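(* For every $\epsilon>0$ there is a set $A\subset\mathbb{P}$ whose relative density $d_{\mathbb{P}}(A)$ (exists and) is at least $1-\epsilon$ such that $\mathbb{P}-A$ is not piecewise syndetic. In particular, $R:=\mathbb{N}\setminus(\mathbb{P}-A)$ is thickly syndetic, but not prime intersective.
   Context: $\mathbb{N}=\{1,2,3,\dots\}$, $[N]=\{1,\dots,N\}$, $\mathbb{P}$ is the set of primes. For $A,E\subset\mathbb{N}$, $E$ infinite, $\overline{d}_E(A)=\limsup_{N}\frac{|A\cap E\cap[N]|}{|E\cap[N]|}$, $\underline{d}_E(A)=\liminf_{N}\frac{|A\cap E\cap[N]|}{|E\cap[N]|}$, and $d_E(A)$ is their common value when equal. $A-B=\{a-b:a\in A,b\in B\}$. $S\subset\mathbb{N}$ is thick if it contains arbitrarily long intervals of consecutive integers; syndetic if $S-F\supset\mathbb{N}$ for some finite $F$; piecewise syndetic if $S=T\cap R$ with $T$ thick and $R$ syndetic; thickly syndetic if it intersects every piecewise syndetic set (equivalently, for every $N$ there is a syndetic $J$ with $[N]+J\subset S$). A set $S\subset\mathbb{Z}$ has one of these properties if $S\cap\mathbb{N}$ does. $R\subset\mathbb{N}$ is prime intersective if for every $A\subset\mathbb{P}$ with $\overline{d}_{\mathbb{P}}(A)>0$ we have $R\cap(A-A)\neq\varnothing$. *)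

theory Defs
  imports
    Complex_Main
    "HOL-Library.Liminf_Limsup"
    "HOL-Library.Extended_Real"
    "HOL-Computational_Algebra.Primes"
begin

text \<open>
  All sets are sets of integers, since difference sets contain negative numbers. The positive
  integers are \<open>pos_ints\<close> (the constant \<open>\<nat>\<close> of the library contains 0).
\<close>

definition pos_ints :: "int set" where
  "pos_ints = {n. 0 < n}"

definition primes :: "int set" where
  "primes = {p. prime p}"

definition diff_set :: "int set \<Rightarrow> int set \<Rightarrow> int set" where
  "diff_set A B = {a - b | a b. a \<in> A \<and> b \<in> B}"

text \<open>
  The finitely many indices for which \<open>E \<inter> {1..N}\<close> is empty contribute the value 0 and
  affect neither limit when \<open>E\<close> contains a positive integer.
\<close>

definition upper_rel_density :: "int set \<Rightarrow> int set \<Rightarrow> ereal" where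
  "upper_rel_density E A =
     limsup (\<lambda>N::nat. ereal (real (card (A \<inter> E \<inter> {1..int N})) / real (card (E \<inter> {1..int N}))))"

definition lower_rel_density :: "int set \<Rightarrow> int set \<Rightarrow> ereal" where
  "lower_rel_density E A =
     liminf (\<lambda>N::nat. ereal (real (card (A \<inter> E \<inter> {1..int N})) / real (card (E \<inter> {1..int N}))))"

definition has_rel_density :: "int set \<Rightarrow> int set \<Rightarrow> real \<Rightarrow> bool" where
  "has_rel_density E A d \<longleftrightarrow>
     upper_rel_density E A = ereal d \<and> lower_rel_density E A = ereal d"

text \<open>
  The notions of largeness for a set of integers refer to its positive part.
\<close>

definition thick :: "int set \<Rightarrow> bool" where
  "thick S \<longleftrightarrow> (\<forall>L::nat. \<exists>a. {a + 1..a + int L} \<subseteq> S \<inter> pos_ints)"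

definition syndetic :: "int set \<Rightarrow> bool" where
  "syndetic S \<longleftrightarrow> (\<exists>F. finite F \<and> pos_ints \<subseteq> diff_set (S \<inter> pos_ints) F)"

definition piecewise_syndetic :: "int set \<Rightarrow> bool" where
  "piecewise_syndetic S \<longleftrightarrow>
     (\<exists>T R. T \<subseteq> pos_ints \<and> R \<subseteq> pos_ints \<and> thick T \<and> syndetic R \<and> S \<inter> pos_ints = T \<inter> R)"

definition thickly_syndetic :: "int set \<Rightarrow> bool" where
  "thickly_syndetic S \<longleftrightarrow>
     (\<forall>B. B \<subseteq> pos_ints \<and> piecewise_syndetic B \<longrightarrow> S \<inter> pos_ints \<inter> B \<noteq> {})"

text \<open>
  Meant for \<open>R \<subseteq> pos_ints\<close>; a set containing 0 satisfies it trivially.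
\<close>

definition prime_intersective :: "int set \<Rightarrow> bool" where
  "prime_intersective R \<longleftrightarrow>
     (\<forall>A. A \<subseteq> primes \<and> upper_rel_density primes A > 0 \<longrightarrow> R \<inter> diff_set A A \<noteq> {})"

end

theory Submission
  imports
    Defs
    "HOL-Number_Theory.Number_Theory"
    "HOL-Computational_Algebra.Squarefree"
    "HOL-Real_Asymp.Real_Asymp"
begin

text \<open>
  Let \<open>q\<close> range over a finite block of primes with large sum of reciprocals. All but a small
  proportion of the primes \<open>a\<close> are 1 modulo some \<open>q\<close> in the block, and if \<open>n + i + 1\<close> is divisible by
  every \<open>q\<close>, then \<open>n + i + a\<close> is composite for these \<open>a\<close>. Using \<open>k\<close> disjoint blocks, one for each
  \<open>i < k\<close>, a whole residue class of \<open>n\<close> has the property that \<open>n, ..., n + k - 1\<close> avoid the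
  differences of primes and non-discarded primes. Discarding at level \<open>k\<close> only primes beyond a threshold
  (the finitely many smaller ones are dealt with by further congruences on \<open>n\<close>) keeps the union of the
  discarded sets small.

  The relative density has to exist, which is arranged by a greedy choice among the remaining primes.
  It succeeds if in every interval the discarded primes are a small proportion of all
  primes up to a negligible error. An upper bound sieve bounds the discarded primes in an interval
  by a small multiple of its length divided by the logarithm, and the prime number theorem bounds the
  primes from below. The latter is derived from Selberg's formula: an extremal deviation
  at \<open>x\<close> forces opposite extremal deviations at \<open>x / p\<close> and \<open>x / (p q)\<close> for most primes \<open>p, q\<close>,
  although primes and products of two primes occur close to each other.
\<close>

section \<open>Selberg's formula\<close>

text \<open>The sieve gains because each q of a block excludes two residues of a discarded prime: 0,
  by primality, and 1. This saves the product of q / (q - 1) over the block, which can be made as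
  large as desired, and it works in every interval without any information on primes in arithmetic
  progressions. There a bound up to a constant factor is enough. The primes themselves must be
  bounded from below with the right constant, since the greedy choice compares discarded primes with
  all primes on intervals of arbitrary position and length; a lower bound of the Chebyshev type
  would allow intervals of positive proportion containing too few primes. Blocks belonging to
  different i have to be disjoint, since n has only one residue modulo each q. The gaps of length k
  start at all large members of a residue class, hence occur in every long interval of a thick set,
  where a syndetic set meets every stretch of some fixed length; so no piecewise syndetic set fits
  into the differences. Intersectivity fails because A - A is contained in the set of differences
  between primes and elements of A.\<close>

definition ints :: "real \<Rightarrow> nat set" where
  "ints x = {n. 0 < n \<and> real n \<le> x}"

lemma ints_eq: "ints x = {1..nat \<lfloor>x\<rfloor>}"
proof -
  have "real n \<le> x \<longleftrightarrow> n \<le> nat \<lfloor>x\<rfloor>" if "n > 0" for n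
    using that by linarith
  then show ?thesis by (auto simp: ints_def)
qed

lemma finite_ints [simp, intro]: "finite (ints x)"
  by (simp add: ints_eq)

lemma ints_of_nat: "ints (real n) = {1..n}"
  by (simp add: ints_eq)

lemma ints_empty: "x < 1 \<Longrightarrow> ints x = {}"
  by (auto simp: ints_def)

lemma ints_mono: "x \<le> y \<Longrightarrow> ints x \<subseteq> ints y"
  by (auto simp: ints_def)

lemma ints_mult_iff: "a > 0 \<Longrightarrow> b \<in> ints (x / real a) \<longleftrightarrow> 0 < b \<and> real (a * b) \<le> x"
  by (auto simp: ints_def field_simps)

text \<open>Pairs (a, b) with a b \<le> x are grouped by their product n. This is the form in which
  summatory functions of Dirichlet convolutions are rearranged below.\<close>

lemma sum_ints_divisors:
  "(\<Sum>a\<in>ints x. \<Sum>b\<in>ints (x / real a). F a b) = (\<Sum>n\<in>ints x. \<Sum>d | d dvd n. F d (n div d))"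
proof -
  have fin: "finite {d. d dvd n}" if "n \<in> ints x" for n :: nat
    using that by (auto simp: ints_def)
  have "(\<Sum>a\<in>ints x. \<Sum>b\<in>ints (x / real a). F a b)
      = (\<Sum>(a,b)\<in>(SIGMA a:ints x. ints (x / real a)). F a b)"
    by (rule sum.Sigma) auto
  also have "\<dots> = (\<Sum>(n,d)\<in>(SIGMA n:ints x. {d. d dvd n}). F d (n div d))"
    by (rule sum.reindex_bij_witness[where i = "\<lambda>(n,d). (d, n div d)" and j = "\<lambda>(a,b). (a * b, a)"])
       (auto simp: ints_def field_simps dvd_def split: prod.splits simp flip: of_nat_mult
             intro: order_trans[rotated])
  also have "\<dots> = (\<Sum>n\<in>ints x. \<Sum>d | d dvd n. F d (n div d))"
    using fin by (intro sum.Sigma[symmetric]) auto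
  finally show ?thesis .
qed

section \<open>Moebius inversion\<close>

definition moebius :: "nat \<Rightarrow> real" where
  "moebius n = (if squarefree n then (-1) ^ card (prime_factors n) else 0)"

lemma abs_moebius_le_1: "\<bar>moebius n\<bar> \<le> 1"
  by (simp add: moebius_def power_abs)

lemma prime_factors_prod_primes:
  assumes "finite T" "\<And>p. p \<in> T \<Longrightarrow> prime p"
  shows "prime_factors (\<Prod>T :: nat) = T"
proof -
  have "prime_factors (\<Prod>p\<in>T. p) = \<Union>((prime_factors \<circ> (\<lambda>p. p)) ` T)"
    using assms(1) not_prime_0 assms(2)[of 0] by (intro prime_factors_prod) auto
  also have "\<dots> = T"
    using assms by (auto simp: prime_prime_factors)
  finally show ?thesis by simp
qed

text \<open>Squarefree divisors correspond to sets of prime factors, so the sum is the expansion of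
  the product of (-1) + 1 over the primes dividing n.\<close>

lemma sum_moebius_divisors:
  assumes "n > 0"
  shows "(\<Sum>d | d dvd n. moebius d) = (if n = 1 then 1 else 0)"
proof -
  let ?P = "prime_factors n"
  have P: "prime p" if "p \<in> ?P" for p using that by auto
  have sqf: "squarefree (\<Prod>T)" if "T \<subseteq> ?P" for T
    using that P by (intro squarefree_prod_coprime) (auto intro!: primes_coprime squarefree_prime)
  have eq: "\<Prod>(prime_factors d) = d" if "squarefree d" for d :: nat
  proof -
    have "d \<noteq> 0" using that by (intro notI) auto
    then have "d = (\<Prod>p\<in>prime_factors d. p ^ multiplicity p d)"
      by (simp add: prod_prime_factors)
    also have "\<dots> = (\<Prod>p\<in>prime_factors d. p)"
    proof (intro prod.cong refl)
      fix p assume p: "p \<in> prime_factors d"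
      then have "multiplicity p d \<le> 1" "multiplicity p d > 0"
        using that \<open>d \<noteq> 0\<close> by (auto simp: squarefree_factorial_semiring'' prime_factors_multiplicity)
      then have "multiplicity p d = 1" by linarith
      then show "p ^ multiplicity p d = p" by simp
    qed
    finally show ?thesis by simp
  qed
  have "(\<Sum>d | d dvd n. moebius d) = (\<Sum>d | d dvd n \<and> squarefree d. (-1) ^ card (prime_factors d))"
    using assms by (intro sum.mono_neutral_cong_right) (auto simp: moebius_def)
  also have "\<dots> = (\<Sum>T\<in>Pow ?P. (-1) ^ card T)"
  proof (rule sum.reindex_bij_witness[where i = "\<lambda>T. \<Prod>T" and j = prime_factors], goal_cases)
    case (1 d) then show ?case using eq by auto
  next
    case (2 d) then show ?case using assms by (auto intro: dvd_trans simp: prime_factors_dvd)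
  next
    case (3 T) then show ?case by (intro prime_factors_prod_primes) (auto intro: finite_subset[of _ ?P])
  next
    case (4 T)
    have "\<Prod>T dvd \<Prod>?P" using 4 by (intro prod_dvd_prod_subset) auto
    also have "\<Prod>?P dvd (\<Prod>p\<in>?P. p ^ multiplicity p n)"
      by (intro prod_dvd_prod) (auto simp: prime_factors_multiplicity dvd_power)
    also have "\<dots> = n" using assms by (simp add: prod_prime_factors)
    finally show ?case using 4 sqf by auto
  next
    case (5 d) then show ?case by simp
  qed
  also have "\<dots> = (\<Prod>p\<in>?P. ((-1) + 1))"
    by (subst prod_add) simp_all
  also have "\<dots> = (if n = 1 then 1 else 0)"
  proof (cases "n = 1")
    case False
    then obtain p where "prime p" "p dvd n" using prime_factor_nat by blast
    then have "p \<in> ?P" using assms by (simp add: prime_factors_dvd)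
    then show ?thesis using False by (subst prod_zero) auto
  qed simp
  finally show ?thesis .
qed

text \<open>Inversion for functions of a real variable: bounds for the sums of R (y / n) at the
  points y = x / d add up to a bound for R x, because the Moebius function is at most 1 in absolute
  value.\<close>

lemma moebius_inversion_ints:
  fixes R :: "real \<Rightarrow> real"
  assumes "x \<ge> 1"
  shows "(\<Sum>d\<in>ints x. moebius d * (\<Sum>n\<in>ints (x / real d). R (x / real d / real n))) = R x"
proof -
  have "(\<Sum>d\<in>ints x. moebius d * (\<Sum>n\<in>ints (x / real d). R (x / real d / real n)))
      = (\<Sum>d\<in>ints x. \<Sum>n\<in>ints (x / real d). moebius d * R (x / real d / real n))"
    by (simp add: sum_distrib_left)
  also have "\<dots> = (\<Sum>n\<in>ints x. \<Sum>d | d dvd n. moebius d * R (x / real d / real (n div d)))"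
    by (rule sum_ints_divisors)
  also have "\<dots> = (\<Sum>n\<in>ints x. \<Sum>d | d dvd n. moebius d * R (x / real n))"
    by (intro sum.cong) (auto simp: ints_def elim!: dvdE)
  also have "\<dots> = (\<Sum>n\<in>ints x. if n = 1 then R x else 0)"
    by (intro sum.cong refl)
       (simp add: sum_distrib_right[symmetric] sum_moebius_divisors ints_def)
  also have "\<dots> = R x"
    using assms by (subst sum.delta) (auto, auto simp: ints_def)
  finally show ?thesis .
qed

section \<open>Sums of monotone functions compared with integrals\<close>

lemma sum_antimono_asymptotics:
  fixes f F :: "real \<Rightarrow> real"
  assumes deriv: "\<And>t. t \<ge> 1 \<Longrightarrow> (F has_real_derivative f t) (at t)"
    and anti: "\<And>s t. 1 \<le> s \<Longrightarrow> s \<le> t \<Longrightarrow> f t \<le> f s"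
    and nonneg: "\<And>t. t \<ge> 1 \<Longrightarrow> f t \<ge> 0"
  obtains c where "\<And>y. y \<ge> 1 \<Longrightarrow> \<bar>(\<Sum>n\<in>ints y. f (real n)) - F y - c\<bar> \<le> f (real_of_int \<lfloor>y\<rfloor>)"
proof -
  have step: "F t - F s \<le> (t - s) * f s \<and> F t - F s \<ge> (t - s) * f t" if st: "1 \<le> s" "s \<le> t" for s t
  proof (cases "s = t")
    case False
    then obtain z where "s < z" "z < t" "F t - F s = (t - s) * f z"
      using MVT2[of s t F f] deriv st by force
    then show ?thesis using st anti[of s z] anti[of z t] by (auto intro!: mult_left_mono)
  qed auto
  \<comment> \<open>The deviation from \<open>F\<close> decreases along the integers, but increases
    once the last term is subtracted. It therefore converges, and the limit c lies between the two
    sequences.\<close>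
  define a where "a = (\<lambda>n::nat. (\<Sum>k=1..Suc n. f (real k)) - F (real (Suc n)))"
  have dec: "decseq a"
  proof (rule decseq_SucI)
    fix n show "a (Suc n) \<le> a n"
      using step[of "real (Suc n)" "real (Suc (Suc n))"] by (simp add: a_def)
  qed
  have inc: "incseq (\<lambda>n. a n - f (real (Suc n)))"
  proof (rule incseq_SucI)
    fix n show "a n - f (real (Suc n)) \<le> a (Suc n) - f (real (Suc (Suc n)))"
      using step[of "real (Suc n)" "real (Suc (Suc n))"] by (simp add: a_def)
  qed
  have lb: "a n \<ge> a 0 - f 1" for n
    using incseqD[OF inc, of 0 n] nonneg[of "real (Suc n)"] by simp
  obtain c where c: "a \<longlonglongrightarrow> c" "\<And>n. c \<le> a n"
    using decseq_convergent[OF dec, of "a 0 - f 1"] lb by blast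
  have up: "a n - f (real (Suc n)) \<le> c" for n
  proof (rule LIMSEQ_le_const[OF c(1)])
    show "\<exists>N. \<forall>k\<ge>N. a n - f (real (Suc n)) \<le> a k"
    proof (intro exI allI impI)
      fix k assume "n \<le> k"
      from incseqD[OF inc this] nonneg[of "real (Suc k)"] show "a n - f (real (Suc n)) \<le> a k" by simp
    qed
  qed
  show ?thesis
  proof (rule that)
    fix y :: real assume y: "y \<ge> 1"
    define n where "n = nat \<lfloor>y\<rfloor> - 1"
    have n: "nat \<lfloor>y\<rfloor> = Suc n" using y by (simp add: n_def le_nat_iff le_floor_iff)
    then have fl: "\<lfloor>y\<rfloor> = int (Suc n)" by linarith
    have ny: "real (Suc n) \<le> y" "y - real (Suc n) < 1" using fl by linarith+
    have f0: "f (real (Suc n)) \<ge> 0" "f y \<ge> 0" using nonneg y by auto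
    have "F y - F (real (Suc n)) \<ge> (y - real (Suc n)) * f y"
         "F y - F (real (Suc n)) \<le> (y - real (Suc n)) * f (real (Suc n))"
      using step[of "real (Suc n)" y] ny by auto
    moreover have "(y - real (Suc n)) * f y \<ge> 0" "(y - real (Suc n)) * f (real (Suc n)) \<le> f (real (Suc n))"
      using ny f0 by (auto intro!: mult_left_le_one_le mult_nonneg_nonneg)
    ultimately have "F y - F (real (Suc n)) \<ge> 0" "F y - F (real (Suc n)) \<le> f (real (Suc n))" by linarith+
    moreover have "(\<Sum>n\<in>ints y. f (real n)) = (\<Sum>k=1..Suc n. f (real k))" by (simp only: ints_eq n)
    moreover have "f (real_of_int \<lfloor>y\<rfloor>) = f (real (Suc n))" by (simp only: fl of_int_of_nat_eq)
    ultimately show "\<bar>(\<Sum>n\<in>ints y. f (real n)) - F y - c\<bar> \<le> f (real_of_int \<lfloor>y\<rfloor>)"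
      using c(2)[of n] up[of n] unfolding a_def by linarith
  qed
qed

text \<open>For increasing f the deviation need not converge; at integers it stays between 0 and the
  last term, by the mean value theorem on each unit step.\<close>

lemma sum_mono_asymptotics:
  fixes f F :: "real \<Rightarrow> real"
  assumes deriv: "\<And>t. t \<ge> 1 \<Longrightarrow> (F has_real_derivative f t) (at t)"
    and mono: "\<And>s t. 1 \<le> s \<Longrightarrow> s \<le> t \<Longrightarrow> f s \<le> f t"
    and nonneg: "\<And>t. t \<ge> 1 \<Longrightarrow> f t \<ge> 0" and y: "y \<ge> 1"
  shows "\<bar>(\<Sum>n\<in>ints y. f (real n)) - (F y - F 1)\<bar> \<le> f y"
proof -
  have step: "F t - F s \<ge> (t - s) * f s \<and> F t - F s \<le> (t - s) * f t" if st: "1 \<le> s" "s \<le> t" for s t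
  proof (cases "s = t")
    case False
    then obtain z where "s < z" "z < t" "F t - F s = (t - s) * f z"
      using MVT2[of s t F f] deriv st by force
    then show ?thesis using st mono[of s z] mono[of z t] by (auto intro!: mult_left_mono)
  qed auto
  have ind: "0 \<le> (\<Sum>k=1..Suc n. f (real k)) - (F (real (Suc n)) - F 1)
     \<and> (\<Sum>k=1..Suc n. f (real k)) - (F (real (Suc n)) - F 1) \<le> f (real (Suc n))" for n
  proof (induction n)
    case 0 then show ?case using nonneg[of 1] by simp
  next
    case (Suc n)
    then show ?case using step[of "real (Suc n)" "real (Suc (Suc n))"] by simp
  qed
  define n where "n = nat \<lfloor>y\<rfloor> - 1"
  have n: "nat \<lfloor>y\<rfloor> = Suc n" using y by (simp add: n_def le_nat_iff le_floor_iff)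
  then have fl: "\<lfloor>y\<rfloor> = int (Suc n)" by linarith
  have ny: "real (Suc n) \<le> y" "y - real (Suc n) < 1" using fl by linarith+
  have f0: "f (real (Suc n)) \<ge> 0" "f y \<ge> 0" using nonneg y by auto
  have "F y - F (real (Suc n)) \<ge> (y - real (Suc n)) * f (real (Suc n))"
       "F y - F (real (Suc n)) \<le> (y - real (Suc n)) * f y"
    using step[of "real (Suc n)" y] ny by auto
  moreover have "(y - real (Suc n)) * f (real (Suc n)) \<ge> 0" "(y - real (Suc n)) * f y \<le> f y"
    using ny f0 by (auto intro!: mult_left_le_one_le mult_nonneg_nonneg)
  ultimately have "F y - F (real (Suc n)) \<ge> 0" "F y - F (real (Suc n)) \<le> f y" by linarith+
  moreover have "(\<Sum>n\<in>ints y. f (real n)) = (\<Sum>k=1..Suc n. f (real k))" by (simp only: ints_eq n)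
  moreover have "f (real (Suc n)) \<le> f y" using mono[of "real (Suc n)" y] ny by simp
  ultimately show ?thesis using ind[of n] by linarith
qed

lemma sum_inverse_sqrt_le: "(\<Sum>k=1..n. 1 / sqrt (real k)) \<le> 2 * sqrt (real n)"
proof (induction n)
  case (Suc n)
  have "1 / sqrt (real (Suc n)) \<le> 2 * (sqrt (real (Suc n)) - sqrt (real n))"
  proof -
    let ?a = "sqrt (real (Suc n))" and ?b = "sqrt (real n)"
    have "(?a - ?b) * (?a + ?b) = 1" by (simp add: algebra_simps)
    moreover have "?b \<le> ?a" "?a > 0" "?b \<ge> 0" by auto
    moreover from this have "(?a - ?b) * (?a + ?b) \<le> (?a - ?b) * (2 * ?a)"
      by (intro mult_left_mono) auto
    ultimately show ?thesis by (simp add: field_simps)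
  qed
  with Suc show ?case by simp
qed simp

text \<open>Selberg's generalised von Mangoldt function, the Dirichlet convolution of the Moebius
  function with the square of the logarithm.\<close>

definition mangoldt2 :: "nat \<Rightarrow> real" where
  "mangoldt2 n = mangoldt n * ln (real n) + (\<Sum>d | d dvd n. mangoldt d * mangoldt (n div d))"

lemma mangoldt2_nonneg: "mangoldt2 n \<ge> 0"
  unfolding mangoldt2_def
  by (cases "n = 0") (auto intro!: add_nonneg_nonneg mult_nonneg_nonneg sum_nonneg mangoldt_nonneg)

lemma sum_divisors_flip:
  fixes n :: nat assumes "n > 0"
  shows "(\<Sum>d | d dvd n. g (n div d)) = (\<Sum>d | d dvd n. g d)"
  by (rule sum.reindex_bij_witness[where i = "\<lambda>d. n div d" and j = "\<lambda>d. n div d"])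
     (use assms in \<open>auto elim!: dvdE\<close>)

text \<open>Chains e | d | n are regrouped by e and d / e. The inner sum over d / e gives ln n - ln
  e, and the term with ln e cancels the first part of \<open>mangoldt2\<close>.\<close>

lemma sum_mangoldt2_divisors:
  assumes "n > 0"
  shows "(\<Sum>d | d dvd n. mangoldt2 d) = (ln (real n))\<^sup>2"
proof -
  have fin: "finite {e. e dvd d}" if "d dvd n" for d
    using assms that by (intro finite_divisors_nat) (auto elim!: dvdE)
  have "(\<Sum>d | d dvd n. \<Sum>e | e dvd d. mangoldt e * mangoldt (d div e))
      = (\<Sum>(d,e)\<in>(SIGMA d:{d. d dvd n}. {e. e dvd d}). mangoldt e * mangoldt (d div e) :: real)"
    using fin assms by (intro sum.Sigma) auto
  also have "\<dots> = (\<Sum>(e,f)\<in>(SIGMA e:{e. e dvd n}. {f. f dvd n div e}). mangoldt e * mangoldt f)"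
    by (rule sum.reindex_bij_witness[where i = "\<lambda>(e,f). (e * f, e)" and j = "\<lambda>(d,e). (e, d div e)"])
       (use assms in \<open>auto elim!: dvdE\<close>)
  also have "\<dots> = (\<Sum>e | e dvd n. \<Sum>f | f dvd n div e. mangoldt e * mangoldt f)"
    using assms by (intro sum.Sigma[symmetric]) (auto elim!: dvdE)
  also have "\<dots> = (\<Sum>e | e dvd n. mangoldt e * (ln (real n) - ln (real e)))"
  proof (intro sum.cong refl)
    fix e assume "e \<in> {e. e dvd n}"
    then have e: "n div e > 0" "real n = real e * real (n div e)" "e > 0"
      using assms by (auto elim!: dvdE)
    then have "(\<Sum>f | f dvd n div e. mangoldt e * mangoldt f) = mangoldt e * ln (real (n div e))"
      using mangoldt_sum[of "n div e", where ?'a = real] by (simp add: sum_distrib_left[symmetric])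
    also have "ln (real (n div e)) = ln (real n) - ln (real e)"
      using e by (simp add: ln_mult)
    finally show "(\<Sum>f | f dvd n div e. mangoldt e * mangoldt f) = mangoldt e * (ln (real n) - ln (real e))" .
  qed
  finally have "(\<Sum>d | d dvd n. mangoldt2 d) = (\<Sum>d | d dvd n. mangoldt d * ln (real n))"
    by (simp add: mangoldt2_def sum.distrib algebra_simps sum_subtractf)
  also have "\<dots> = (ln (real n))\<^sup>2"
    using mangoldt_sum[of n, where ?'a = real] assms
    by (simp add: sum_distrib_right[symmetric] power2_eq_square)
  finally show ?thesis .
qed

definition selberg_sum :: "real \<Rightarrow> real" where
  "selberg_sum x = (\<Sum>n\<in>ints x. mangoldt2 n)"

lemma sum_selberg_sum: "(\<Sum>m\<in>ints x. selberg_sum (x / real m)) = (\<Sum>n\<in>ints x. (ln (real n))\<^sup>2)"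
proof -
  have "(\<Sum>m\<in>ints x. selberg_sum (x / real m)) = (\<Sum>n\<in>ints x. \<Sum>d | d dvd n. mangoldt2 (n div d))"
    unfolding selberg_sum_def by (rule sum_ints_divisors)
  also have "\<dots> = (\<Sum>n\<in>ints x. (ln (real n))\<^sup>2)"
    by (intro sum.cong refl) (simp add: sum_divisors_flip sum_mangoldt2_divisors ints_def)
  finally show ?thesis .
qed

lemma ln_le_sqrt:
  assumes "y \<ge> (1::real)" shows "ln y \<le> 2 * sqrt y" "(ln y)\<^sup>2 \<le> 16 * sqrt y"
proof -
  have "ln y = 2 * ln (sqrt y)" using assms by (simp add: ln_sqrt)
  moreover have "ln (sqrt y) \<le> sqrt y" using ln_le_minus_one[of "sqrt y"] assms by simp
  ultimately show "ln y \<le> 2 * sqrt y" by simp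
  have "ln y = 4 * ln (sqrt (sqrt y))" using assms by (simp add: ln_sqrt)
  moreover have "ln (sqrt (sqrt y)) \<le> sqrt (sqrt y)" using ln_le_minus_one[of "sqrt (sqrt y)"] assms by simp
  ultimately have "ln y \<le> 4 * sqrt (sqrt y)" by simp
  then have "(ln y)\<^sup>2 \<le> (4 * sqrt (sqrt y))\<^sup>2" using assms by (intro power_mono) auto
  then show "(ln y)\<^sup>2 \<le> 16 * sqrt y" using assms by (simp add: power_mult_distrib)
qed

text \<open>The function \<open>2 y ln y + a y + b\<close> has, for suitable \<open>a\<close> and \<open>b\<close>, the same summatory function as
  the Selberg sum up to \<open>O(sqrt y)\<close>; Moebius inversion then loses only \<open>O(x)\<close>.\<close>

lemma selberg_comparison:
  obtains a b C :: real where "C \<ge> 0"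
    "\<And>y. y \<ge> 1 \<Longrightarrow> \<bar>(\<Sum>n\<in>ints y. (ln (real n))\<^sup>2)
        - (\<Sum>n\<in>ints y. 2 * (y / real n) * ln (y / real n) + a * (y / real n) + b)\<bar> \<le> C * sqrt y"
proof -
  obtain g where g: "\<And>y. y \<ge> 1 \<Longrightarrow> \<bar>(\<Sum>n\<in>ints y. 1 / real n) - ln y - g\<bar> \<le> 1 / real_of_int \<lfloor>y\<rfloor>"
  proof (rule sum_antimono_asymptotics[of ln "\<lambda>t. 1 / t"])
    show "(ln has_real_derivative 1 / t) (at t)" if "t \<ge> 1" for t :: real
      using that by (auto intro!: derivative_eq_intros)
  qed (auto simp: field_simps)
  obtain c where c: "\<And>y. y \<ge> 1 \<Longrightarrow> \<bar>(\<Sum>n\<in>ints y. (1 + ln (real n)) / real n) - (ln y + (ln y)\<^sup>2 / 2) - c\<bar>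
      \<le> (1 + ln (real_of_int \<lfloor>y\<rfloor>)) / real_of_int \<lfloor>y\<rfloor>"
  proof (rule sum_antimono_asymptotics[of "\<lambda>t. ln t + (ln t)\<^sup>2 / 2" "\<lambda>t. (1 + ln t) / t"])
    show "((\<lambda>t. ln t + (ln t)\<^sup>2 / 2) has_real_derivative (1 + ln t) / t) (at t)" if "t \<ge> 1" for t :: real
      using that by (auto intro!: derivative_eq_intros simp: field_simps)
    show "(1 + ln t) / t \<le> (1 + ln s) / s" if "1 \<le> s" "s \<le> t" for s t :: real
    proof (rule DERIV_nonpos_imp_nonincreasing[OF that(2)])
      fix x assume "s \<le> x" "x \<le> t"
      then have "((\<lambda>x. (1 + ln x) / x) has_real_derivative - ln x / x\<^sup>2) (at x)" "- ln x / x\<^sup>2 \<le> 0"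
        using that by (auto intro!: derivative_eq_intros simp: field_simps power2_eq_square)
      then show "\<exists>y. ((\<lambda>x. (1 + ln x) / x) has_real_derivative y) (at x) \<and> y \<le> 0" by blast
    qed
  qed auto
  \<comment> \<open>The constants g and c come from the sums of 1 / n and (1 + ln n) / n. This a
    makes the coefficient of y ln y equal to -2, and this b makes the coefficient of y equal to 2,
    matching the sum of the squared logarithms.\<close>
  define a where "a = - 2 - 2 * g"
  define b where "b = 2 + 2 * c + 2 * g\<^sup>2"
  define C where "C = 32 + 10 + 2 * \<bar>a\<bar> + \<bar>b\<bar>"
  show ?thesis
  proof (rule that[of C a b])
    show "C \<ge> 0" by (simp add: C_def)
    fix y :: real assume y: "y \<ge> 1"
    define l where "l = ln y"
    have l0: "l \<ge> 0" using y by (simp add: l_def)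
    define H where "H = (\<Sum>n\<in>ints y. 1 / real n)"
    define H2 where "H2 = (\<Sum>n\<in>ints y. (1 + ln (real n)) / real n)"
    define L2 where "L2 = (\<Sum>n\<in>ints y. (ln (real n))\<^sup>2)"
    define K where "K = (\<Sum>n\<in>ints y. 2 * (y / real n) * ln (y / real n) + a * (y / real n) + b)"
    define fl where "fl = real_of_int \<lfloor>y\<rfloor>"
    have fl: "fl \<ge> 1" "fl \<le> y" "y - 1 < fl" using y unfolding fl_def by auto
    then have fl2: "y / 2 \<le> fl" by linarith
    have e1: "\<bar>L2 - (y * l\<^sup>2 - 2 * y * l + 2 * y)\<bar> \<le> l\<^sup>2 + 2"
    proof -
      have "\<bar>(\<Sum>n\<in>ints y. (ln (real n))\<^sup>2) - ((y * (ln y)\<^sup>2 - 2 * y * ln y + 2 * y) - (1 * (ln 1)\<^sup>2 - 2 * 1 * ln 1 + 2 * 1))\<bar> \<le> (ln y)\<^sup>2"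
        using y by (intro sum_mono_asymptotics[where F = "\<lambda>t. t * (ln t)\<^sup>2 - 2 * t * ln t + 2 * t" and f = "\<lambda>t. (ln t)\<^sup>2"])
          (auto intro!: derivative_eq_intros mult_mono simp: field_simps power2_eq_square)
      then show ?thesis unfolding L2_def l_def by simp
    qed
    define e2 where "e2 = H - l - g"
    have e2: "\<bar>e2\<bar> \<le> 2 / y"
    proof -
      have "\<bar>e2\<bar> \<le> 1 / fl" using g[OF y] by (simp add: e2_def H_def l_def fl_def)
      also have "\<dots> \<le> 1 / (y / 2)" using fl2 y by (intro divide_left_mono) auto
      finally show ?thesis by simp
    qed
    define e3 where "e3 = H2 - (l + l\<^sup>2 / 2) - c"
    have e3: "\<bar>e3\<bar> \<le> 2 * (1 + l) / y"
    proof -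
      have "\<bar>e3\<bar> \<le> (1 + ln fl) / fl" using c[OF y] by (simp add: e3_def H2_def l_def fl_def)
      also have "\<dots> \<le> (1 + l) / (y / 2)" using fl2 fl y by (intro frac_le) (auto simp: l_def)
      finally show ?thesis by (simp add: mult.commute)
    qed
    have "K = (\<Sum>n\<in>ints y. y * (2 * l + 2 + a) * (1 / real n) - 2 * y * ((1 + ln (real n)) / real n) + b)"
      unfolding K_def
    proof (intro sum.cong refl)
      fix n assume "n \<in> ints y"
      then have n: "real n > 0" by (simp add: ints_def)
      then have lnq: "ln (y / real n) = l - ln (real n)" using y by (simp add: ln_div l_def)
      show "2 * (y / real n) * ln (y / real n) + a * (y / real n) + b
          = y * (2 * l + 2 + a) * (1 / real n) - 2 * y * ((1 + ln (real n)) / real n) + b"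
        unfolding lnq using n by (simp add: field_simps)
    qed
    also have "\<dots> = y * (2 * l + 2 + a) * H - 2 * y * H2 + b * fl"
      using y by (simp add: sum.distrib sum_subtractf sum_distrib_left H_def H2_def ints_eq fl_def)
    finally have K: "K = y * (2 * l + 2 + a) * (l + g + e2) - 2 * y * (l + l\<^sup>2 / 2 + c + e3) + b * fl"
      by (simp add: e2_def e3_def)
    have "K - (y * l\<^sup>2 - 2 * y * l + 2 * y) = (2 * l + 2 + a) * (y * e2) - 2 * (y * e3) - b * (y - fl)"
      unfolding K a_def b_def by (simp add: algebra_simps power2_eq_square)
    also have "\<bar>\<dots>\<bar> \<le> (2 * l + 2 + \<bar>a\<bar>) * 2 + 2 * (2 * (1 + l)) + \<bar>b\<bar>"
    proof -
      have "\<bar>y * e2\<bar> \<le> 2" "\<bar>y * e3\<bar> \<le> 2 * (1 + l)" using e2 e3 y by (auto simp: abs_mult field_simps)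
      moreover have "\<bar>2 * l + 2 + a\<bar> \<le> 2 * l + 2 + \<bar>a\<bar>" using l0 by linarith
      ultimately have "\<bar>(2 * l + 2 + a) * (y * e2)\<bar> \<le> (2 * l + 2 + \<bar>a\<bar>) * 2"
        unfolding abs_mult[of "2 * l + 2 + a"] by (intro mult_mono) (use l0 in auto)
      moreover have "\<bar>b * (y - fl)\<bar> \<le> \<bar>b\<bar>"
        unfolding abs_mult using fl by (intro mult_left_le) auto
      ultimately show ?thesis using \<open>\<bar>y * e3\<bar> \<le> 2 * (1 + l)\<close> by linarith
    qed
    finally have e4: "\<bar>K - (y * l\<^sup>2 - 2 * y * l + 2 * y)\<bar> \<le> (2 * l + 2 + \<bar>a\<bar>) * 2 + 2 * (2 * (1 + l)) + \<bar>b\<bar>" .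
    have tri: "\<bar>L2 - K\<bar> \<le> \<bar>L2 - m\<bar> + \<bar>K - m\<bar>" for m by linarith
    have "\<bar>L2 - K\<bar> \<le> (l\<^sup>2 + 2) + ((2 * l + 2 + \<bar>a\<bar>) * 2 + 2 * (2 * (1 + l)) + \<bar>b\<bar>)"
      by (rule order_trans[OF tri add_mono[OF e1 e4]])
    also have "\<dots> = l\<^sup>2 + 8 * l + (10 + 2 * \<bar>a\<bar> + \<bar>b\<bar>)" by (simp add: algebra_simps)
    finally have "\<bar>L2 - K\<bar> \<le> l\<^sup>2 + 8 * l + (10 + 2 * \<bar>a\<bar> + \<bar>b\<bar>)" .
    also have "l\<^sup>2 + 8 * l + (10 + 2 * \<bar>a\<bar> + \<bar>b\<bar>) \<le> 16 * sqrt y + 8 * (2 * sqrt y) + (10 + 2 * \<bar>a\<bar> + \<bar>b\<bar>) * sqrt y"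
    proof -
      have "(10 + 2 * \<bar>a\<bar> + \<bar>b\<bar>) * 1 \<le> (10 + 2 * \<bar>a\<bar> + \<bar>b\<bar>) * sqrt y"
        using y by (intro mult_left_mono) auto
      then show ?thesis using ln_le_sqrt[OF y] by (simp add: l_def)
    qed
    also have "\<dots> = C * sqrt y" by (simp add: C_def algebra_simps)
    finally show "\<bar>(\<Sum>n\<in>ints y. (ln (real n))\<^sup>2)
        - (\<Sum>n\<in>ints y. 2 * (y / real n) * ln (y / real n) + a * (y / real n) + b)\<bar> \<le> C * sqrt y"
      by (simp add: L2_def K_def)
  qed
qed

theorem selberg_formula:
  obtains C where "C > 0" "\<And>x. x \<ge> 1 \<Longrightarrow> \<bar>selberg_sum x - 2 * x * ln x\<bar> \<le> C * x"
proof -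
  obtain a b C where C: "C \<ge> 0"
    and *: "\<And>y. y \<ge> 1 \<Longrightarrow> \<bar>(\<Sum>n\<in>ints y. (ln (real n))\<^sup>2)
        - (\<Sum>n\<in>ints y. 2 * (y / real n) * ln (y / real n) + a * (y / real n) + b)\<bar> \<le> C * sqrt y"
    by (rule selberg_comparison) (rule that)
  define R where "R = (\<lambda>y. selberg_sum y - (2 * y * ln y + a * y + b))"
  have R: "\<bar>\<Sum>n\<in>ints y. R (y / real n)\<bar> \<le> C * sqrt y" if "y \<ge> 1" for y
    using *[OF that] by (simp add: R_def sum_subtractf sum_selberg_sum)
  have "\<bar>selberg_sum x - 2 * x * ln x\<bar> \<le> (2 * C + \<bar>a\<bar> + \<bar>b\<bar> + 1) * x" if x: "x \<ge> 1" for x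
  proof -
    have "\<bar>R x\<bar> = \<bar>\<Sum>d\<in>ints x. moebius d * (\<Sum>n\<in>ints (x / real d). R (x / real d / real n))\<bar>"
      by (simp only: moebius_inversion_ints[OF x])
    also have "\<dots> \<le> (\<Sum>d\<in>ints x. C * sqrt (x / real d))"
    proof (rule order_trans[OF sum_abs sum_mono])
      fix d assume d: "d \<in> ints x"
      have "\<bar>moebius d * (\<Sum>n\<in>ints (x / real d). R (x / real d / real n))\<bar> \<le> 1 * (C * sqrt (x / real d))"
        unfolding abs_mult using d by (intro mult_mono abs_moebius_le_1 R) (auto simp: ints_def)
      then show "\<bar>moebius d * (\<Sum>n\<in>ints (x / real d). R (x / real d / real n))\<bar> \<le> C * sqrt (x / real d)"
        by simp
    qed
    also have "\<dots> = C * sqrt x * (\<Sum>k=1..nat \<lfloor>x\<rfloor>. 1 / sqrt (real k))"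
      by (simp add: ints_eq real_sqrt_divide sum_distrib_left)
    also have "\<dots> \<le> C * sqrt x * (2 * sqrt x)"
    proof -
      have "(\<Sum>k=1..nat \<lfloor>x\<rfloor>. 1 / sqrt (real k)) \<le> 2 * sqrt (real (nat \<lfloor>x\<rfloor>))" by (rule sum_inverse_sqrt_le)
      also have "\<dots> \<le> 2 * sqrt x" using x by simp
      finally show ?thesis using C x by (intro mult_left_mono) auto
    qed
    also have "\<dots> = 2 * C * x" using x by simp
    finally have "\<bar>selberg_sum x - 2 * x * ln x\<bar> \<le> 2 * C * x + \<bar>a * x + b\<bar>" unfolding R_def by linarith
    also have "\<bar>a * x + b\<bar> \<le> \<bar>a\<bar> * x + \<bar>b\<bar> * x"
      using x mult_left_mono[of 1 x "\<bar>b\<bar>"] by (intro order_trans[OF abs_triangle_ineq]) (auto simp: abs_mult)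
    finally show ?thesis using x by (simp add: algebra_simps)
  qed
  moreover have "2 * C + \<bar>a\<bar> + \<bar>b\<bar> + 1 > 0" using C by linarith
  ultimately show ?thesis using that by blast
qed

section \<open>The prime number theorem\<close>

definition psi :: "real \<Rightarrow> real" where
  "psi x = (\<Sum>n\<in>ints x. mangoldt n)"

lemma psi_mono: "x \<le> y \<Longrightarrow> psi x \<le> psi y"
  unfolding psi_def by (intro sum_mono2 ints_mono mangoldt_nonneg) auto

lemma psi_nonneg: "psi x \<ge> 0"
  unfolding psi_def by (intro sum_nonneg mangoldt_nonneg)

lemma psi_eq_0: "x < 2 \<Longrightarrow> psi x = 0"
proof -
  assume "x < 2"
  then have "mangoldt n = (0::real)" if "n \<in> ints x" for n
  proof -
    have "n = 1" using that \<open>x < 2\<close> by (auto simp: ints_def)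
    then show ?thesis by simp
  qed
  then show "psi x = 0" by (simp add: psi_def)
qed

lemma card_ints: "x \<ge> 0 \<Longrightarrow> real (card (ints x)) \<le> x" "x \<ge> 0 \<Longrightarrow> x - 1 < real (card (ints x))"
  by (auto simp: ints_eq)

lemma psi_le_trivial: "x \<ge> 1 \<Longrightarrow> psi x \<le> x * ln x"
proof -
  assume x: "x \<ge> 1"
  have "psi x \<le> (\<Sum>n\<in>ints x. ln x)"
    unfolding psi_def
  proof (rule sum_mono)
    fix n assume "n \<in> ints x"
    then have "0 < n" "real n \<le> x" by (auto simp: ints_def)
    then show "mangoldt n \<le> ln x" using mangoldt_le[of n] by (intro order_trans[OF mangoldt_le]) auto
  qed
  also have "\<dots> \<le> x * ln x" using x card_ints[of x] by (simp add: mult_right_mono)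
  finally show ?thesis .
qed

definition mangoldt_conv :: "nat \<Rightarrow> real" where
  "mangoldt_conv n = (\<Sum>d | d dvd n. mangoldt d * mangoldt (n div d))"

lemma mangoldt_conv_nonneg: "mangoldt_conv n \<ge> 0"
  unfolding mangoldt_conv_def by (intro sum_nonneg mult_nonneg_nonneg mangoldt_nonneg)

lemma selberg_sum_diff:
  assumes "x \<le> y"
  shows "selberg_sum y - selberg_sum x
       = (\<Sum>n\<in>ints y - ints x. mangoldt n * ln (real n)) + (\<Sum>n\<in>ints y - ints x. mangoldt_conv n)"
  using ints_mono[OF assms]
  by (simp add: selberg_sum_def mangoldt2_def mangoldt_conv_def sum.distrib sum_diff)

lemma psi_diff: "x \<le> y \<Longrightarrow> psi y - psi x = (\<Sum>n\<in>ints y - ints x. mangoldt n)"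
  using ints_mono[of x y] by (simp add: psi_def sum_diff)

lemma sum_mangoldt_ln_ge:
  assumes "1 \<le> x" "x \<le> y"
  shows "(\<Sum>n\<in>ints y - ints x. mangoldt n * ln (real n)) \<ge> ln x * (psi y - psi x)"
  unfolding psi_diff[OF assms(2)] sum_distrib_left
proof (rule sum_mono)
  fix n assume "n \<in> ints y - ints x"
  then have "x < real n" by (auto simp: ints_def)
  then show "ln x * mangoldt n \<le> mangoldt n * ln (real n)"
    using assms by (subst mult.commute) (intro mult_left_mono mangoldt_nonneg, auto)
qed

lemma sum_mangoldt_ln_le:
  assumes "1 \<le> x" "x \<le> y"
  shows "(\<Sum>n\<in>ints y - ints x. mangoldt n * ln (real n)) \<le> ln y * (psi y - psi x)"
  unfolding psi_diff[OF assms(2)] sum_distrib_left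
proof (rule sum_mono)
  fix n assume "n \<in> ints y - ints x"
  then have "0 < n" "real n \<le> y" by (auto simp: ints_def)
  then show "mangoldt n * ln (real n) \<le> ln y * mangoldt n"
    using assms by (subst mult.commute) (intro mult_right_mono mangoldt_nonneg, auto)
qed

lemma psi_diff_le_selberg:
  assumes "1 \<le> x" "x \<le> y"
  shows "ln x * (psi y - psi x) \<le> selberg_sum y - selberg_sum x"
  using sum_mangoldt_ln_ge[OF assms] selberg_sum_diff[OF assms(2)]
    sum_nonneg[of "ints y - ints x" mangoldt_conv] mangoldt_conv_nonneg by simp

text \<open>Beyond sqrt x the weight ln n is at least half of ln x, so omitting the nonnegative
  convolution in Selberg's formula leaves O(x) for psi x - psi (sqrt x). Below sqrt x the trivial
  bound suffices.\<close>

lemma chebyshev_upper: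
  obtains C where "C > 0" "\<And>x. x \<ge> 0 \<Longrightarrow> psi x \<le> C * x"
proof -
  obtain C where C: "C > 0" "\<And>x. x \<ge> 1 \<Longrightarrow> \<bar>selberg_sum x - 2 * x * ln x\<bar> \<le> C * x"
    by (rule selberg_formula) (rule that)
  have "psi x \<le> (5 + 2 * C) * x" if x: "x \<ge> 0" for x
  proof (cases "x \<ge> 3")
    case False
    show ?thesis
    proof (cases "x \<ge> 1")
      case True
      have "ln x \<le> 2" using ln_le_minus_one[of x] True False by simp
      then have "x * ln x \<le> x * (5 + 2 * C)" using x C by (intro mult_left_mono) auto
      then show ?thesis using psi_le_trivial[OF True] by (simp add: mult.commute)
    next
      case False then show ?thesis using psi_eq_0[of x] x C by simp
    qed
  next
    case True
    have l1: "ln x \<ge> 1"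
      using ln_ge_iff[of x 1] True exp_le by linarith
    have s: "sqrt x \<ge> 1" "sqrt x \<le> x" using True by (auto intro!: real_le_lsqrt simp: power2_eq_square)
    have "selberg_sum (sqrt x) \<ge> 0"
      unfolding selberg_sum_def by (intro sum_nonneg mangoldt2_nonneg)
    then have "ln (sqrt x) * (psi x - psi (sqrt x)) \<le> 2 * x * ln x + C * x"
      using psi_diff_le_selberg[OF s] C(2)[of x] True by linarith
    also have "\<dots> \<le> (2 + C) * x * ln x"
      using mult_left_mono[OF l1, of "C * x"] C(1) True by (simp add: algebra_simps)
    finally have "ln x * (psi x - psi (sqrt x)) \<le> ln x * (2 * (2 + C) * x)"
      using True by (simp add: ln_sqrt algebra_simps)
    then have "psi x - psi (sqrt x) \<le> 2 * (2 + C) * x"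
      using l1 by (subst (asm) mult_le_cancel_left_pos) auto
    moreover have "psi (sqrt x) \<le> sqrt x * ln (sqrt x)" using psi_le_trivial[OF s(1)] .
    moreover have "sqrt x * ln (sqrt x) \<le> sqrt x * sqrt x"
      using ln_le_minus_one[of "sqrt x"] s by (intro mult_left_mono) auto
    ultimately show ?thesis using True by (simp add: algebra_simps)
  qed
  then show ?thesis using that[of "5 + 2 * C"] C by auto
qed

definition mertens :: "real \<Rightarrow> real" where
  "mertens x = (\<Sum>n\<in>ints x. mangoldt n / real n)"

text \<open>The logarithm of the factorial is evaluated twice, once by comparison with an integral
  and once as the sum of mangoldt d times the number of multiples of d up to x. Replacing that
  number by x / d costs at most psi x.\<close>

lemma mertens_estimate:
  obtains K where "K > 0" "\<And>x. x \<ge> 1 \<Longrightarrow> \<bar>mertens x - ln x\<bar> \<le> K"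
proof -
  obtain C where C: "C > 0" "\<And>x. x \<ge> 0 \<Longrightarrow> psi x \<le> C * x" by (rule chebyshev_upper) (rule that)
  have "\<bar>mertens x - ln x\<bar> \<le> C + 3" if x: "x \<ge> 1" for x
  proof -
    have "(\<Sum>n\<in>ints x. ln (real n)) = (\<Sum>n\<in>ints x. \<Sum>d | d dvd n. mangoldt d)"
      by (intro sum.cong refl) (simp add: mangoldt_sum ints_def)
    also have "\<dots> = (\<Sum>d\<in>ints x. \<Sum>b\<in>ints (x / real d). mangoldt d)"
      by (rule sum_ints_divisors[symmetric])
    also have "\<dots> = (\<Sum>d\<in>ints x. mangoldt d * real (card (ints (x / real d))))" by (simp add: mult.commute)
    finally have 1: "(\<Sum>n\<in>ints x. ln (real n)) = \<dots>" .
    have "\<bar>x * mertens x - (\<Sum>n\<in>ints x. ln (real n))\<bar>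
        = \<bar>\<Sum>d\<in>ints x. mangoldt d * (x / real d - real (card (ints (x / real d))))\<bar>"
      by (simp add: 1 mertens_def sum_distrib_left sum_subtractf[symmetric] algebra_simps)
    also have "\<dots> \<le> (\<Sum>d\<in>ints x. mangoldt d * 1)"
    proof (rule order_trans[OF sum_abs sum_mono])
      fix d assume "d \<in> ints x"
      then have "x / real d \<ge> 0" using x by auto
      then have "\<bar>x / real d - real (card (ints (x / real d)))\<bar> \<le> 1" using card_ints[of "x / real d"] by linarith
      then show "\<bar>mangoldt d * (x / real d - real (card (ints (x / real d))))\<bar> \<le> mangoldt d * 1"
        unfolding abs_mult abs_mangoldt by (intro mult_left_mono mangoldt_nonneg)
    qed
    also have "\<dots> \<le> C * x" using C(2)[of x] x by (simp add: psi_def)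
    finally have 2: "\<bar>x * mertens x - (\<Sum>n\<in>ints x. ln (real n))\<bar> \<le> C * x" .
    have "\<bar>(\<Sum>n\<in>ints x. ln (real n)) - ((x * ln x - x) - (1 * ln 1 - 1))\<bar> \<le> ln x"
      using x by (intro sum_mono_asymptotics[where F = "\<lambda>t. t * ln t - t" and f = ln])
        (auto intro!: derivative_eq_intros)
    then have "\<bar>x * mertens x - x * ln x\<bar> \<le> C * x + x + ln x + 1" using 2 x by simp
    also have "\<dots> \<le> (C + 3) * x" using ln_le_minus_one[of x] x by (simp add: algebra_simps)
    also have "\<bar>x * mertens x - x * ln x\<bar> = x * \<bar>mertens x - ln x\<bar>"
      using x by (simp add: abs_mult flip: right_diff_distrib)
    finally show ?thesis using x by (simp add: mult.commute)
  qed
  then show ?thesis using that[of "C + 3"] C by auto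
qed

section \<open>Selberg's formula on dyadic intervals\<close>

definition dyadic_error :: "real \<Rightarrow> real" where
  "dyadic_error x = (psi (2 * x) - psi x) / x - 1"

lemma dyadic_error_bounded:
  obtains B where "B > 0" "\<And>x. x > 0 \<Longrightarrow> \<bar>dyadic_error x\<bar> \<le> B"
proof -
  obtain C where C: "C > 0" "\<And>x. x \<ge> 0 \<Longrightarrow> psi x \<le> C * x" by (rule chebyshev_upper) (rule that)
  have "\<bar>dyadic_error x\<bar> \<le> 2 * C + 1" if "x > 0" for x
  proof -
    have "(psi (2 * x) - psi x) / x \<le> 2 * C" using C(2)[of "2 * x"] psi_nonneg[of x] that by (simp add: field_simps)
    moreover have "(psi (2 * x) - psi x) / x \<ge> 0" using psi_mono[of x "2 * x"] that by simp
    ultimately show ?thesis unfolding dyadic_error_def by linarith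
  qed
  then show ?thesis using that[of "2 * C + 1"] C by auto
qed

lemma sum_mangoldt_conv: "(\<Sum>n\<in>ints x. mangoldt_conv n) = (\<Sum>a\<in>ints x. mangoldt a * psi (x / real a))"
  by (simp add: mangoldt_conv_def psi_def sum_distrib_left sum_ints_divisors)

text \<open>On (x, 2 x] the factor ln n equals ln x up to a bounded error, so differencing Selberg's
  formula over a dyadic interval takes the place of partial summation. The main term 2 ln x
  disappears: one ln x comes from the 1 in \<open>dyadic_error\<close>, the other from Mertens'
  estimate.\<close>

lemma selberg_dyadic_error:
  obtains K where "K > 0"
    "\<And>x. x \<ge> 1 \<Longrightarrow> \<bar>dyadic_error x * ln x + (\<Sum>a\<in>ints x. mangoldt a / real a * dyadic_error (x / real a))\<bar> \<le> K"
proof -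
  obtain C where C: "C > 0" "\<And>x. x \<ge> 1 \<Longrightarrow> \<bar>selberg_sum x - 2 * x * ln x\<bar> \<le> C * x" by (rule selberg_formula) (rule that)
  obtain C' where C': "C' > 0" "\<And>x. x \<ge> 0 \<Longrightarrow> psi x \<le> C' * x" by (rule chebyshev_upper) (rule that)
  obtain K where K: "K > 0" "\<And>x. x \<ge> 1 \<Longrightarrow> \<bar>mertens x - ln x\<bar> \<le> K" by (rule mertens_estimate) (rule that)
  define K1 where "K1 = 3 * C + 4 + 2 * C' + K"
  have "\<bar>dyadic_error x * ln x + (\<Sum>a\<in>ints x. mangoldt a / real a * dyadic_error (x / real a))\<bar> \<le> K1" if x: "x \<ge> 1" for x
  proof -
    define A where "A = (\<Sum>n\<in>ints (2 * x) - ints x. mangoldt n * ln (real n))"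
    define P where "P = psi (2 * x) - psi x"
    define Q where "Q = (\<Sum>a\<in>ints x. mangoldt a * (psi (2 * (x / real a)) - psi (x / real a)))"
    have P: "P \<ge> 0" "P \<le> 2 * C' * x"
      using psi_mono[of x "2 * x"] C'(2)[of "2 * x"] psi_nonneg[of x] x by (auto simp: P_def)
    have "ln (2 * x) = ln x + ln 2" using x by (simp add: ln_mult)
    then have A: "A \<ge> ln x * P" "A \<le> (ln x + ln 2) * P"
      using sum_mangoldt_ln_ge[of x "2 * x"] sum_mangoldt_ln_le[of x "2 * x"] x by (auto simp: A_def P_def)
    have l2: "ln 2 * P \<le> 1 * P" "(0::real) < ln 2" "ln 2 \<le> (1::real)"
      using P ln_le_minus_one[of "2::real"] mult_right_mono[of "ln 2" 1 P] by auto
    have "(\<Sum>n\<in>ints (2 * x) - ints x. mangoldt_conv n)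
        = (\<Sum>a\<in>ints (2 * x). mangoldt a * psi (2 * x / real a)) - (\<Sum>a\<in>ints x. mangoldt a * psi (x / real a))"
      using ints_mono[of x "2 * x"] x by (simp add: sum_diff sum_mangoldt_conv[symmetric])
    \<comment> \<open>For a beyond x the argument 2 x / a is below 2, where \<open>psi\<close>
      vanishes; hence both sums run over the same range.\<close>
    also have "(\<Sum>a\<in>ints (2 * x). mangoldt a * psi (2 * x / real a)) = (\<Sum>a\<in>ints x. mangoldt a * psi (2 * x / real a))"
    proof (intro sum.mono_neutral_right ballI)
      show "ints x \<subseteq> ints (2 * x)" using x by (intro ints_mono) auto
      fix a assume "a \<in> ints (2 * x) - ints x"
      then have "x < real a" by (auto simp: ints_def)
      then have "2 * x / real a < 2" using x by (simp add: field_simps)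
      then show "mangoldt a * psi (2 * x / real a) = 0" by (simp add: psi_eq_0)
    qed auto
    also have "(\<Sum>a\<in>ints x. mangoldt a * psi (2 * x / real a)) - (\<Sum>a\<in>ints x. mangoldt a * psi (x / real a)) = Q"
      by (simp add: Q_def sum_subtractf right_diff_distrib)
    finally have AQ: "selberg_sum (2 * x) - selberg_sum x = A + Q"
      using selberg_sum_diff[of x "2 * x"] x by (simp add: A_def)
    have "\<bar>selberg_sum (2 * x) - 2 * (2 * x) * (ln x + ln 2)\<bar> \<le> C * (2 * x)" "\<bar>selberg_sum x - 2 * x * ln x\<bar> \<le> C * x"
      using C(2)[of x] C(2)[of "2 * x"] x by (auto simp: ln_mult add.commute)
    moreover have "0 \<le> 4 * x * ln 2" "4 * x * ln 2 \<le> 4 * x * 1"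
      using x l2 by (auto intro!: mult_left_mono)
    ultimately have "\<bar>A + Q - 2 * x * ln x\<bar> \<le> 3 * C * x + 4 * x"
      unfolding AQ[symmetric] abs_le_iff by (simp add: algebra_simps)
    then have "\<bar>ln x * P + Q - 2 * x * ln x\<bar> \<le> 3 * C * x + 4 * x + 2 * C' * x"
      using A P l2 unfolding abs_le_iff by (simp add: algebra_simps)
    then have "\<bar>ln x * P + Q - 2 * x * ln x\<bar> / x \<le> 3 * C + 4 + 2 * C'"
      using x by (simp add: field_simps)
    moreover have "\<bar>ln x * P + Q - 2 * x * ln x\<bar> / x = \<bar>ln x * (P / x) + Q / x - 2 * ln x\<bar>"
    proof -
      have "(ln x * P + Q - 2 * x * ln x) / x = ln x * (P / x) + Q / x - 2 * ln x" using x by (simp add: field_simps)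
      moreover have "\<bar>ln x * P + Q - 2 * x * ln x\<bar> / x = \<bar>(ln x * P + Q - 2 * x * ln x) / x\<bar>" using x by simp
      ultimately show ?thesis by simp
    qed
    moreover have "Q / x = (\<Sum>a\<in>ints x. mangoldt a / real a * (dyadic_error (x / real a) + 1))"
      unfolding Q_def sum_divide_distrib
      using x by (intro sum.cong refl) (auto simp: dyadic_error_def ints_def field_simps)
    moreover have "\<dots> = (\<Sum>a\<in>ints x. mangoldt a / real a * dyadic_error (x / real a)) + mertens x"
      by (simp add: mertens_def ring_distribs sum.distrib)
    moreover have "P / x = dyadic_error x + 1" by (simp add: dyadic_error_def P_def)
    ultimately have "\<bar>ln x * (dyadic_error x + 1) + ((\<Sum>a\<in>ints x. mangoldt a / real a * dyadic_error (x / real a)) + mertens x) - 2 * ln x\<bar>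
       \<le> 3 * C + 4 + 2 * C'" by simp
    then show ?thesis using K(2)[OF x] unfolding K1_def by (simp add: algebra_simps)
  qed
  moreover have "K1 > 0" using C C' K by (simp add: K1_def)
  ultimately show ?thesis using that by blast
qed

text \<open>Omitting the nonnegative convolution in Selberg's formula gives a bound of
  Brun-Titchmarsh type, with twice the expected main term.\<close>

lemma psi_short_interval:
  obtains C where "C > 0" "\<And>x y. 2 \<le> x \<Longrightarrow> x \<le> y \<Longrightarrow> y \<le> 2 * x \<Longrightarrow> psi y - psi x \<le> 2 * (y - x) + C * x / ln x"
proof -
  obtain C where C: "C > 0" "\<And>x. x \<ge> 1 \<Longrightarrow> \<bar>selberg_sum x - 2 * x * ln x\<bar> \<le> C * x" by (rule selberg_formula) (rule that)
  have "psi y - psi x \<le> 2 * (y - x) + (4 + 3 * C) * x / ln x" if "2 \<le> x" "x \<le> y" "y \<le> 2 * x" for x y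
  proof -
    have lx: "ln x > 0" using that by simp
    have "ln x * (psi y - psi x) \<le> selberg_sum y - selberg_sum x" using psi_diff_le_selberg that by simp
    also have "\<dots> \<le> 2 * y * ln y - 2 * x * ln x + C * y + C * x" using C(2)[of x] C(2)[of y] that by simp
    also have "ln y \<le> ln x + 1"
    proof -
      have "ln y - ln x = ln (y / x)" using that by (simp add: ln_div)
      also have "\<dots> \<le> y / x - 1" using ln_le_minus_one[of "y / x"] that by simp
      also have "\<dots> \<le> 1" using that by (simp add: field_simps)
      finally show ?thesis by simp
    qed
    then have "2 * y * ln y - 2 * x * ln x + C * y + C * x \<le> 2 * y * (ln x + 1) - 2 * x * ln x + C * (2 * x) + C * x"
      using that C by (intro add_mono diff_mono mult_left_mono) auto
    also have "\<dots> \<le> 2 * (y - x) * ln x + (4 + 3 * C) * x" using that by (simp add: algebra_simps)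
    finally show ?thesis using lx by (simp add: field_simps)
  qed
  then show ?thesis using that[of "4 + 3 * C"] C by auto
qed

text \<open>Passing from x to y changes the count by what lies in (x, y] and (2 x, 2 y], and changes
  the normalisation by the factor x / y. The first is small by \<open>psi_short_interval\<close>,
  the second by Chebyshev's bound. Thus one value can represent the error on a whole short
  window.\<close>

lemma dyadic_error_slowly_varying:
  obtains C where "C > 0" "\<And>x y. 2 \<le> x \<Longrightarrow> x \<le> y \<Longrightarrow> y \<le> 2 * x \<Longrightarrow>
     \<bar>dyadic_error y - dyadic_error x\<bar> \<le> C * ((y - x) / x) + C / ln x"
proof -
  obtain C where C: "C > 0" "\<And>x y. 2 \<le> x \<Longrightarrow> x \<le> y \<Longrightarrow> y \<le> 2 * x \<Longrightarrow> psi y - psi x \<le> 2 * (y - x) + C * x / ln x"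
    by (rule psi_short_interval) (rule that)
  obtain C' where C': "C' > 0" "\<And>x. x \<ge> 0 \<Longrightarrow> psi x \<le> C' * x" by (rule chebyshev_upper) (rule that)
  define M where "M = 6 + 2 * C' + 3 * C"
  have "\<bar>dyadic_error y - dyadic_error x\<bar> \<le> M * ((y - x) / x) + M / ln x"
    if xy: "2 \<le> x" "x \<le> y" "y \<le> 2 * x" for x y
  proof -
    have lx: "ln x > 0" using xy by simp
    define p where "p = psi y - psi x"
    define q where "q = psi (2 * y) - psi (2 * x)"
    define r where "r = psi (2 * x) - psi x"
    have p: "0 \<le> p" "p \<le> 2 * (y - x) + C * x / ln x" using psi_mono[of x y] C(2)[of x y] xy by (auto simp: p_def)
    have q0: "0 \<le> q" using psi_mono[of "2 * x" "2 * y"] xy by (simp add: q_def)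
    have "q \<le> 2 * (2 * y - 2 * x) + C * (2 * x) / ln (2 * x)" using C(2)[of "2 * x" "2 * y"] xy by (simp add: q_def)
    also have "C * (2 * x) / ln (2 * x) \<le> C * (2 * x) / ln x"
      using xy C by (intro divide_left_mono) auto
    finally have q: "q \<le> 4 * (y - x) + 2 * (C * x / ln x)" by (simp add: algebra_simps)
    have r: "0 \<le> r" "r \<le> C' * (2 * x)" using psi_mono[of x "2 * x"] C'(2)[of "2 * x"] psi_nonneg[of x] xy by (auto simp: r_def)
    have "dyadic_error y - dyadic_error x = (q - p) / y - r * (y - x) / (x * y)"
      using xy unfolding dyadic_error_def p_def q_def r_def by (simp add: field_simps)
    also have "\<bar>\<dots>\<bar> \<le> \<bar>(q - p) / y\<bar> + \<bar>r * (y - x) / (x * y)\<bar>" by (rule abs_triangle_ineq4)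
    also have "\<bar>(q - p) / y\<bar> \<le> (6 * (y - x) + 3 * (C * x / ln x)) / x"
    proof -
      have "\<bar>q - p\<bar> \<le> 6 * (y - x) + 3 * (C * x / ln x)" using p q q0 by argo
      then show ?thesis using xy unfolding abs_divide by (intro frac_le) auto
    qed
    also have "\<bar>r * (y - x) / (x * y)\<bar> \<le> 2 * C' * ((y - x) / x)"
    proof -
      have "\<bar>r * (y - x) / (x * y)\<bar> = r * (y - x) / (x * y)" using r xy by simp
      also have "\<dots> \<le> (C' * (2 * x)) * (y - x) / (x * x)" 
        using r xy C' by (intro frac_le mult_right_mono mult_left_mono mult_nonneg_nonneg) auto
      also have "\<dots> = 2 * C' * ((y - x) / x)" using xy by (simp add: field_simps)
      finally show ?thesis .
    qed
    also have "(6 * (y - x) + 3 * (C * x / ln x)) / x = 6 * ((y - x) / x) + 3 * C / ln x"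
      using xy lx by (simp add: field_simps)
    finally have "\<bar>dyadic_error y - dyadic_error x\<bar> \<le> (6 + 2 * C') * ((y - x) / x) + 3 * C / ln x"
      by (simp add: algebra_simps)
    also have "\<dots> \<le> M * ((y - x) / x) + M / ln x"
      using xy lx C C' by (intro add_mono mult_right_mono divide_right_mono) (auto simp: M_def)
    finally show ?thesis .
  qed
  moreover have "M > 0" using C C' by (simp add: M_def)
  ultimately show ?thesis using that by blast
qed

section \<open>Primes and products of two primes on a logarithmic scale\<close>

definition shell :: "real \<Rightarrow> real \<Rightarrow> nat set" where
  "shell s t = ints (exp t) - ints (exp s)"

lemma shell_iff: "n \<in> shell s t \<longleftrightarrow> exp s < real n \<and> real n \<le> exp t"
  by (auto simp: shell_def ints_def intro: gr0I less_le_trans[of 0 "exp s"])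

lemma finite_shell [simp]: "finite (shell s t)"
  by (simp add: shell_def)

lemma ln_shell: "n \<in> shell s t \<Longrightarrow> s < ln (real n) \<and> ln (real n) \<le> t \<and> 0 < n"
  unfolding shell_iff
  by (metis exp_gt_zero less_trans ln_exp ln_le_cancel_iff ln_less_cancel_iff of_nat_0_less_iff)

lemma shell_union: "s \<le> t \<Longrightarrow> t \<le> u \<Longrightarrow> shell s u = shell s t \<union> shell t u"
  by (auto simp: shell_iff) (meson exp_le_cancel_iff le_less_trans less_le_trans order_trans)+

text \<open>Together with \<open>semiprime_weight\<close> this splits the sum of
  \<open>mangoldt2 n / n\<close> over J; prime powers are counted along with the primes.\<close>

definition prime_weight :: "nat set \<Rightarrow> real" where
  "prime_weight J = (\<Sum>n\<in>J. mangoldt n * ln (real n) / real n)"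

definition semiprime_weight :: "nat set \<Rightarrow> real" where
  "semiprime_weight J = (\<Sum>n\<in>J. mangoldt_conv n / real n)"

lemma weights_mono:
  assumes "I \<subseteq> J" "finite J"
  shows "prime_weight I \<le> prime_weight J" "semiprime_weight I \<le> semiprime_weight J"
proof -
  have "mangoldt n * ln (real n) / real n \<ge> 0" for n
    by (cases "n = 0") (auto intro!: divide_nonneg_nonneg mult_nonneg_nonneg mangoldt_nonneg)
  then show "prime_weight I \<le> prime_weight J" unfolding prime_weight_def using assms by (intro sum_mono2) auto
  show "semiprime_weight I \<le> semiprime_weight J" unfolding semiprime_weight_def
    using assms by (intro sum_mono2 divide_nonneg_nonneg mangoldt_conv_nonneg) auto
qed

text \<open>Since n \<le> exp (v + h) on the shell, replacing 1 / n by exp (- v - h) only lowers the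
  sum, which Selberg's formula then evaluates. The factor 1 - exp (- h) is the length of the shell
  relative to its upper end.\<close>

lemma shell_weight_lower:
  obtains C where "C > 0" "\<And>v h. 0 \<le> v \<Longrightarrow> 0 \<le> h \<Longrightarrow>
    prime_weight (shell v (v + h)) + semiprime_weight (shell v (v + h)) \<ge> 2 * v * (1 - exp (- h)) - C"
proof -
  obtain C where C: "C > 0" "\<And>x. x \<ge> 1 \<Longrightarrow> \<bar>selberg_sum x - 2 * x * ln x\<bar> \<le> C * x"
    by (rule selberg_formula) (rule that)
  have "prime_weight (shell v (v + h)) + semiprime_weight (shell v (v + h)) \<ge> 2 * v * (1 - exp (- h)) - 2 * C"
    if vh: "0 \<le> v" "0 \<le> h" for v h
  proof -
    define x where "x = exp v"
    define y where "y = exp (v + h)"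
    have xy: "1 \<le> x" "x \<le> y" "y > 0" using vh by (auto simp: x_def y_def)
    have "\<bar>selberg_sum x - 2 * x * v\<bar> \<le> C * x" "\<bar>selberg_sum y - 2 * y * (v + h)\<bar> \<le> C * y"
      using C(2)[of x] C(2)[of y] xy by (auto simp: x_def y_def)
    then have "2 * y * (v + h) - C * y - 2 * x * v - C * x \<le> selberg_sum y - selberg_sum x" by linarith
    moreover have "C * x \<le> C * y" "2 * y * v \<le> 2 * y * (v + h)" using xy vh C by auto
    ultimately have "2 * y * v - 2 * x * v - 2 * C * y \<le> selberg_sum y - selberg_sum x" by linarith
    also have "\<dots> \<le> y * (prime_weight (shell v (v + h)) + semiprime_weight (shell v (v + h)))"
    proof -
      have "selberg_sum y - selberg_sum x = (\<Sum>n\<in>shell v (v + h). mangoldt n * ln (real n) + mangoldt_conv n)"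
        using selberg_sum_diff[OF xy(2)] by (simp add: shell_def x_def y_def sum.distrib)
      also have "\<dots> \<le> (\<Sum>n\<in>shell v (v + h). y * (mangoldt n * ln (real n) / real n + mangoldt_conv n / real n))"
      proof (rule sum_mono)
        fix n assume n: "n \<in> shell v (v + h)"
        then have "0 < n" "real n \<le> y" using ln_shell by (auto simp: shell_iff y_def)
        then have "1 \<le> y / real n" by simp
        moreover have "mangoldt n * ln (real n) + mangoldt_conv n \<ge> 0"
          using \<open>0 < n\<close> by (intro add_nonneg_nonneg mult_nonneg_nonneg mangoldt_nonneg mangoldt_conv_nonneg) auto
        ultimately have "1 * (mangoldt n * ln (real n) + mangoldt_conv n) \<le> y / real n * (mangoldt n * ln (real n) + mangoldt_conv n)"
          by (intro mult_right_mono)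
        then show "mangoldt n * ln (real n) + mangoldt_conv n
            \<le> y * (mangoldt n * ln (real n) / real n + mangoldt_conv n / real n)"
          by (simp add: add_divide_distrib ring_distribs)
      qed
      finally show ?thesis by (simp add: prime_weight_def semiprime_weight_def sum.distrib sum_distrib_left ring_distribs)
    qed
    finally have "(2 * y * v - 2 * x * v - 2 * C * y) / y \<le> prime_weight (shell v (v + h)) + semiprime_weight (shell v (v + h))"
      using xy by (simp add: field_simps)
    moreover have "(2 * y * v - 2 * x * v - 2 * C * y) / y = 2 * v * (1 - x / y) - 2 * C"
      using xy by (simp add: field_simps)
    moreover have "x / y = exp (- h)" by (simp add: x_def y_def exp_diff[symmetric])
    ultimately show ?thesis by simp
  qed
  then show ?thesis using that[of "2 * C"] C by auto
qed

text \<open>Mertens' estimate loses a constant K independent of h, so these bounds are sharp only on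
  shells long compared with K.\<close>

lemma prime_weight_shell:
  obtains K where "K > 0" "\<And>v h. 0 \<le> v \<Longrightarrow> 0 \<le> h \<Longrightarrow> v * (h - K) \<le> prime_weight (shell v (v + h))"
    "\<And>v h. 0 \<le> v \<Longrightarrow> 0 \<le> h \<Longrightarrow> prime_weight (shell v (v + h)) \<le> (v + h) * (h + K)"
proof -
  obtain K where K: "K > 0" "\<And>x. x \<ge> 1 \<Longrightarrow> \<bar>mertens x - ln x\<bar> \<le> K"
    by (rule mertens_estimate) (rule that)
  have main: "v * (h - 2 * K) \<le> prime_weight (shell v (v + h)) \<and> prime_weight (shell v (v + h)) \<le> (v + h) * (h + 2 * K)"
    if vh: "0 \<le> v" "0 \<le> h" for v h
  proof -
    define S where "S = (\<Sum>n\<in>shell v (v + h). mangoldt n / real n)"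
    have "S = mertens (exp (v + h)) - mertens (exp v)"
      using ints_mono[of "exp v" "exp (v + h)"] vh by (simp add: S_def mertens_def shell_def sum_diff)
    then have S: "h - 2 * K \<le> S" "S \<le> h + 2 * K"
      using K(2)[of "exp v"] K(2)[of "exp (v + h)"] vh by auto
    have "v * S \<le> prime_weight (shell v (v + h))" "prime_weight (shell v (v + h)) \<le> (v + h) * S"
      unfolding S_def prime_weight_def sum_distrib_left
    proof (safe intro!: sum_mono)
      fix n assume n: "n \<in> shell v (v + h)"
      then have "v \<le> ln (real n)" "ln (real n) \<le> v + h" "mangoldt n / real n \<ge> (0::real)"
        using ln_shell[OF n] mangoldt_nonneg[of n] by auto
      then have "v * (mangoldt n / real n) \<le> ln (real n) * (mangoldt n / real n)"
        "ln (real n) * (mangoldt n / real n) \<le> (v + h) * (mangoldt n / real n)"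
        by (blast intro: mult_right_mono)+
      then show "v * (mangoldt n / real n) \<le> mangoldt n * ln (real n) / real n"
        "mangoldt n * ln (real n) / real n \<le> (v + h) * (mangoldt n / real n)"
        by (auto simp: mult.commute)
    qed
    moreover have "v * (h - 2 * K) \<le> v * S" "(v + h) * S \<le> (v + h) * (h + 2 * K)"
      using S vh by (auto intro!: mult_left_mono)
    ultimately show ?thesis by linarith
  qed
  show ?thesis using that[of "2 * K"] K main by auto
qed

lemma prime_weight_Un: "finite A \<Longrightarrow> finite B \<Longrightarrow> A \<inter> B = {} \<Longrightarrow> prime_weight (A \<union> B) = prime_weight A + prime_weight B"
  by (simp add: prime_weight_def sum.union_disjoint)

lemma shell_disjoint: "t \<le> s' \<Longrightarrow> shell s t \<inter> shell s' t' = {}"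
  by (auto dest!: ln_shell)

lemma prime_weight_cells:
  assumes "h \<ge> 0"
  shows "prime_weight (shell v (v + real k * h)) = (\<Sum>j<k. prime_weight (shell (v + real j * h) (v + real j * h + h)))"
proof (induction k)
  case 0
  have "shell v v = {}" by (auto simp: shell_iff)
  then show ?case by (simp add: prime_weight_def)
next
  case (Suc k)
  have eq: "v + real (Suc k) * h = v + real k * h + h" by (simp add: algebra_simps)
  have "shell v (v + real (Suc k) * h) = shell v (v + real k * h) \<union> shell (v + real k * h) (v + real k * h + h)"
    unfolding eq using assms by (intro shell_union) auto
  then show ?case using Suc by (simp add: prime_weight_Un shell_disjoint)
qed

text \<open>By Selberg's formula every cell carries primes or semiprimes, by Mertens' theorem neither kind can
  fill a long block alone, so two neighbouring cells together carry both.\<close>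

lemma mixed_window:
  assumes h: "0 < h" "h \<le> 1/10"
  obtains k :: nat and v0 :: real where "v0 > 0" "k > 0"
    "\<And>v. v \<ge> v0 \<Longrightarrow> \<exists>j<k. prime_weight (shell (v + real j * h) (v + real j * h + 2 * h)) \<ge> h * v / 4
                  \<and> semiprime_weight (shell (v + real j * h) (v + real j * h + 2 * h)) \<ge> h * v / 4"
proof -
  obtain C where C: "C > 0" "\<And>v h. 0 \<le> v \<Longrightarrow> 0 \<le> h \<Longrightarrow>
    prime_weight (shell v (v + h)) + semiprime_weight (shell v (v + h)) \<ge> 2 * v * (1 - exp (- h)) - C"
    by (rule shell_weight_lower) (rule that)
  obtain K where K: "K > 0" "\<And>v h. 0 \<le> v \<Longrightarrow> 0 \<le> h \<Longrightarrow> v * (h - K) \<le> prime_weight (shell v (v + h))"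
    "\<And>v h. 0 \<le> v \<Longrightarrow> 0 \<le> h \<Longrightarrow> prime_weight (shell v (v + h)) \<le> (v + h) * (h + K)"
    by (rule prime_weight_shell) (rule that)
  \<comment> \<open>The block length c = k h must dwarf the Mertens error K. With v at least 4 c the
    logarithms on the block stay below 5 v / 4, and with v at least 10 C / h Selberg's error C is at
    most a tenth of h v.\<close>
  obtain k :: nat where k: "10 * K / h < real k" using reals_Archimedean2 by blast
  define c where "c = real k * h"
  have c: "10 * K < c" using k h by (simp add: c_def field_simps)
  then have c0: "c > 0" using K by simp
  then have k0: "k > 0" using h by (auto simp: c_def intro: gr0I)
  define v0 where "v0 = 4 * c + 10 * C / h"
  have v0: "v0 > 0" using c0 C h by (simp add: v0_def add_pos_pos)
  show ?thesis
  proof (rule that[OF v0 k0])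
    fix v assume v: "v \<ge> v0"
    have "10 * C / h > 0" using C h by simp
    then have vc: "v \<ge> 4 * c" "10 * C / h \<le> v" "v > 0" using v c0 unfolding v0_def by linarith+
    then have vC: "10 * C \<le> v * h" using h by (simp add: field_simps)
    have hv: "h * v > 0" using vc h by simp
    define cell where "cell = (\<lambda>j::nat. shell (v + real j * h) (v + real j * h + h))"
    define win where "win = (\<lambda>j::nat. shell (v + real j * h) (v + real j * h + 2 * h))"
    have sub: "cell j \<subseteq> win j" "cell (Suc j) \<subseteq> win j" for j
    proof -
      have "win j = cell j \<union> cell (Suc j)"
        using shell_union[of "v + real j * h" "v + real j * h + h" "v + real j * h + 2 * h"] h
        by (simp add: win_def cell_def algebra_simps)
      then show "cell j \<subseteq> win j" "cell (Suc j) \<subseteq> win j" by auto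
    qed
    have tot: "prime_weight (cell j) + semiprime_weight (cell j) \<ge> 17/10 * (h * v)" for j
    proof -
      have "exp (- h) \<le> 1 - 9/10 * h"
      proof -
        have "1 + h \<le> exp h" by (rule exp_ge_add_one_self)
        then have "exp (- h) \<le> 1 / (1 + h)" using h by (simp add: exp_minus field_simps)
        moreover have "9 * (h * h) \<le> 9 * (h * (1/10))" using h by (intro mult_left_mono) auto
        then have "1 / (1 + h) \<le> 1 - 9/10 * h" using h by (simp add: field_simps)
        ultimately show ?thesis by linarith
      qed
      then have "9/10 * h \<le> 1 - exp (- h)" by simp
      then have "2 * (v + real j * h) * (9/10 * h) \<le> 2 * (v + real j * h) * (1 - exp (- h))"
        using vc h by (intro mult_left_mono) auto
      moreover have "2 * v * (9/10 * h) \<le> 2 * (v + real j * h) * (9/10 * h)"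
        using vc h by (intro mult_right_mono mult_left_mono) auto
      moreover have "2 * v * (9/10 * h) = 18/10 * (h * v)" "C \<le> 1/10 * (h * v)"
        using vC by (auto simp: mult.commute)
      moreover have "2 * (v + real j * h) * (1 - exp (- h)) - C \<le> prime_weight (cell j) + semiprime_weight (cell j)"
        unfolding cell_def using vc h by (intro C(2)) auto
      ultimately show ?thesis by linarith
    qed
    have total: "v * (c - K) \<le> (\<Sum>j<k. prime_weight (cell j))" "(\<Sum>j<k. prime_weight (cell j)) \<le> (v + c) * (c + K)"
      using K(2,3)[of v c] prime_weight_cells[of h v k] vc c0 h by (auto simp: cell_def c_def)
    have "\<exists>j<k. prime_weight (win j) \<ge> h * v / 4 \<and> semiprime_weight (win j) \<ge> h * v / 4"
    proof (rule ccontr)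
      assume neg: "\<not> ?thesis"
      have fin: "finite (win j)" for j by (simp add: win_def)
      have ex1: "\<not> (prime_weight (cell i) \<ge> h * v / 4 \<and> semiprime_weight (cell i') \<ge> h * v / 4)"
        if "j < k" "cell i \<subseteq> win j" "cell i' \<subseteq> win j" for i i' j
        using neg that weights_mono[OF that(2) fin] weights_mono[OF that(3) fin] by force
      \<comment> \<open>Either property of the first cell spreads to all cells of the block. If all
        are poor in semiprimes, each has prime weight at least 17/10 - 1/4 = 29/20 times h v, above
        the Mertens bound (5/4) (11/10). If all are poor in primes, their total is at most a quarter
        of c v, below the Mertens bound 9/10.\<close>
      show False
      proof (cases "prime_weight (cell 0) \<ge> h * v / 4")
        case True
        have P: "prime_weight (cell j) \<ge> h * v / 4" if "j < k" for j
          using that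
        proof (induction j)
          case (Suc j)
          then have "semiprime_weight (cell (Suc j)) < h * v / 4"
            using ex1[of j j "Suc j"] sub[of j] by force
          then show ?case using tot[of "Suc j"] hv by linarith
        qed (use True in simp)
        have "prime_weight (cell j) \<ge> 29/20 * (h * v)" if "j < k" for j
        proof -
          have "semiprime_weight (cell j) < h * v / 4" using ex1[of j j j] sub[of j] P[OF that] that by force
          then show ?thesis using tot[of j] by simp
        qed
        then have "(\<Sum>j<k. 29/20 * (h * v)) \<le> (\<Sum>j<k. prime_weight (cell j))" by (intro sum_mono) auto
        then have "29/20 * (c * v) \<le> (v + c) * (c + K)" using total by (simp add: c_def)
        also have "\<dots> \<le> (v + v / 4) * (c + c / 10)" using c vc c0 K by (intro mult_mono) auto
        finally have "c * v \<le> 0" by (simp add: algebra_simps)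
        then show False using c0 vc by (simp add: mult_le_0_iff)
      next
        case False
        have P: "prime_weight (cell j) < h * v / 4" if "j < k" for j
          using that
        proof (induction j)
          case (Suc j)
          then have "semiprime_weight (cell j) \<ge> h * v / 4" using tot[of j] hv by linarith
          then show ?case using ex1[of j "Suc j" j] sub[of j] Suc.prems by force
        qed (use False in simp)
        have "(\<Sum>j<k. prime_weight (cell j)) \<le> (\<Sum>j<k. h * v / 4)" using P by (intro sum_mono) (auto intro: less_imp_le)
        then have "v * (c - K) \<le> c * v / 4" using total by (simp add: c_def)
        moreover have "v * (c - c / 10) \<le> v * (c - K)" using c vc by (intro mult_left_mono) auto
        ultimately have "c * v \<le> 0" by (simp add: algebra_simps)
        then show False using c0 vc by (simp add: mult_le_0_iff)
      qed
    qed
    then show "\<exists>j<k. prime_weight (shell (v + real j * h) (v + real j * h + 2 * h)) \<ge> h * v / 4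
                  \<and> semiprime_weight (shell (v + real j * h) (v + real j * h + 2 * h)) \<ge> h * v / 4"
      by (simp add: win_def)
  qed
qed

text \<open>Throughout J the error is e0 up to \<alpha> / 2. The first sum is small only if \<sigma>
  E is near -\<beta> at x / n for the primes, the second only if it is near \<beta> for the
  semiprimes. According to the sign of \<sigma> e0 one of these fails by at least \<alpha> / 2 on
  all of J, while the other sum is still nonnegative.\<close>

lemma pigeonhole_window:
  fixes E :: "real \<Rightarrow> real"
  assumes "\<bar>\<sigma>\<bar> = 1" "\<alpha> > 0" "\<beta> \<ge> \<alpha>" "finite J"
    and bound: "\<And>y. \<bar>E y\<bar> \<le> \<beta>"
    and vary: "\<And>n. n \<in> J \<Longrightarrow> \<bar>E (x / real n) - e0\<bar> \<le> \<alpha> / 2"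
    and w: "prime_weight J \<ge> w" "semiprime_weight J \<ge> w" "w \<ge> 0"
    and J: "\<And>n. n \<in> J \<Longrightarrow> 0 < n"
  shows "(\<Sum>n\<in>J. mangoldt n * ln (real n) / real n * (\<beta> + \<sigma> * E (x / real n)))
       + (\<Sum>n\<in>J. mangoldt_conv n / real n * (\<beta> - \<sigma> * E (x / real n))) \<ge> \<alpha> / 2 * w"
proof -
  have sg: "\<bar>\<sigma> * E y\<bar> \<le> \<beta>" "\<bar>\<sigma> * E y - \<sigma> * e0\<bar> = \<bar>E y - e0\<bar>" for y
    using bound[of y] assms(1) by (auto simp: abs_mult right_diff_distrib[symmetric])
  have nn: "mangoldt n * ln (real n) / real n \<ge> 0" "mangoldt_conv n / real n \<ge> 0" if "n \<in> J" for n
    using J[OF that] by (auto intro!: divide_nonneg_nonneg mult_nonneg_nonneg mangoldt_nonneg mangoldt_conv_nonneg)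
  have nn1: "(\<Sum>n\<in>J. mangoldt n * ln (real n) / real n * (\<beta> + \<sigma> * E (x / real n))) \<ge> 0"
  proof (intro sum_nonneg mult_nonneg_nonneg nn)
    fix n show "0 \<le> \<beta> + \<sigma> * E (x / real n)" using sg(1)[of "x / real n"] by linarith
  qed
  have nn2: "(\<Sum>n\<in>J. mangoldt_conv n / real n * (\<beta> - \<sigma> * E (x / real n))) \<ge> 0"
  proof (intro sum_nonneg mult_nonneg_nonneg nn)
    fix n show "0 \<le> \<beta> - \<sigma> * E (x / real n)" using sg(1)[of "x / real n"] by linarith
  qed
  have aw: "\<alpha> / 2 * w \<le> \<alpha> / 2 * prime_weight J" "\<alpha> / 2 * w \<le> \<alpha> / 2 * semiprime_weight J"
    using w assms(2) by (auto intro!: mult_left_mono)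
  show ?thesis
  proof (cases "\<sigma> * e0 \<ge> 0")
    case True
    have "\<alpha> / 2 * prime_weight J \<le> (\<Sum>n\<in>J. mangoldt n * ln (real n) / real n * (\<beta> + \<sigma> * E (x / real n)))"
      unfolding prime_weight_def sum_distrib_left
    proof (rule sum_mono)
      fix n assume n: "n \<in> J"
      have "\<alpha> / 2 \<le> \<beta> + \<sigma> * E (x / real n)" using vary[OF n] sg(2)[of "x / real n"] True assms(3) by linarith
      then show "\<alpha> / 2 * (mangoldt n * ln (real n) / real n) \<le> mangoldt n * ln (real n) / real n * (\<beta> + \<sigma> * E (x / real n))"
        using nn(1)[OF n] by (subst mult.commute) (rule mult_left_mono)
    qed
    then show ?thesis using nn2 aw by linarith
  next
    case False
    have "\<alpha> / 2 * semiprime_weight J \<le> (\<Sum>n\<in>J. mangoldt_conv n / real n * (\<beta> - \<sigma> * E (x / real n)))"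
      unfolding semiprime_weight_def sum_distrib_left
    proof (rule sum_mono)
      fix n assume n: "n \<in> J"
      have "\<alpha> / 2 \<le> \<beta> - \<sigma> * E (x / real n)" using vary[OF n] sg(2)[of "x / real n"] False assms(3) by linarith
      then show "\<alpha> / 2 * (mangoldt_conv n / real n) \<le> mangoldt_conv n / real n * (\<beta> - \<sigma> * E (x / real n))"
        using nn(2)[OF n] by (subst mult.commute) (rule mult_left_mono)
    qed
    then show ?thesis using nn1 aw by linarith
  qed
qed

text \<open>If the error is almost extremal at \<open>x\<close>, then Selberg's formula forces it to be almost extremal with
  the opposite sign at most \<open>x / p\<close>, and with the same sign at most \<open>x / (p q)\<close>.\<close>

lemma extremal_upper_bound:
  fixes E :: "real \<Rightarrow> real"
  assumes K: "\<And>x. x \<ge> 1 \<Longrightarrow> \<bar>mertens x - ln x\<bar> \<le> K"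
    and K1: "\<And>x. x \<ge> 1 \<Longrightarrow> \<bar>E x * ln x + (\<Sum>a\<in>ints x. mangoldt a / real a * E (x / real a))\<bar> \<le> K1"
    and bound: "\<And>y. \<bar>E y\<bar> \<le> \<beta>" and sg: "\<sigma> = 1 \<or> \<sigma> = -1" and x: "x \<ge> 1"
    and ext: "\<sigma> * E x \<ge> \<beta> - 2 * \<epsilon>"
  shows "(\<Sum>n\<in>ints x. mangoldt n * ln (real n) / real n * (\<beta> + \<sigma> * E (x / real n)))
       + (\<Sum>n\<in>ints x. mangoldt_conv n / real n * (\<beta> - \<sigma> * E (x / real n)))
       \<le> 4 * \<epsilon> * (ln x)\<^sup>2 + (\<beta> * K + K1) * (3 * ln x + K)"
proof -
  define u where "u = ln x"
  define S where "S = (\<lambda>y. \<Sum>a\<in>ints y. mangoldt a / real a * E (y / real a))"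
  define Q where "Q = (\<Sum>a\<in>ints x. mangoldt a / real a * (\<beta> + \<sigma> * E (x / real a)))"
  define K2 where "K2 = \<beta> * K + K1"
  have u0: "u \<ge> 0" using x by (simp add: u_def)
  have b0: "\<beta> \<ge> 0" using bound[of 0] by linarith
  have "K \<ge> 0" "K1 \<ge> 0" using K[of 1] K1[of 1] by linarith+
  then have K2: "K2 \<ge> 0" using b0 by (simp add: K2_def)
  have sgS: "\<bar>\<sigma> * E y * ln y + \<sigma> * S y\<bar> \<le> K1" if "y \<ge> 1" for y
    using K1[OF that] sg by (auto simp: S_def)
  have sE: "\<bar>\<sigma> * E y\<bar> \<le> \<beta>" for y using bound[of y] sg by auto
  have pos: "0 \<le> \<beta> + \<sigma> * E y" for y using sE[of y] by linarith
  have "Q = \<beta> * mertens x + \<sigma> * S x"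
    by (simp add: Q_def mertens_def S_def sum_distrib_left sum.distrib[symmetric] algebra_simps)
  moreover have "\<sigma> * S x \<le> K1 - \<sigma> * E x * u" using sgS[OF x] by (simp add: u_def)
  moreover have "\<beta> * mertens x \<le> \<beta> * (u + K)" using K[OF x] b0 by (intro mult_left_mono) (auto simp: u_def)
  moreover have "(\<beta> - 2 * \<epsilon>) * u \<le> \<sigma> * E x * u" using ext u0 by (intro mult_right_mono)
  ultimately have Q: "Q \<le> 2 * \<epsilon> * u + K2" by (simp add: K2_def algebra_simps)
  have T1: "(\<Sum>n\<in>ints x. mangoldt n * ln (real n) / real n * (\<beta> + \<sigma> * E (x / real n))) \<le> u * Q"
    unfolding Q_def sum_distrib_left
  proof (rule sum_mono)
    fix n assume "n \<in> ints x"
    then have n: "0 < n" "real n \<le> x" by (auto simp: ints_def)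
    then have "ln (real n) \<le> u" by (simp add: u_def)
    moreover have "0 \<le> mangoldt n / real n * (\<beta> + \<sigma> * E (x / real n))"
      by (intro mult_nonneg_nonneg divide_nonneg_nonneg mangoldt_nonneg pos) auto
    ultimately have "ln (real n) * (mangoldt n / real n * (\<beta> + \<sigma> * E (x / real n))) \<le> u * (mangoldt n / real n * (\<beta> + \<sigma> * E (x / real n)))"
      by (rule mult_right_mono)
    then show "mangoldt n * ln (real n) / real n * (\<beta> + \<sigma> * E (x / real n)) \<le> u * (mangoldt n / real n * (\<beta> + \<sigma> * E (x / real n)))"
      by (simp add: mult_ac)
  qed
  have "(\<Sum>n\<in>ints x. mangoldt_conv n / real n * (\<beta> - \<sigma> * E (x / real n)))
      = (\<Sum>n\<in>ints x. \<Sum>d | d dvd n. mangoldt d / real d * (mangoldt (n div d) / real (n div d) * (\<beta> - \<sigma> * E (x / real d / real (n div d)))))"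
    unfolding mangoldt_conv_def sum_divide_distrib sum_distrib_right
    by (intro sum.cong refl) (auto simp: ints_def elim!: dvdE)
  also have "\<dots> = (\<Sum>a\<in>ints x. \<Sum>b\<in>ints (x / real a). mangoldt a / real a * (mangoldt b / real b * (\<beta> - \<sigma> * E (x / real a / real b))))"
    by (rule sum_ints_divisors[symmetric])
  also have "\<dots> = (\<Sum>a\<in>ints x. mangoldt a / real a * (\<beta> * mertens (x / real a) - \<sigma> * S (x / real a)))"
    by (simp add: mertens_def S_def sum_distrib_left sum_subtractf[symmetric] algebra_simps)
  \<comment> \<open>Selberg's formula is now applied at x / a: it converts the inner sum over b back
    into the error at x / a, so the semiprime sum reduces to \<open>Q\<close> as well.\<close>
  also have "\<dots> \<le> (\<Sum>a\<in>ints x. mangoldt a / real a * ((\<beta> + \<sigma> * E (x / real a)) * u + K2))"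
  proof (intro sum_mono mult_left_mono divide_nonneg_nonneg mangoldt_nonneg)
    fix a assume "a \<in> ints x"
    then have a: "0 < a" "real a \<le> x" by (auto simp: ints_def)
    define y where "y = x / real a"
    have y: "1 \<le> y" "y \<le> x" using a x by (auto simp: y_def field_simps)
    then have "\<beta> * mertens y \<le> \<beta> * (ln y + K)" using K[OF y(1)] b0 by (intro mult_left_mono) auto
    moreover have "- (\<sigma> * S y) \<le> K1 + \<sigma> * E y * ln y" using sgS[OF y(1)] by linarith
    moreover have "(\<beta> + \<sigma> * E y) * ln y \<le> (\<beta> + \<sigma> * E y) * u"
      using y pos[of y] by (intro mult_left_mono) (auto simp: u_def)
    ultimately show "\<beta> * mertens (x / real a) - \<sigma> * S (x / real a) \<le> (\<beta> + \<sigma> * E (x / real a)) * u + K2"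
      by (simp add: y_def[symmetric] K2_def algebra_simps)
  qed auto
  also have "\<dots> = u * Q + K2 * mertens x"
    by (simp add: Q_def mertens_def sum_distrib_left sum.distrib[symmetric] algebra_simps)
  also have "\<dots> \<le> u * Q + K2 * (u + K)" using K[OF x] K2 mult_left_mono[of "mertens x" "u + K" K2] by (auto simp: u_def)
  finally have "(\<Sum>n\<in>ints x. mangoldt n * ln (real n) / real n * (\<beta> + \<sigma> * E (x / real n)))
       + (\<Sum>n\<in>ints x. mangoldt_conv n / real n * (\<beta> - \<sigma> * E (x / real n))) \<le> 2 * (u * Q) + K2 * (u + K)"
    using T1 by linarith
  also have "u * Q \<le> u * (2 * \<epsilon> * u + K2)" using Q u0 by (rule mult_left_mono)
  also have "2 * (u * (2 * \<epsilon> * u + K2)) + K2 * (u + K) = 4 * \<epsilon> * u\<^sup>2 + K2 * (3 * u + K)"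
    by (simp add: algebra_simps power2_eq_square)
  finally show ?thesis by (simp add: u_def K2_def)
qed

text \<open>The extremal argument requires a bound near the limit superior at every argument, but
  such a bound holds only beyond some X0. Setting the error to 0 below X0 affects only a in (x / X0,
  x], whose Mertens mass is bounded independently of x.\<close>

lemma truncated_selberg:
  fixes X0 :: real
  assumes "X0 \<ge> 1" and K: "K > 0" "\<And>x. x \<ge> 1 \<Longrightarrow> \<bar>mertens x - ln x\<bar> \<le> K"
    and B: "B > 0" "\<And>x. x > 0 \<Longrightarrow> \<bar>E x\<bar> \<le> B"
    and K1: "\<And>x. x \<ge> 1 \<Longrightarrow> \<bar>E x * ln x + (\<Sum>a\<in>ints x. mangoldt a / real a * E (x / real a))\<bar> \<le> K1"
    and x: "x \<ge> 1"
  defines "E' \<equiv> (\<lambda>y. if y \<ge> X0 then E y else 0)"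
  shows "\<bar>E' x * ln x + (\<Sum>a\<in>ints x. mangoldt a / real a * E' (x / real a))\<bar> \<le> K1 + B * (2 * ln X0 + 2 * K)"
proof -
  define G where "G = (\<lambda>y. E y - E' y)"
  have G: "\<bar>G y\<bar> \<le> B" if "y > 0" for y using B that by (auto simp: G_def E'_def)
  have G0: "G y = 0" if "y \<ge> X0" for y using that by (simp add: G_def E'_def)
  have 1: "\<bar>G x * ln x\<bar> \<le> B * ln X0"
  proof (cases "x \<ge> X0")
    case False
    then have "\<bar>G x\<bar> * \<bar>ln x\<bar> \<le> B * ln X0" using G[of x] x assms(1) B(1) by (intro mult_mono) auto
    then show ?thesis by (simp add: abs_mult)
  qed (use G0 B(1) assms(1) in auto)
  have 2: "\<bar>\<Sum>a\<in>ints x. mangoldt a / real a * G (x / real a)\<bar> \<le> B * (ln X0 + 2 * K)"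
  proof -
    have "\<bar>\<Sum>a\<in>ints x. mangoldt a / real a * G (x / real a)\<bar> = \<bar>\<Sum>a\<in>ints x - ints (x / X0). mangoldt a / real a * G (x / real a)\<bar>"
    proof (intro arg_cong[where f = abs] sum.mono_neutral_right ballI)
      fix a assume "a \<in> ints x - (ints x - ints (x / X0))"
      then have "0 < a" "real a \<le> x / X0" by (auto simp: ints_def)
      then have "X0 \<le> x / real a" using assms(1) by (simp add: field_simps)
      then show "mangoldt a / real a * G (x / real a) = 0" by (simp add: G0)
    qed auto
    also have "\<dots> \<le> (\<Sum>a\<in>ints x - ints (x / X0). mangoldt a / real a * B)"
    proof (rule order_trans[OF sum_abs sum_mono])
      fix a assume "a \<in> ints x - ints (x / X0)"
      then have "0 < a" by (auto simp: ints_def)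
      then have "\<bar>G (x / real a)\<bar> \<le> B" using x by (intro G) auto
      then show "\<bar>mangoldt a / real a * G (x / real a)\<bar> \<le> mangoldt a / real a * B"
        unfolding abs_mult by (intro mult_mono divide_nonneg_nonneg mangoldt_nonneg) auto
    qed
    also have "\<dots> = B * (mertens x - mertens (x / X0))"
    proof -
      have "ints (x / X0) \<subseteq> ints x" using assms(1) x by (intro ints_mono) (simp add: field_simps)
      then show ?thesis by (simp add: mertens_def sum_distrib_left sum_diff right_diff_distrib mult.commute)
    qed
    also have "\<dots> \<le> B * (ln X0 + 2 * K)"
    proof (intro mult_left_mono)
      show "mertens x - mertens (x / X0) \<le> ln X0 + 2 * K"
      proof (cases "x \<ge> X0")
        case True
        then have "ln (x / X0) = ln x - ln X0" using assms(1) by (simp add: ln_div)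
        then show ?thesis using K(2)[of x] K(2)[of "x / X0"] True assms(1) by (simp add: abs_le_iff)
      next
        case False
        then have "mertens (x / X0) = 0" using assms(1) by (simp add: mertens_def ints_empty)
        moreover have "ln x \<le> ln X0" using False x by simp
        ultimately show ?thesis using K(2)[of x] K(1) x by (simp add: abs_le_iff)
      qed
    qed (use B in auto)
    finally show ?thesis .
  qed
  have "E' x * ln x + (\<Sum>a\<in>ints x. mangoldt a / real a * E' (x / real a))
      = (E x * ln x + (\<Sum>a\<in>ints x. mangoldt a / real a * E (x / real a)))
       - G x * ln x - (\<Sum>a\<in>ints x. mangoldt a / real a * G (x / real a))"
    by (simp add: G_def sum_subtractf left_diff_distrib right_diff_distrib)
  then show ?thesis using K1[OF x] 1 2 by (simp add: algebra_simps)
qed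

text \<open>Let \<alpha> be the limit superior of the absolute error, assumed positive. At a nearly
  extremal x = exp u the nonnegative sum f is at most 4 \<epsilon> u^2 + O(u). But there are about u
  disjoint windows, each forcing a contribution of order u by \<open>pigeonhole_window\<close>, so f
  also exceeds a multiple of u^2 that is independent of \<epsilon>.\<close>

lemma dyadic_error_tendsto_0: "(dyadic_error \<longlongrightarrow> 0) at_top"
proof (rule ccontr)
  assume not: "\<not> (dyadic_error \<longlongrightarrow> 0) at_top"
  let ?E = dyadic_error
  obtain B where B: "B > 0" "\<And>x. x > 0 \<Longrightarrow> \<bar>?E x\<bar> \<le> B"
    by (rule dyadic_error_bounded) (rule that)
  obtain K where K: "K > 0" "\<And>x. x \<ge> 1 \<Longrightarrow> \<bar>mertens x - ln x\<bar> \<le> K"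
    by (rule mertens_estimate) (rule that)
  obtain K1 where K1: "K1 > 0" "\<And>x. x \<ge> 1 \<Longrightarrow> \<bar>?E x * ln x + (\<Sum>a\<in>ints x. mangoldt a / real a * ?E (x / real a))\<bar> \<le> K1"
    by (rule selberg_dyadic_error) (rule that)
  obtain C where C: "C > 0" "\<And>x y. 2 \<le> x \<Longrightarrow> x \<le> y \<Longrightarrow> y \<le> 2 * x \<Longrightarrow> \<bar>?E y - ?E x\<bar> \<le> C * ((y - x) / x) + C / ln x"
    by (rule dyadic_error_slowly_varying) (rule that)

  obtain e where e: "e > 0" "\<not> eventually (\<lambda>x. \<bar>?E x\<bar> < e) at_top"
    using not by (auto simp: tendsto_iff dist_real_def)
  define Z where "Z = {a. eventually (\<lambda>x. \<bar>?E x\<bar> \<le> a) at_top}"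
  have "B \<in> Z" unfolding Z_def using B(2) by (auto intro: eventually_mono[OF eventually_gt_at_top[of 0]])
  have Ze: "e \<le> a" if "a \<in> Z" for a
  proof (rule ccontr)
    assume "\<not> e \<le> a"
    then have "eventually (\<lambda>x. \<bar>?E x\<bar> < e) at_top"
      using that unfolding Z_def by (auto elim: eventually_mono)
    then show False using e by blast
  qed
  have bdd: "bdd_below Z" using Ze by (intro bdd_belowI[of _ e])
  define \<alpha> where "\<alpha> = Inf Z"
  have "e \<le> \<alpha>" unfolding \<alpha>_def using \<open>B \<in> Z\<close> Ze by (intro cInf_greatest) auto
  then have \<alpha>: "\<alpha> > 0" using e by simp

  \<comment> \<open>Over a window of logarithmic length 2 h the argument changes by a relative
    amount at most 4 h, hence the error by at most 4 C h \<le> \<alpha> / 4; the other \<alpha> / 4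
    is left for the term C / ln y.\<close>
  define h where "h = min (1/10) (\<alpha> / (16 * C))"
  have h: "0 < h" "h \<le> 1/10" "16 * C * h \<le> \<alpha>" using \<alpha> C by (auto simp: h_def min_def field_simps)
  have exph: "exp (2 * h) - 1 \<le> 4 * h" "exp (2 * h) \<le> 2"
  proof -
    have "exp (2 * h) \<le> 1 + 2 * h + (2 * h)\<^sup>2" using h by (intro exp_bound) auto
    moreover have "4 * (h * h) \<le> 4 * (h * (1/10))" using h by (intro mult_left_mono) auto
    moreover have "(2 * h)\<^sup>2 = 4 * (h * h)" by (simp add: power2_eq_square)
    ultimately show "exp (2 * h) - 1 \<le> 4 * h" "exp (2 * h) \<le> 2" using h by linarith+
  qed
  obtain k v0 where k: "v0 > 0" "k > 0" and win: "\<And>v. v \<ge> v0 \<Longrightarrow>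
      \<exists>j<k. prime_weight (shell (v + real j * h) (v + real j * h + 2 * h)) \<ge> h * v / 4
         \<and> semiprime_weight (shell (v + real j * h) (v + real j * h + 2 * h)) \<ge> h * v / 4"
    using h(1,2) by (rule mixed_window) (rule that)
  \<comment> \<open>Chosen so that 4 \<epsilon> is the constant c below, half the coefficient 2 c of
    u^2 forced by the windows.\<close>
  define \<epsilon> where "\<epsilon> = \<alpha> / (2048 * (real k + 1))"
  have \<epsilon>: "\<epsilon> > 0" using \<alpha> by (auto simp: \<epsilon>_def intro!: divide_pos_pos add_nonneg_pos)
  define \<beta> where "\<beta> = \<alpha> + \<epsilon>"
  obtain a where "a \<in> Z" "a < \<beta>" using cInf_lessD[of Z \<beta>] \<open>B \<in> Z\<close> \<epsilon> by (auto simp: \<alpha>_def \<beta>_def)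
  then have "eventually (\<lambda>x. \<bar>?E x\<bar> \<le> \<beta>) at_top" unfolding Z_def by (auto elim: eventually_mono)
  then obtain X0' where "\<And>x. x \<ge> X0' \<Longrightarrow> \<bar>?E x\<bar> \<le> \<beta>" by (auto simp: eventually_at_top_linorder)
  then obtain X0 where X0: "X0 \<ge> 1" "\<And>x. x \<ge> X0 \<Longrightarrow> \<bar>?E x\<bar> \<le> \<beta>"
    using that[of "max 1 X0'"] by auto
  define E' where "E' = (\<lambda>y. if y \<ge> X0 then ?E y else 0)"
  have E'bound: "\<bar>E' y\<bar> \<le> \<beta>" for y using X0(2)[of y] \<alpha> \<epsilon> by (auto simp: E'_def \<beta>_def)
  define K2 where "K2 = K1 + B * (2 * ln X0 + 2 * K)"
  have K2: "\<bar>E' x * ln x + (\<Sum>a\<in>ints x. mangoldt a / real a * E' (x / real a))\<bar> \<le> K2" if "x \<ge> 1" for x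
    unfolding E'_def K2_def using truncated_selberg[OF X0(1) K B K1(2) that] by simp
  define X1 where "X1 = max (max X0 2) (exp (4 * C / \<alpha>))"
  have X1: "X1 \<ge> X0" "X1 \<ge> 2" "X1 \<ge> exp (4 * C / \<alpha>)" by (auto simp: X1_def)
  have C1: "C / ln y \<le> \<alpha> / 4" if "y \<ge> X1" for y
  proof -
    have "4 * C / \<alpha> \<le> ln y" using X1 that by (subst ln_ge_iff) auto
    then show ?thesis using \<alpha> C ln_gt_zero[of y] X1 that by (simp add: field_simps)
  qed
  define W where "W = \<beta> * K + K2"
  define c where "c = \<alpha> / (512 * (real k + 1))"
  have c0: "c > 0" using \<alpha> by (auto simp: c_def intro!: divide_pos_pos add_nonneg_pos)
  define d where "d = (real k + 1) * h"
  have d0: "d > 0" using h by (simp add: d_def add_nonneg_pos)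
  have W0: "W \<ge> 0"
    using \<alpha> \<epsilon> K(1) K1(1) B(1) X0(1) by (simp add: W_def K2_def \<beta>_def)
  \<comment> \<open>In this order the nontrivial entries make c u^2 exceed the linear error, let the
    windows begin at u / 4, keep x / n beyond X1, provide enough windows, and place x itself beyond
    X0.\<close>
  define U where "U = Max {1, (W * (3 + K) + 1) / c, 4 * v0, 2 * ln X1, 8 * d, ln X0}"
  have U: "U \<ge> 1" "U \<ge> (W * (3 + K) + 1) / c" "U \<ge> 4 * v0" "U \<ge> 2 * ln X1" "U \<ge> 8 * d" "U \<ge> ln X0"
    unfolding U_def by (intro Max_ge; simp)+
  \<comment> \<open>Since \<beta> - 2 \<epsilon> = \<alpha> - \<epsilon>, minimality of \<alpha>
    supplies arbitrarily large x that are extremal in the sense of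
    \<open>extremal_upper_bound\<close>.\<close>
  have "\<not> eventually (\<lambda>x. \<bar>?E x\<bar> \<le> \<alpha> - \<epsilon>) at_top"
    using cInf_lower[of "\<alpha> - \<epsilon>" Z] bdd \<epsilon> by (auto simp: Z_def \<alpha>_def)
  then obtain x where x: "x \<ge> exp U" "\<bar>?E x\<bar> > \<alpha> - \<epsilon>"
    by (auto simp: eventually_at_top_linorder not_le)
  define u where "u = ln x"
  have x0: "x > 0" using x(1) by (meson exp_gt_zero less_le_trans)
  then have ex: "x = exp u" by (simp add: u_def)
  have uU: "u \<ge> U" using x(1) by (simp add: ex)
  have u: "u \<ge> 1" "u \<ge> (W * (3 + K) + 1) / c" "u / 4 \<ge> v0" "u / 2 \<ge> ln X1" "u \<ge> 8 * d" "u \<ge> ln X0"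
    using U uU by auto
  have x1: "x \<ge> 1" "x \<ge> X0" using u X0(1) x0 by (auto simp: ex ln_ge_iff[symmetric])
     (metis dual_order.trans exp_le_cancel_iff exp_ln less_le_trans zero_less_one order_refl)
  define \<sigma> :: real where "\<sigma> = (if ?E x \<ge> 0 then 1 else -1)"
  have sg: "\<sigma> = 1 \<or> \<sigma> = -1" by (simp add: \<sigma>_def)
  have ext: "\<sigma> * E' x \<ge> \<beta> - 2 * \<epsilon>" using x(2) x1 by (auto simp: \<sigma>_def E'_def \<beta>_def)

  define f where "f = (\<lambda>n. mangoldt n * ln (real n) / real n * (\<beta> + \<sigma> * E' (x / real n))
       + mangoldt_conv n / real n * (\<beta> - \<sigma> * E' (x / real n)))"
  have upper: "sum f (ints x) \<le> 4 * \<epsilon> * u\<^sup>2 + W * (3 * u + K)"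
    using extremal_upper_bound[OF K(2) K2 E'bound sg x1(1) ext] by (simp add: f_def sum.distrib W_def u_def)
  have f0: "f n \<ge> 0" if "n \<in> ints x" for n
  proof -
    have "\<bar>\<sigma> * E' (x / real n)\<bar> \<le> \<beta>" using E'bound[of "x / real n"] sg by auto
    then have p: "0 \<le> \<beta> + \<sigma> * E' (x / real n)" "0 \<le> \<beta> - \<sigma> * E' (x / real n)" by linarith+
    have q: "0 \<le> mangoldt n * ln (real n) / real n" "0 \<le> mangoldt_conv n / real n"
      using that by (auto intro!: mult_nonneg_nonneg divide_nonneg_nonneg mangoldt_nonneg mangoldt_conv_nonneg simp: ints_def)
    show ?thesis unfolding f_def
      by (rule add_nonneg_nonneg[OF mult_nonneg_nonneg[OF q(1) p(1)] mult_nonneg_nonneg[OF q(2) p(2)]])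
  qed
  \<comment> \<open>Blocks of length d have room for k window positions of step h and a window of
    length 2 h. They lie between u / 4 and u / 2: the lower end keeps every window weight of order
    u, the upper end keeps x / n at least exp (u / 2).\<close>
  define v where "v = (\<lambda>i::nat. u / 4 + real i * d)"
  define I where "I = nat \<lfloor>u / (4 * d)\<rfloor>"
  have vI: "v i + d \<le> u / 2" if "i < I" for i
  proof -
    have "real (Suc i) \<le> real I" using that by linarith
    also have "\<dots> \<le> u / (4 * d)" using u d0 by (simp add: I_def)
    finally have "real (Suc i) * d \<le> u / 4" using d0 by (simp add: field_simps)
    then show ?thesis by (simp add: v_def algebra_simps)
  qed
  have "\<exists>j<k. prime_weight (shell (v i + real j * h) (v i + real j * h + 2 * h)) \<ge> h * v i / 4
         \<and> semiprime_weight (shell (v i + real j * h) (v i + real j * h + 2 * h)) \<ge> h * v i / 4" for i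
  proof (rule win)
    have "real i * d \<ge> 0" using d0 by simp
    then show "v0 \<le> v i" using u(3) unfolding v_def by linarith
  qed
  then obtain j where j: "\<And>i. j i < k" "\<And>i. prime_weight (shell (v i + real (j i) * h) (v i + real (j i) * h + 2 * h)) \<ge> h * v i / 4"
     "\<And>i. semiprime_weight (shell (v i + real (j i) * h) (v i + real (j i) * h + 2 * h)) \<ge> h * v i / 4"
    by metis
  define t where "t = (\<lambda>i. v i + real (j i) * h)"
  define J where "J = (\<lambda>i. shell (t i) (t i + 2 * h))"
  have t: "v i \<le> t i" "t i + 2 * h \<le> v i + d" for i
  proof -
    have "real (j i) + 1 \<le> real k" using j(1)[of i] by linarith
    then have "(real (j i) + 1) * h \<le> real k * h" using h by (intro mult_right_mono) auto
    then show "t i + 2 * h \<le> v i + d" by (simp add: t_def d_def algebra_simps)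
    show "v i \<le> t i" using h by (simp add: t_def)
  qed
  have vmono: "v i + d \<le> v i'" if "i < i'" for i i'
  proof -
    have "real i + 1 \<le> real i'" using that by linarith
    then have "(real i + 1) * d \<le> real i' * d" using d0 by (intro mult_right_mono) auto
    then show ?thesis by (simp add: v_def algebra_simps)
  qed
  have disj: "J i \<inter> J i' = {}" if "i \<noteq> i'" for i i'
  proof -
    have "J a \<inter> J b = {}" if "a < b" for a b
      unfolding J_def using vmono[OF that] t(2)[of a] t(1)[of b] by (intro shell_disjoint) linarith
    then show ?thesis using that by (metis Int_commute linorder_neqE_nat)
  qed
  have Jsub: "J i \<subseteq> ints x" if "i < I" for i
  proof
    fix n assume "n \<in> J i"
    then have "0 < n" "ln (real n) \<le> t i + 2 * h" using ln_shell unfolding J_def by blast+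
    then have "ln (real n) \<le> ln x" using t(2)[of i] vI[OF that] u(1) by (simp add: u_def)
    then show "n \<in> ints x" using \<open>0 < n\<close> x0 by (simp add: ints_def)
  qed
  have low: "sum f (J i) \<ge> \<alpha> / 2 * (h * u / 16)" if i: "i < I" for i
  proof -
    \<comment> \<open>The smallest possible value of x / n on the window serves as common reference
      point.\<close>
    define y0 where "y0 = exp (u - (t i + 2 * h))"
    have "exp (ln X1) \<le> y0" unfolding y0_def using vI[OF i] t(2)[of i] u(4) by (simp del: exp_ln)
    then have y0: "y0 \<ge> X1" using X1 by simp
    have vary: "\<bar>E' (x / real n) - E' y0\<bar> \<le> \<alpha> / 2" if "n \<in> J i" for n
    proof -
      have n: "exp (t i) < real n" "real n \<le> exp (t i + 2 * h)" using that by (auto simp: J_def shell_iff)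
      have n0: "real n > 0" using n(1) by (meson exp_gt_zero less_trans)
      have "y0 = x / exp (t i + 2 * h)" by (simp add: y0_def ex exp_diff)
      then have 1: "y0 \<le> x / real n" using n(2) n0 x0 by (simp add: divide_left_mono)
      have "x / real n \<le> x / exp (t i)" using n x0 n0 by (intro divide_left_mono) auto
      also have "\<dots> = exp (2 * h) * y0" by (simp add: y0_def ex exp_diff exp_add)
      finally have 2: "x / real n \<le> exp (2 * h) * y0" .
      have y00: "y0 > 0" using y0 X1 by linarith
      have "exp (2 * h) * y0 \<le> 2 * y0" using exph y00 by (intro mult_right_mono) auto
      then have "x / real n \<le> 2 * y0" using 2 by linarith
      then have "\<bar>?E (x / real n) - ?E y0\<bar> \<le> C * ((x / real n - y0) / y0) + C / ln y0"
        using 1 y0 X1 by (intro C(2)) auto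
      also have "(x / real n - y0) / y0 \<le> 4 * h"
      proof -
        have "x / real n - y0 \<le> (exp (2 * h) - 1) * y0" using 2 by (simp add: algebra_simps)
        also have "\<dots> \<le> 4 * h * y0" using exph y00 by (intro mult_right_mono) auto
        finally show ?thesis using y00 by (simp add: field_simps)
      qed
      then have "C * ((x / real n - y0) / y0) \<le> C * (4 * h)" using C by (intro mult_left_mono) auto
      then have "C * ((x / real n - y0) / y0) + C / ln y0 \<le> \<alpha> / 2" using C1[OF y0] h(3) by linarith
      finally show ?thesis using y0 X1 1 by (simp add: E'_def)
    qed
    have "\<alpha> / 2 * (h * v i / 4) \<le> (\<Sum>n\<in>J i. mangoldt n * ln (real n) / real n * (\<beta> + \<sigma> * E' (x / real n)))
       + (\<Sum>n\<in>J i. mangoldt_conv n / real n * (\<beta> - \<sigma> * E' (x / real n)))"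
    proof (rule pigeonhole_window[where ?e0.0 = "E' y0"])
      show "\<alpha> > 0" by (rule \<alpha>)
      show "\<bar>E' y\<bar> \<le> \<beta>" for y by (rule E'bound)
      show "\<bar>E' (x / real n) - E' y0\<bar> \<le> \<alpha> / 2" if "n \<in> J i" for n using that by (rule vary)
      show "\<bar>\<sigma>\<bar> = 1" using sg by auto
      show "\<alpha> \<le> \<beta>" using \<epsilon> by (simp add: \<beta>_def)
      show "finite (J i)" by (simp add: J_def)
      show "h * v i / 4 \<le> prime_weight (J i)" "h * v i / 4 \<le> semiprime_weight (J i)"
        using j(2,3)[of i] by (auto simp: J_def t_def)
      show "0 \<le> h * v i / 4" using h u(1) d0 by (simp add: v_def)
      show "0 < n" if "n \<in> J i" for n using that ln_shell by (auto simp: J_def)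
    qed
    moreover have "h * (u / 4) \<le> h * v i" using h d0 by (intro mult_left_mono) (auto simp: v_def)
    then have "\<alpha> / 2 * (h * u / 16) \<le> \<alpha> / 2 * (h * v i / 4)" using \<alpha> by (intro mult_left_mono) auto
    ultimately show ?thesis by (simp add: f_def sum.distrib)
  qed
  have "real I * (\<alpha> / 2 * (h * u / 16)) = (\<Sum>i<I. \<alpha> / 2 * (h * u / 16))" by simp
  also have "\<dots> \<le> (\<Sum>i<I. sum f (J i))" using low by (intro sum_mono) auto
  also have "\<dots> = sum f (\<Union>i<I. J i)" using disj by (subst sum.UNION_disjoint) (auto simp: J_def)
  also have "\<dots> \<le> sum f (ints x)" using Jsub f0 by (intro sum_mono2) auto
  also note upper
  finally have main: "real I * (\<alpha> / 2 * (h * u / 16)) \<le> 4 * \<epsilon> * u\<^sup>2 + W * (3 * u + K)" .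
  have "real I \<ge> u / (4 * d) - 1" by (simp add: I_def) linarith
  moreover have "u / (8 * d) \<ge> 1" using u(5) d0 by (simp add: field_simps)
  moreover have "u / (4 * d) = u / (8 * d) + u / (8 * d)" by simp
  ultimately have "u / (8 * d) \<le> real I" by linarith
  then have 1: "u / (8 * d) * (\<alpha> / 2 * (h * u / 16)) \<le> real I * (\<alpha> / 2 * (h * u / 16))"
    using \<alpha> h u(1) by (intro mult_right_mono) auto
  have 2: "u / (8 * d) * (\<alpha> / 2 * (h * u / 16)) = 2 * c * u\<^sup>2"
  proof -
    define r where "r = real k + 1"
    have "r > 0" by (simp add: r_def add_nonneg_pos)
    then show ?thesis unfolding d_def c_def r_def[symmetric] using h by (simp add: field_simps power2_eq_square)
  qed
  have 3: "4 * \<epsilon> = c"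
  proof -
    have "4 * (\<alpha> / (2048 * r)) = \<alpha> / (512 * r)" for r :: real by simp
    then show ?thesis unfolding \<epsilon>_def c_def .
  qed
  have "2 * c * u\<^sup>2 \<le> c * u\<^sup>2 + W * (3 * u + K)"
    using order_trans[OF 1 main] unfolding 2 3 .
  then have "c * u\<^sup>2 \<le> W * (3 * u + K)" by linarith
  moreover have "W * (3 * u + K) \<le> W * ((3 + K) * u)"
    using W0 K(1) u(1) mult_left_mono[of 1 u K] by (intro mult_left_mono) (auto simp: algebra_simps)
  moreover have "(W * (3 + K) + 1) * u \<le> c * u * u"
    using u(1,2) c0 by (intro mult_right_mono) (auto simp: field_simps)
  ultimately show False using u(1) by (simp add: power2_eq_square algebra_simps)
qed

text \<open>Halving s repeatedly, the dyadic errors add up to at most \<epsilon> s, and the range up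
  to 2 X is absorbed by M. In this form the estimate holds for all s \<ge> 0, so it can be used at
  both ends of an interval (s, N] uniformly in s.\<close>

theorem prime_number_theorem_psi:
  assumes "\<epsilon> > 0"
  obtains M where "M \<ge> 0" "\<And>s. s \<ge> 0 \<Longrightarrow> \<bar>psi s - s\<bar> \<le> M + \<epsilon> * s"
proof -
  have "eventually (\<lambda>x. \<bar>dyadic_error x\<bar> < \<epsilon>) at_top"
    using dyadic_error_tendsto_0 assms by (auto simp: tendsto_iff dist_real_def)
  then obtain X' where X': "\<And>x. x \<ge> X' \<Longrightarrow> \<bar>dyadic_error x\<bar> < \<epsilon>" by (auto simp: eventually_at_top_linorder)
  define X where "X = max 1 X'"
  have X: "X \<ge> 1" "\<And>x. x \<ge> X \<Longrightarrow> \<bar>dyadic_error x\<bar> < \<epsilon>" using X' by (auto simp: X_def)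
  define M where "M = psi (2 * X) + 2 * X"
  have small: "\<bar>psi s - s\<bar> \<le> M" if "0 \<le> s" "s \<le> 2 * X" for s
    using psi_mono[OF that(2)] psi_nonneg[of s] that by (simp add: M_def abs_le_iff)
  have ind: "\<bar>psi s - s\<bar> \<le> M + \<epsilon> * s" if "0 \<le> s" "s \<le> 2 ^ Suc n * X" for s n
    using that
  proof (induction n arbitrary: s)
    case 0
    then have "\<epsilon> * s \<ge> 0" using assms by simp
    then show ?case using small[of s] 0 by simp
  next
    case (Suc n)
    show ?case
    proof (cases "s \<le> 2 * X")
      case True then show ?thesis using small[of s] Suc.prems assms by (simp add: add_increasing2)
    next
      case False
      define y where "y = s / 2"
      have y: "y \<ge> X" "s = 2 * y" using False by (auto simp: y_def)
      have "\<bar>psi y - y\<bar> \<le> M + \<epsilon> * y" using Suc.prems y X by (intro Suc.IH) (auto simp: mult_ac)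
      moreover have "\<bar>(psi (2 * y) - psi y) - y\<bar> \<le> \<epsilon> * y"
      proof -
        have "(psi (2 * y) - psi y) - y = dyadic_error y * y" using y X by (simp add: dyadic_error_def field_simps)
        also have "\<bar>\<dots>\<bar> \<le> \<epsilon> * y" unfolding abs_mult using less_imp_le[OF X(2)[OF y(1)]] assms y(1) X(1) by (intro mult_mono) auto
        finally show ?thesis .
      qed
      ultimately show ?thesis unfolding y(2) by linarith
    qed
  qed
  show ?thesis
  proof (rule that)
    show "M \<ge> 0" using psi_nonneg[of "2 * X"] X by (simp add: M_def)
    fix s :: real assume "s \<ge> 0"
    obtain n where "s < 2 ^ n" using real_arch_pow[of 2 s] by auto
    then have "s \<le> 2 ^ n * 1" by simp
    also have "\<dots> \<le> 2 ^ n * X" using X(1) by (intro mult_left_mono) auto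
    also have "\<dots> \<le> 2 ^ Suc n * X" using X(1) by simp
    finally have "s \<le> 2 ^ Suc n * X" .
    then show "\<bar>psi s - s\<bar> \<le> M + \<epsilon> * s" using ind \<open>s \<ge> 0\<close> by blast
  qed
qed

section \<open>An upper bound sieve\<close>

lemma sum_crt:
  fixes M p :: nat
  assumes "coprime M p" "M > 0" "p > 0"
  shows "(\<Sum>n<M * p. F (n mod M) (n mod p)) = (\<Sum>a<M. \<Sum>b<p. F a b)"
proof -
  have inj: "inj_on (\<lambda>n. (n mod M, n mod p)) {..<M * p}"
  proof (rule inj_onI)
    fix n m assume nm: "n \<in> {..<M * p}" "m \<in> {..<M * p}" "(n mod M, n mod p) = (m mod M, m mod p)"
    then have "[n = m] (mod M)" "[n = m] (mod p)" by (auto simp: unique_euclidean_semiring_class.cong_def)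
    then have "[n = m] (mod M * p)" using assms(1) by (simp add: coprime_cong_mult_nat)
    then show "n = m" using nm by (simp add: unique_euclidean_semiring_class.cong_def)
  qed
  have "(\<lambda>n. (n mod M, n mod p)) ` {..<M * p} = {..<M} \<times> {..<p}"
    using assms card_image[OF inj] by (intro card_subset_eq) auto
  then have "(\<Sum>(a,b)\<in>{..<M} \<times> {..<p}. F a b) = (\<Sum>n<M * p. F (n mod M) (n mod p))"
    using sum.reindex[OF inj, of "\<lambda>(a,b). F a b"] by simp
  then show ?thesis by (simp add: sum.cartesian_product)
qed

text \<open>The Chinese remainder theorem in probabilistic form: functions of the residues modulo
  different primes are independent over a full period.\<close>

lemma sum_prod_periodic:
  fixes f :: "nat \<Rightarrow> nat \<Rightarrow> real"
  assumes "finite T" "\<And>p. p \<in> T \<Longrightarrow> prime p" "\<And>p n. p \<in> T \<Longrightarrow> f p (n mod p) = f p n"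
  shows "(\<Sum>n<\<Prod>T. \<Prod>p\<in>T. f p n) = (\<Prod>p\<in>T. \<Sum>n<p. f p n)"
  using assms
proof (induction T rule: finite_induct)
  case (insert p T)
  define M where "M = \<Prod>T"
  have M: "coprime M p" "M > 0" "p > 0" unfolding M_def using insert
    by (auto intro!: prod_coprime_left primes_coprime prime_gt_0_nat simp: prod_pos prime_gt_0_nat)
  have per: "f q (n mod M) = f q n" if "q \<in> T" for q n
  proof -
    have "q dvd M" unfolding M_def using that insert by (intro dvd_prodI[where f = "\<lambda>x. x", simplified]) auto
    then have "n mod M mod q = n mod q" by (simp add: mod_mod_cancel)
    then show ?thesis using insert.prems(2)[of q "n mod M"] insert.prems(2)[of q n] that by simp
  qed
  have "(\<Sum>n<\<Prod>(insert p T). \<Prod>q\<in>insert p T. f q n) = (\<Sum>n<M * p. (\<Prod>q\<in>T. f q (n mod M)) * f p (n mod p))"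
    using insert per by (simp add: M_def mult.commute cong: prod.cong)
  also have "\<dots> = (\<Sum>a<M. \<Sum>b<p. (\<Prod>q\<in>T. f q a) * f p b)" by (rule sum_crt[OF M])
  also have "\<dots> = (\<Prod>q\<in>T. \<Sum>n<q. f q n) * (\<Sum>b<p. f p b)"
    using insert by (simp add: sum_product M_def[symmetric] flip: sum_distrib_left sum_distrib_right)
  finally show ?case using insert by (simp add: mult.commute)
qed simp

lemma sum_periodic_window:
  fixes F :: "nat \<Rightarrow> real"
  assumes "\<And>n. F (n + M) = F n"
  shows "(\<Sum>n\<in>{s..<s + M}. F n) = (\<Sum>n<M. F n)"
proof (cases "M = 0")
  case False
  show ?thesis
  proof (induction s)
    case 0 show ?case by (simp add: atLeast0LessThan)
  next
    case (Suc s)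
    have "(\<Sum>n\<in>{Suc s..<Suc s + M}. F n) = (\<Sum>n\<in>{Suc s..<s + M}. F n) + F (s + M)"
      using False by (simp add: sum.atLeastLessThan_Suc)
    also have "\<dots> = (\<Sum>n\<in>{s..<s + M}. F n)"
      using False sum.atLeast_Suc_lessThan[of s "s + M" F] assms by simp
    finally show ?case using Suc by simp
  qed
qed simp

text \<open>Full periods contribute their mean, and the incomplete last period costs at most its
  length because F is bounded by 1.\<close>

lemma sum_periodic_le:
  fixes F :: "nat \<Rightarrow> real"
  assumes per: "\<And>n. F (n + M) = F n" and b: "\<And>n. \<bar>F n\<bar> \<le> 1" and M: "M > 0"
    and nn: "(\<Sum>n<M. F n) \<ge> 0"
  shows "(\<Sum>n\<in>{s..<s + X}. F n) \<le> real X / real M * (\<Sum>n<M. F n) + real M"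
proof (induction X arbitrary: s rule: less_induct)
  case (less X)
  show ?case
  proof (cases "X < M")
    case True
    have "(\<Sum>n\<in>{s..<s + X}. F n) \<le> (\<Sum>n\<in>{s..<s + X}. 1)" using b by (intro sum_mono) (auto simp: abs_le_iff)
    also have "\<dots> \<le> real M" using True by simp
    also have "\<dots> \<le> real X / real M * (\<Sum>n<M. F n) + real M" using nn by simp
    finally show ?thesis .
  next
    case False
    have "(\<Sum>n\<in>{s..<s + X}. F n) = (\<Sum>n\<in>{s..<s + M}. F n) + (\<Sum>n\<in>{s + M..<s + M + (X - M)}. F n)"
      using False sum.atLeastLessThan_concat[of s "s + M" "s + X" F] by simp
    also have "(\<Sum>n\<in>{s..<s + M}. F n) = (\<Sum>n<M. F n)" using per by (rule sum_periodic_window)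
    also have "(\<Sum>n\<in>{s + M..<s + M + (X - M)}. F n) \<le> real (X - M) / real M * (\<Sum>n<M. F n) + real M"
      using False M by (intro less) auto
    also have "(\<Sum>n<M. F n) + (real (X - M) / real M * (\<Sum>n<M. F n) + real M) = real X / real M * (\<Sum>n<M. F n) + real M"
      using False M by (simp add: field_simps of_nat_diff)
    finally show ?thesis by simp
  qed
qed

section \<open>Selberg's upper bound sieve as a second moment estimate\<close>

locale sieve =
  fixes P :: "nat set" and Om :: "nat \<Rightarrow> nat set"
  assumes fin: "finite P" and prime: "\<And>p. p \<in> P \<Longrightarrow> prime p"
    and Om: "\<And>p. p \<in> P \<Longrightarrow> Om p \<subseteq> {..<p}" and Om_card: "\<And>p. p \<in> P \<Longrightarrow> 2 * card (Om p) \<le> p"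
begin

definition h :: "nat \<Rightarrow> real" where
  "h p = real (card (Om p)) / (real p - real (card (Om p)))"

text \<open>For \<open>n\<close> uniform modulo \<open>p\<close> the variables \<open>g p n\<close> have mean 0 and variance \<open>h p\<close>, and they are
  independent for different \<open>p\<close>; on sifted \<open>n\<close> they are constant. This replaces the
  diagonalisation of the quadratic form in Selberg's sieve.\<close>

definition g :: "nat \<Rightarrow> nat \<Rightarrow> real" where
  "g p n = (if n mod p \<in> Om p then -1 else h p)"

lemma p_pos: "p \<in> P \<Longrightarrow> p > 0" using prime prime_gt_0_nat by blast

lemma card_lt: "p \<in> P \<Longrightarrow> card (Om p) < p" using Om_card[of p] p_pos[of p] by linarith

lemma h_bounds: assumes "p \<in> P" shows "0 \<le> h p" "h p \<le> 1"
  using Om_card[OF assms] card_lt[OF assms] by (auto simp: h_def field_simps)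

lemma sum_g: assumes p: "p \<in> P" shows "(\<Sum>n<p. g p n) = 0" "(\<Sum>n<p. g p n * g p n) = real p * h p"
proof -
  have fO: "finite (Om p)" using Om[OF p] finite_subset by blast
  have card: "card {n. n < p \<and> n \<notin> Om p} = p - card (Om p)"
  proof -
    have "{n. n < p \<and> n \<notin> Om p} = {..<p} - Om p" by auto
    then show ?thesis using Om[OF p] fO by (simp add: card_Diff_subset)
  qed
  have split: "(\<Sum>n<p. if n mod p \<in> Om p then a else b) = real (card (Om p)) * a + (real p - real (card (Om p))) * b" for a b :: real
  proof -
    have "(\<Sum>n<p. if n mod p \<in> Om p then a else b) = (\<Sum>n<p. if n \<in> Om p then a else b)"
      by (intro sum.cong) auto
    also have "\<dots> = (\<Sum>n\<in>Om p. a) + (\<Sum>n\<in>{..<p} - Om p. b)"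
      using Om[OF p] by (subst sum.If_cases) (auto simp: Int_absorb1 Diff_eq)
    finally show ?thesis using Om[OF p] fO card_lt[OF p] by (simp add: card_Diff_subset of_nat_diff)
  qed
  have d: "real p - real (card (Om p)) > 0" using card_lt[OF p] by simp
  show "(\<Sum>n<p. g p n) = 0" unfolding g_def split using d by (simp add: h_def)
  have "(\<Sum>n<p. g p n * g p n) = (\<Sum>n<p. if n mod p \<in> Om p then 1 else h p * h p)"
    by (intro sum.cong) (auto simp: g_def)
  also have "\<dots> = real p * h p"
  proof -
    have "w + q * (w / q * (w / q)) = (w + q) * (w / q)" if "q > 0" for w q :: real
      using that by (simp add: field_simps)
    from this[OF d, of "real (card (Om p))"] show ?thesis unfolding split h_def by simp
  qed
  finally show "(\<Sum>n<p. g p n * g p n) = real p * h p" .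
qed

text \<open>This is where at most half of the residues may be forbidden: then h p \<le> 1, and the
  products of the g p stay bounded by 1, as the estimate of incomplete periods requires.\<close>

lemma abs_g: "p \<in> P \<Longrightarrow> \<bar>g p n\<bar> \<le> 1"
  using h_bounds[of p] by (auto simp: g_def)

definition G :: "nat set \<Rightarrow> nat \<Rightarrow> real" where
  "G T n = (\<Prod>p\<in>T. g p n)"

text \<open>A prime lying in only one of the two sets contributes an independent factor of mean 0,
  so only the diagonal has a main term. The error is the length of one period, which is at most the
  product of the two moduli.\<close>

lemma correlation:
  assumes T: "T1 \<subseteq> P" "T2 \<subseteq> P"
  shows "(\<Sum>n\<in>{s..<s + X}. G T1 n * G T2 n)
     \<le> (if T1 = T2 then real X * (\<Prod>p\<in>T1. h p) else 0) + real (\<Prod>T1 * \<Prod>T2)"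
proof -
  let ?T = "T1 \<union> T2"
  define M where "M = \<Prod>?T"
  have fT: "finite T1" "finite T2" using T fin finite_subset by blast+
  define f where "f = (\<lambda>p n. (if p \<in> T1 then g p n else 1) * (if p \<in> T2 then g p n else 1))"
  have G: "G T1 n * G T2 n = (\<Prod>p\<in>?T. f p n)" for n
  proof -
    have "G T1 n = (\<Prod>p\<in>?T. if p \<in> T1 then g p n else 1)" "G T2 n = (\<Prod>p\<in>?T. if p \<in> T2 then g p n else 1)"
      unfolding G_def using fT by (auto intro!: prod.mono_neutral_cong_left)
    then show ?thesis by (simp add: f_def prod.distrib)
  qed
  have TP: "p \<in> P" if "p \<in> ?T" for p using that T by auto
  have f1: "\<bar>f p n\<bar> \<le> 1" if "p \<in> ?T" for p n
    using abs_g[OF TP[OF that], of n] by (auto simp: f_def abs_mult mult_le_one)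
  have pos: "M > 0" "\<Prod>T1 > 0" "\<Prod>T2 > 0" "\<Prod>(T1 \<inter> T2) > 0" unfolding M_def using TP p_pos T by (auto intro!: prod_pos)
  have "M \<le> M * \<Prod>(T1 \<inter> T2)" using pos by simp
  also have "\<dots> = \<Prod>T1 * \<Prod>T2" unfolding M_def using prod.union_inter[OF fT, of "\<lambda>x. x"] by simp
  finally have Mle: "M \<le> \<Prod>T1 * \<Prod>T2" .
  have fper: "f p (n mod p) = f p n" for p n by (simp add: f_def g_def)
  have full: "(\<Sum>n<M. \<Prod>p\<in>?T. f p n) = (\<Prod>p\<in>?T. \<Sum>n<p. f p n)"
    unfolding M_def using fT prime TP fper by (intro sum_prod_periodic) auto
  have full2: "(\<Prod>p\<in>?T. \<Sum>n<p. f p n) = (if T1 = T2 then real M * (\<Prod>p\<in>T1. h p) else 0)"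
  proof (cases "T1 = T2")
    case True
    then have "(\<Prod>p\<in>?T. \<Sum>n<p. f p n) = (\<Prod>p\<in>T1. real p * h p)"
      using sum_g(2) T by (intro prod.cong) (auto simp: f_def)
    then show ?thesis using True by (simp add: prod.distrib M_def)
  next
    case False
    then obtain p where p: "p \<in> ?T" "p \<notin> T1 \<or> p \<notin> T2" by auto
    then have "(\<Sum>n<p. f p n) = (\<Sum>n<p. g p n)" by (intro sum.cong) (auto simp: f_def)
    also have "\<dots> = 0" using sum_g(1) TP p by auto
    finally show ?thesis using p False fT by (auto intro!: prod_zero)
  qed
  have per: "(\<Prod>p\<in>?T. f p (n + M)) = (\<Prod>p\<in>?T. f p n)" for n
  proof (intro prod.cong refl)
    fix p assume "p \<in> ?T"
    then have "p dvd M" unfolding M_def using fT by (intro dvd_prodI[where f = "\<lambda>x. x", simplified]) auto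
    then have "(n + M) mod p = n mod p" by (metis dvd_eq_mod_eq_0 mod_add_right_eq add_0_right)
    then show "f p (n + M) = f p n" by (metis fper)
  qed
  have "(\<Sum>n\<in>{s..<s + X}. \<Prod>p\<in>?T. f p n) \<le> real X / real M * (\<Sum>n<M. \<Prod>p\<in>?T. f p n) + real M"
  proof (rule sum_periodic_le[where M = M])
    show "(\<Prod>p\<in>?T. f p (n + M)) = (\<Prod>p\<in>?T. f p n)" for n by (rule per)
    show "M > 0" by (rule pos)
    show "\<bar>\<Prod>p\<in>?T. f p n\<bar> \<le> 1" for n unfolding abs_prod using f1 by (intro prod_le_1) auto
    show "0 \<le> (\<Sum>n<M. \<Prod>p\<in>?T. f p n)" unfolding full full2 using h_bounds T by (auto intro!: mult_nonneg_nonneg prod_nonneg)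
  qed
  also have "real X / real M * (\<Sum>n<M. \<Prod>p\<in>?T. f p n) = (if T1 = T2 then real X * (\<Prod>p\<in>T1. h p) else 0)"
    unfolding full full2 using pos by simp
  finally show ?thesis unfolding G using Mle by (smt (verit) of_nat_mono)
qed

text \<open>Squarefree numbers up to D composed of primes of P, encoded as their sets of prime
  factors.\<close>

definition supp :: "nat \<Rightarrow> nat set set" where
  "supp D = {T. T \<subseteq> P \<and> \<Prod>T \<le> D}"

text \<open>The denominator of Selberg's sieve: the sum over squarefree d up to D of the product of
  h p over the primes dividing d.\<close>

definition L :: "nat \<Rightarrow> real" where
  "L D = (\<Sum>T\<in>supp D. \<Prod>p\<in>T. h p)"

lemma finite_supp: "finite (supp D)"
  unfolding supp_def using fin by (auto intro: finite_subset[of _ "Pow P"])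

lemma card_supp: "card (supp D) \<le> D"
proof -
  have "inj_on (\<lambda>T. \<Prod>T) (supp D)"
  proof (rule inj_on_inverseI[where g = prime_factors])
    fix T assume "T \<in> supp D"
    then show "prime_factors (\<Prod>T) = T"
      using prime finite_subset[OF _ fin] by (intro prime_factors_prod_primes) (auto simp: supp_def)
  qed
  then have "card (supp D) = card ((\<lambda>T. \<Prod>T) ` supp D)" by (simp add: card_image)
  also have "\<dots> \<le> card {1..D}"
  proof (intro card_mono image_subsetI)
    fix T assume T: "T \<in> supp D"
    then have "\<Prod>T > 0" using p_pos by (intro prod_pos) (auto simp: supp_def)
    then show "\<Prod>T \<in> {1..D}" using T by (auto simp: supp_def)
  qed auto
  finally show ?thesis by simp
qed

lemma L_ge_1: "D \<ge> 1 \<Longrightarrow> L D \<ge> 1"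
proof -
  assume "D \<ge> 1"
  then have "{} \<in> supp D" by (simp add: supp_def)
  then have "(\<Sum>T\<in>{{}}. \<Prod>p\<in>T. h p) \<le> L D"
    unfolding L_def using finite_supp h_bounds
    by (intro sum_mono2) (auto intro!: prod_nonneg simp: supp_def)
  then show ?thesis by simp
qed

text \<open>On sifted n each g p n equals h p, so the sum of G T n over the support is exactly L D
  there. Its second moment over the interval is at most X L D plus the errors of at most D^2 pairs,
  each at most D^2. Dividing by the square of L D gives the claim.\<close>

theorem sieve_bound:
  assumes D: "D \<ge> 1"
  shows "real (card {n\<in>{s..<s + X}. \<forall>p\<in>P. n mod p \<notin> Om p}) \<le> real X / L D + real D ^ 4"
proof -
  define Z where "Z = {n\<in>{s..<s + X}. \<forall>p\<in>P. n mod p \<notin> Om p}"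
  have L1: "L D \<ge> 1" using L_ge_1[OF D] .
  have "real (card Z) * (L D)\<^sup>2 = (\<Sum>n\<in>Z. (\<Sum>T\<in>supp D. G T n)\<^sup>2)"
  proof -
    have "(\<Sum>T\<in>supp D. G T n) = L D" if "n \<in> Z" for n
      unfolding L_def G_def using that by (intro sum.cong prod.cong) (auto simp: Z_def supp_def g_def)
    then show ?thesis by simp
  qed
  also have "\<dots> \<le> (\<Sum>n\<in>{s..<s + X}. (\<Sum>T\<in>supp D. G T n)\<^sup>2)"
    by (intro sum_mono2) (auto simp: Z_def)
  also have "\<dots> = (\<Sum>n\<in>{s..<s + X}. \<Sum>T1\<in>supp D. \<Sum>T2\<in>supp D. G T1 n * G T2 n)"
    by (simp add: power2_eq_square sum_product)
  also have "\<dots> = (\<Sum>T1\<in>supp D. \<Sum>n\<in>{s..<s + X}. \<Sum>T2\<in>supp D. G T1 n * G T2 n)"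
    by (rule sum.swap)
  also have "\<dots> = (\<Sum>T1\<in>supp D. \<Sum>T2\<in>supp D. \<Sum>n\<in>{s..<s + X}. G T1 n * G T2 n)"
    by (intro sum.cong refl sum.swap)
  also have "\<dots> \<le> (\<Sum>T1\<in>supp D. \<Sum>T2\<in>supp D. (if T1 = T2 then real X * (\<Prod>p\<in>T1. h p) else 0) + real D * real D)"
  proof (intro sum_mono)
    fix T1 T2 assume T: "T1 \<in> supp D" "T2 \<in> supp D"
    have "(\<Sum>n\<in>{s..<s + X}. G T1 n * G T2 n) \<le> (if T1 = T2 then real X * (\<Prod>p\<in>T1. h p) else 0) + real (\<Prod>T1 * \<Prod>T2)"
      using T by (intro correlation) (auto simp: supp_def)
    moreover have "real (\<Prod>T1 * \<Prod>T2) \<le> real (D * D)"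
      using T by (intro of_nat_mono mult_le_mono) (auto simp: supp_def)
    ultimately show "(\<Sum>n\<in>{s..<s + X}. G T1 n * G T2 n) \<le> (if T1 = T2 then real X * (\<Prod>p\<in>T1. h p) else 0) + real D * real D"
      by simp
  qed
  also have "\<dots> = real X * L D + real (card (supp D)) * (real (card (supp D)) * (real D * real D))"
    using finite_supp by (simp add: sum.distrib L_def sum_distrib_left)
  also have "\<dots> \<le> real X * L D + real D * (real D * (real D * real D))"
    using card_supp[of D] by (intro add_left_mono mult_mono) auto
  finally have "real (card Z) * (L D)\<^sup>2 \<le> real X * L D + real D ^ 4" by (simp add: power4_eq_xxxx mult_ac)
  also have "real D ^ 4 \<le> real D ^ 4 * (L D)\<^sup>2" using L1 by (simp add: mult_le_cancel_left1)
  finally have "real (card Z) * (L D)\<^sup>2 \<le> (real X / L D + real D ^ 4) * (L D)\<^sup>2"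
    using L1 by (simp add: algebra_simps power2_eq_square)
  then show ?thesis using L1 by (simp add: Z_def mult_le_cancel_right)
qed

end

section \<open>Lower bounds for the sieve denominator\<close>

definition smooth_sum :: "nat set \<Rightarrow> real \<Rightarrow> real" where
  "smooth_sum S x = (\<Sum>n\<in>{n\<in>ints x. prime_factors n \<subseteq> S}. 1 / real n)"

text \<open>For a set S of primes this is the sum of 1 / phi(n), phi being Euler's function, over
  squarefree n \<le> x composed of primes of S; the factor 1 / (p - 1) is h p when a single class is
  forbidden.\<close>

definition sqfree_sum :: "nat set \<Rightarrow> real \<Rightarrow> real" where
  "sqfree_sum S x = (\<Sum>T\<in>{T\<in>Pow S. real (\<Prod>T) \<le> x}. \<Prod>p\<in>T. 1 / (real p - 1))"

lemma smooth_sum_nonneg: "smooth_sum S x \<ge> 0"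
  unfolding smooth_sum_def by (intro sum_nonneg) auto

lemma smooth_sum_mono: "x \<le> y \<Longrightarrow> smooth_sum S x \<le> smooth_sum S y"
  unfolding smooth_sum_def using ints_mono[of x y] by (intro sum_mono2) auto

lemma smooth_sum_insert:
  assumes q: "prime q" "q \<notin> S"
  shows "smooth_sum (insert q S) x = smooth_sum S x + smooth_sum (insert q S) (x / real q) / real q"
proof -
  have q0: "q > 0" using q prime_gt_0_nat by blast
  let ?A = "{n\<in>ints x. prime_factors n \<subseteq> insert q S}"
  let ?S = "{n\<in>ints x. prime_factors n \<subseteq> S}"
  let ?B = "{n\<in>ints (x / real q). prime_factors n \<subseteq> insert q S}"
  have pf: "prime_factors (q * m) = insert q (prime_factors m)" if "m > 0" for m
    using q q0 that by (simp add: prime_factors_product prime_prime_factors)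
  have A: "?A = ?S \<union> (\<lambda>m. q * m) ` ?B"
  proof (intro equalityI subsetI)
    fix n assume n: "n \<in> ?A"
    show "n \<in> ?S \<union> (\<lambda>m. q * m) ` ?B"
    proof (cases "q dvd n")
      case True
      then obtain m where m: "n = q * m" by blast
      then have "m > 0" using n by (auto simp: ints_def intro!: Nat.gr0I)
      then have "m \<in> ?B" using n m q0 pf[of m] by (auto simp: ints_mult_iff) (auto simp: ints_def)
      then show ?thesis using m by blast
    next
      case False
      then show ?thesis using n by (auto simp: prime_factors_dvd)
    qed
  next
    fix n assume "n \<in> ?S \<union> (\<lambda>m. q * m) ` ?B"
    then show "n \<in> ?A"
    proof
      assume "n \<in> (\<lambda>m. q * m) ` ?B"
      then obtain m where m: "n = q * m" "m \<in> ?B" by blast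
      then have "m > 0" by (simp add: ints_def)
      then show ?thesis using m pf[of m] q0 by (auto simp: ints_mult_iff) (auto simp: ints_def)
    qed auto
  qed
  have disj: "?S \<inter> (\<lambda>m. q * m) ` ?B = {}"
  proof -
    have "q \<in> prime_factors (q * m)" if "m \<in> ?B" for m using that pf[of m] by (simp add: ints_def)
    then show ?thesis using q(2) by blast
  qed
  have "smooth_sum (insert q S) x = smooth_sum S x + (\<Sum>n\<in>(\<lambda>m. q * m) ` ?B. 1 / real n)"
    unfolding smooth_sum_def A by (rule sum.union_disjoint) (use disj in auto)
  also have "(\<Sum>n\<in>(\<lambda>m. q * m) ` ?B. 1 / real n) = (\<Sum>m\<in>?B. 1 / real m / real q)"
    using q0 by (subst sum.reindex) (auto intro!: inj_onI sum.cong simp: mult.commute)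
  finally show ?thesis by (simp add: smooth_sum_def sum_divide_distrib)
qed

text \<open>The recursion on multiples of q bounds the sum by itself divided by q plus the old sum;
  solving for it gives one Euler factor.\<close>

lemma smooth_sum_insert_le:
  assumes q: "prime q" "q \<notin> S"
  shows "smooth_sum (insert q S) x \<le> real q / (real q - 1) * smooth_sum S x"
proof (cases "x \<ge> 0")
  case True
  have q2: "q \<ge> 2" using q prime_ge_2_nat by blast
  have "smooth_sum (insert q S) (x / real q) \<le> smooth_sum (insert q S) x"
    using q2 True mult_left_mono[of 1 "real q" x] by (intro smooth_sum_mono) (auto simp: field_simps)
  then have "smooth_sum (insert q S) x \<le> smooth_sum S x + smooth_sum (insert q S) x / real q"
    using smooth_sum_insert[OF q, of x] q2 by (simp add: divide_right_mono)
  then show ?thesis using q2 by (simp add: field_simps)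
next
  case False then show ?thesis by (simp add: smooth_sum_def ints_empty)
qed

lemma sqfree_sum_insert:
  assumes "q \<notin> S" "finite S" "q > 0"
  shows "sqfree_sum (insert q S) x = sqfree_sum S x + sqfree_sum S (x / real q) / (real q - 1)"
proof -
  let ?A = "\<lambda>S x. {T\<in>Pow S. real (\<Prod>T) \<le> x}"
  have fT: "finite T" "q \<notin> T" if "T \<subseteq> S" for T using that assms finite_subset by auto
  have A: "?A (insert q S) x = ?A S x \<union> insert q ` ?A S (x / real q)"
  proof (intro equalityI subsetI)
    fix T assume T: "T \<in> ?A (insert q S) x"
    show "T \<in> ?A S x \<union> insert q ` ?A S (x / real q)"
    proof (cases "q \<in> T")
      case True
      define U where "U = T - {q}"
      have U: "T = insert q U" "U \<subseteq> S" using True T by (auto simp: U_def)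
      then have "real q * real (\<Prod>U) \<le> x" using T fT[OF U(2)] by simp
      then have "U \<in> ?A S (x / real q)" using U assms by (simp add: field_simps)
      then show ?thesis using U by blast
    qed (use T in auto)
  next
    fix T assume "T \<in> ?A S x \<union> insert q ` ?A S (x / real q)"
    then show "T \<in> ?A (insert q S) x"
    proof
      assume "T \<in> insert q ` ?A S (x / real q)"
      then obtain U where "T = insert q U" "U \<subseteq> S" "real (\<Prod>U) \<le> x / real q" by auto
      then show ?thesis using fT[of U] assms by (auto simp: field_simps)
    qed auto
  qed
  have "sqfree_sum (insert q S) x = sqfree_sum S x + (\<Sum>T\<in>insert q ` ?A S (x / real q). \<Prod>p\<in>T. 1 / (real p - 1))"
    unfolding sqfree_sum_def A using assms by (intro sum.union_disjoint) auto
  also have "(\<Sum>T\<in>insert q ` ?A S (x / real q). \<Prod>p\<in>T. 1 / (real p - 1))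
      = (\<Sum>T\<in>?A S (x / real q). \<Prod>p\<in>insert q T. 1 / (real p - 1))"
    using assms by (intro sum.reindex_cong[OF _ refl refl]) (auto intro!: inj_onI)
  also have "\<dots> = (\<Sum>T\<in>?A S (x / real q). (\<Prod>p\<in>T. 1 / (real p - 1)) / (real q - 1))"
    using fT by (intro sum.cong) auto
  finally show ?thesis by (simp add: sqfree_sum_def sum_divide_distrib)
qed

lemma smooth_sum_empty: "x \<ge> 1 \<Longrightarrow> smooth_sum {} x = 1" "smooth_sum {} x \<le> sqfree_sum {} x"
proof -
  have e: "{n\<in>ints x. prime_factors n \<subseteq> {}} = (if x \<ge> 1 then {1} else {})"
    by (auto simp: ints_def prime_factorization_empty_iff)
  show "x \<ge> 1 \<Longrightarrow> smooth_sum {} x = 1" unfolding smooth_sum_def e by simp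
  have "{T\<in>Pow {}. real (\<Prod>T) \<le> x} = (if x \<ge> 1 then {{}} else {})" by auto
  then show "smooth_sum {} x \<le> sqfree_sum {} x" unfolding smooth_sum_def e sqfree_sum_def by simp
qed

text \<open>Adding one prime q at a time, the Euler factor q / (q - 1) times the weight 1 / q of the
  multiples of q is exactly the weight 1 / (q - 1) in the squarefree recursion.\<close>

lemma smooth_sum_le_sqfree_sum:
  assumes "finite S" "\<And>p. p \<in> S \<Longrightarrow> prime p"
  shows "smooth_sum S x \<le> sqfree_sum S x"
  using assms
proof (induction S arbitrary: x rule: finite_induct)
  case empty show ?case by (rule smooth_sum_empty(2))
next
  case (insert q S)
  have q: "prime q" "q \<notin> S" "q \<ge> 2" using insert prime_ge_2_nat by auto
  have "smooth_sum (insert q S) (x / real q) / real q \<le> real q / (real q - 1) * smooth_sum S (x / real q) / real q"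
    by (intro divide_right_mono smooth_sum_insert_le q) auto
  also have "\<dots> = smooth_sum S (x / real q) / (real q - 1)" using q by simp
  also have "\<dots> \<le> sqfree_sum S (x / real q) / (real q - 1)"
    using insert q by (intro divide_right_mono insert.IH) auto
  finally have "smooth_sum (insert q S) (x / real q) / real q \<le> sqfree_sum S (x / real q) / (real q - 1)" .
  moreover have "smooth_sum S x \<le> sqfree_sum S x" using insert by auto
  ultimately show ?case
    using smooth_sum_insert[OF q(1,2), of x] sqfree_sum_insert[OF q(2) insert(1), of x] q by linarith
qed

lemma smooth_sum_Un_le:
  assumes "finite B" "\<And>p. p \<in> B \<Longrightarrow> prime p" "B \<inter> S = {}"
  shows "smooth_sum (B \<union> S) x \<le> (\<Prod>q\<in>B. real q / (real q - 1)) * smooth_sum S x"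
  using assms
proof (induction B rule: finite_induct)
  case (insert q B)
  have q: "prime q" "q \<notin> B \<union> S" "q \<ge> 2" using insert prime_ge_2_nat by auto
  have "smooth_sum (insert q B \<union> S) x \<le> real q / (real q - 1) * smooth_sum (B \<union> S) x"
    using smooth_sum_insert_le[OF q(1,2)] by simp
  also have "\<dots> \<le> real q / (real q - 1) * ((\<Prod>q\<in>B. real q / (real q - 1)) * smooth_sum S x)"
    using insert q by (intro mult_left_mono insert.IH) auto
  finally show ?case using insert by (simp add: mult.assoc)
qed simp

lemma ln_le_harmonic: "x \<ge> 1 \<Longrightarrow> ln x \<le> (\<Sum>n\<in>ints x. 1 / real n)"
proof -
  assume x: "x \<ge> 1"
  have ind: "ln (real (Suc n)) \<le> (\<Sum>k=1..n. 1 / real k)" for n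
  proof (induction n)
    case (Suc n)
    have "real (Suc (Suc n)) = real (Suc n) * (1 + 1 / real (Suc n))" by (simp add: field_simps)
    moreover have "ln (real (Suc n) * (1 + 1 / real (Suc n))) = ln (real (Suc n)) + ln (1 + 1 / real (Suc n))"
      by (rule ln_mult_pos) (auto intro!: add_pos_nonneg)
    moreover have "ln (1 + 1 / real (Suc n)) \<le> 1 / real (Suc n)" by (intro ln_add_one_self_le_self) auto
    moreover have "(\<Sum>k=1..Suc n. 1 / real k) = (\<Sum>k=1..n. 1 / real k) + 1 / real (Suc n)" by simp
    ultimately show ?case using Suc by simp
  qed simp
  have "x < real (Suc (nat \<lfloor>x\<rfloor>))" by linarith
  then have "ln x \<le> ln (real (Suc (nat \<lfloor>x\<rfloor>)))" using x by (subst ln_le_cancel_iff) linarith+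
  also have "\<dots> \<le> (\<Sum>n\<in>ints x. 1 / real n)" unfolding ints_eq by (rule ind)
  finally show ?thesis .
qed

lemma ln_le_smooth_sum:
  assumes "x \<ge> 1" "\<And>p. prime p \<Longrightarrow> real p \<le> x \<Longrightarrow> p \<in> S"
  shows "ln x \<le> smooth_sum S x"
proof -
  have "{n\<in>ints x. prime_factors n \<subseteq> S} = ints x"
  proof -
    have "p \<in> S" if "n \<in> ints x" "p \<in> prime_factors n" for n p
    proof -
      have "p \<le> n" "prime p" "real n \<le> x" using that by (auto simp: ints_def prime_factors_dvd dvd_imp_le)
      then show ?thesis using assms(2)[of p] by simp
    qed
    then show ?thesis by blast
  qed
  then show ?thesis using ln_le_harmonic[OF assms(1)] by (simp add: smooth_sum_def)
qed

text \<open>Divergence of the sum of reciprocals of the primes, in Euler product form. The harmonic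
  sum, at least ln z, is bounded by the product over all primes up to z. Those up to y contribute
  the fixed factor c, so ln z \<ge> K c suffices.\<close>

lemma prime_block_exists:
  fixes y :: nat and K :: real
  obtains B where "finite B" "\<And>q. q \<in> B \<Longrightarrow> prime q \<and> q > y" "(\<Prod>q\<in>B. real q / (real q - 1)) \<ge> K"
proof -
  define Y where "Y = {p. prime p \<and> p \<le> y}"
  have fY: "finite Y" by (simp add: Y_def)
  define c where "c = (\<Prod>q\<in>Y. real q / (real q - 1))"
  have c: "c > 0" unfolding c_def
    by (intro prod_pos) (auto simp: Y_def intro!: divide_pos_pos dest: prime_gt_1_nat prime_gt_0_nat)
  define z where "z = max (real y + 1) (exp (K * c))"
  define B where "B = {p. prime p \<and> p > y \<and> real p \<le> z}"
  have fB: "finite B" by (rule finite_subset[OF _ finite_ints[of z]]) (auto simp: B_def ints_def prime_gt_0_nat)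
  have z: "z \<ge> 1" "z \<ge> exp (K * c)" by (auto simp: z_def)
  have "K * c \<le> ln z" using z by (subst ln_ge_iff) auto
  also have "\<dots> \<le> smooth_sum ((B \<union> Y) \<union> {}) z" using z by (intro ln_le_smooth_sum) (auto simp: B_def Y_def)
  also have "\<dots> \<le> (\<Prod>q\<in>B \<union> Y. real q / (real q - 1)) * smooth_sum {} z"
    using fB fY by (intro smooth_sum_Un_le) (auto simp: B_def Y_def)
  also have "\<dots> = (\<Prod>q\<in>B. real q / (real q - 1)) * c"
    using fB fY z by (subst prod.union_disjoint) (auto simp: B_def Y_def c_def smooth_sum_empty)
  finally have "K \<le> (\<Prod>q\<in>B. real q / (real q - 1))" using c by simp
  moreover have "\<And>q. q \<in> B \<Longrightarrow> prime q \<and> q > y" by (simp add: B_def)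
  ultimately show ?thesis using that fB by blast
qed

context sieve begin

text \<open>Every union of an arbitrary subset of B and a set T outside B with product at most D /
  \<Prod>B stays within the support. The two parts can therefore be chosen independently, and all
  subsets of B together give the product of 1 + h q.\<close>

lemma L_lower:
  assumes B: "B \<subseteq> P" and one: "\<And>p. p \<in> P - B \<Longrightarrow> card (Om p) = 1"
  shows "L D \<ge> (\<Prod>q\<in>B. 1 + h q) * sqfree_sum (P - B) (real D / real (\<Prod>B))"
proof -
  define R where "R = {T\<in>Pow (P - B). real (\<Prod>T) \<le> real D / real (\<Prod>B)}"
  have fB: "finite B" using B fin finite_subset by blast
  have PB: "\<Prod>B > 0" using B p_pos by (intro prod_pos) auto
  have Rsub: "T \<subseteq> P - B" if "T \<in> R" for T using that unfolding R_def by blast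
  have RD: "\<Prod>B * \<Prod>T \<le> D" if "T \<in> R" for T
  proof -
    have "real (\<Prod>T) \<le> real D / real (\<Prod>B)" using that unfolding R_def by blast
    then have "real (\<Prod>B) * real (\<Prod>T) \<le> real D" using PB by (simp only: field_simps of_nat_0_less_iff)
    then show ?thesis by (simp only: of_nat_mult[symmetric] of_nat_le_iff)
  qed
  have f: "finite U" "finite T" "U \<inter> T = {}" if "U \<subseteq> B" "T \<in> R" for U T
    using that Rsub[of T] finite_subset[of T P] fin finite_subset[OF _ fB] by blast+
  have inj: "inj_on (\<lambda>(U,T). U \<union> T) (Pow B \<times> R)"
    by (rule inj_on_inverseI[where g = "\<lambda>V. (V \<inter> B, V - B)"]) (use Rsub in auto)
  have "(\<Prod>q\<in>B. 1 + h q) = (\<Sum>U\<in>Pow B. \<Prod>q\<in>U. h q)"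
    using prod_add[OF fB, of h "\<lambda>_. 1"] by (simp add: add.commute)
  moreover have "sqfree_sum (P - B) (real D / real (\<Prod>B)) = (\<Sum>T\<in>R. \<Prod>p\<in>T. h p)"
    unfolding sqfree_sum_def R_def[symmetric]
  proof (intro sum.cong prod.cong refl)
    fix T p assume "T \<in> R" "p \<in> T"
    then have "p \<in> P - B" using Rsub by blast
    then show "1 / (real p - 1) = h p" using one[of p] by (simp add: h_def)
  qed
  ultimately have "(\<Prod>q\<in>B. 1 + h q) * sqfree_sum (P - B) (real D / real (\<Prod>B))
      = (\<Sum>z\<in>Pow B \<times> R. (\<Prod>q\<in>fst z. h q) * (\<Prod>p\<in>snd z. h p))"
    by (simp only: sum_product sum.cartesian_product case_prod_unfold)
  also have "\<dots> = (\<Sum>z\<in>Pow B \<times> R. \<Prod>p\<in>fst z \<union> snd z. h p)"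
  proof (intro sum.cong refl prod.union_disjoint[symmetric])
    fix z assume "z \<in> Pow B \<times> R"
    then have "fst z \<subseteq> B" "snd z \<in> R" by auto
    then show "finite (fst z)" "finite (snd z)" "fst z \<inter> snd z = {}" by (rule f)+
  qed
  also have "\<dots> = (\<Sum>V\<in>(\<lambda>(U,T). U \<union> T) ` (Pow B \<times> R). \<Prod>p\<in>V. h p)"
    unfolding sum.reindex[OF inj] by (simp add: case_prod_unfold)
  also have "\<dots> \<le> L D" unfolding L_def
  proof (rule sum_mono2)
    show "finite (supp D)" by (rule finite_supp)
    show "(\<lambda>(U,T). U \<union> T) ` (Pow B \<times> R) \<subseteq> supp D"
    proof
      fix V assume "V \<in> (\<lambda>(U,T). U \<union> T) ` (Pow B \<times> R)"
      then obtain U T where V: "V = U \<union> T" and UT: "U \<subseteq> B" "T \<in> R" by auto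
      have "\<Prod>(U \<union> T) = \<Prod>U * \<Prod>T" using f[OF UT] by (rule prod.union_disjoint)
      also have "\<dots> \<le> \<Prod>B * \<Prod>T"
        using PB UT fB by (intro mult_le_mono1 dvd_imp_le prod_dvd_prod_subset) auto
      also have "\<dots> \<le> D" using RD[OF UT(2)] .
      finally show "V \<in> supp D" using UT B V Rsub by (auto simp: supp_def)
    qed
    show "0 \<le> (\<Prod>p\<in>V. h p)" if "V \<in> supp D - (\<lambda>(U,T). U \<union> T) ` (Pow B \<times> R)" for V
      using that h_bounds by (intro prod_nonneg) (auto simp: supp_def)
  qed
  finally show ?thesis .
qed

end

text \<open>For q in B the classes 0 and 1 are forbidden, so 1 + h q = q / (q - 2) is at least the
  square of q / (q - 1). One of the two factors K obtained pays for removing B from the smooth sum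
  that bounds ln x; the other is the gain. The condition q > 3 allows two forbidden classes modulo
  q.\<close>

lemma sieve_primes:
  fixes B :: "nat set" and D s X :: nat
  assumes fB: "finite B" and B: "\<And>q. q \<in> B \<Longrightarrow> prime q \<and> q > 3" and D: "D > \<Prod>B"
  shows "real (card {p\<in>{s..<s + X}. prime p \<and> (\<forall>q\<in>B. p mod q \<noteq> 1)})
     \<le> real X / ((\<Prod>q\<in>B. real q / (real q - 1)) * ln (real D / real (\<Prod>B))) + real D ^ 4 + real D + real (card B)"
proof -
  define P where "P = {p. prime p \<and> p \<le> D} \<union> B"
  define Om where "Om = (\<lambda>p::nat. if p \<in> B then {0,1} else {0::nat})"
  interpret sieve P Om
  proof
    show "finite P" using fB by (simp add: P_def)
    show "prime p" if "p \<in> P" for p using that B by (auto simp: P_def)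
    show "Om p \<subseteq> {..<p}" if "p \<in> P" for p
      using that B prime_gt_1_nat[of p] by (auto simp: P_def Om_def)
    show "2 * card (Om p) \<le> p" if "p \<in> P" for p
      using that B[of p] prime_ge_2_nat[of p] by (auto simp: P_def Om_def)
  qed
  define K where "K = (\<Prod>q\<in>B. real q / (real q - 1))"
  define x where "x = real D / real (\<Prod>B)"
  have PB: "\<Prod>B > 0" using B by (auto intro!: prod_pos simp: prime_gt_0_nat)
  have x1: "x > 1" using D PB unfolding x_def by (simp only: field_simps of_nat_less_iff)
  have xD: "x \<le> real D"
  proof -
    have "real D / real Q \<le> real D" if "Q > 0" for Q :: nat
      using that divide_left_mono[of 1 "real Q" "real D"] by simp
    then show ?thesis unfolding x_def using PB .
  qed
  have K0: "K > 0" unfolding K_def using B by (intro prod_pos) force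
  have Ll: "L D \<ge> K * ln x"
  proof -
    have BP: "B \<union> (P - B) = P" "B \<inter> (P - B) = {}" by (auto simp: P_def)
    have "ln x \<le> smooth_sum (B \<union> (P - B)) x"
      using x1 xD unfolding BP by (intro ln_le_smooth_sum) (auto simp: P_def)
    also have "\<dots> \<le> (\<Prod>q\<in>B. real q / (real q - 1)) * smooth_sum (P - B) x"
      using fB B by (intro smooth_sum_Un_le) auto
    also have "\<dots> \<le> K * sqfree_sum (P - B) x"
      unfolding K_def using K0 prime fin by (intro mult_left_mono smooth_sum_le_sqfree_sum) (auto simp: K_def)
    finally have "ln x / K \<le> sqfree_sum (P - B) x" using K0 by (simp add: field_simps)
    then have "K * K * (ln x / K) \<le> K * K * sqfree_sum (P - B) x" using K0 by (intro mult_left_mono) auto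
    also have "K * K \<le> (\<Prod>q\<in>B. 1 + h q)"
      unfolding K_def prod.distrib[symmetric]
    proof (intro prod_mono conjI)
      fix q assume q: "q \<in> B"
      then have q3: "real q > 3" using B by auto
      then show "0 \<le> real q / (real q - 1) * (real q / (real q - 1))" by simp
      have "card (Om q) = 2" using q by (simp add: Om_def)
      then have "1 + h q = real q / (real q - 2)" using q3 by (simp add: h_def field_simps)
      moreover have "real q / (real q - 1) * (real q / (real q - 1)) \<le> real q / (real q - 2)"
      proof -
        define t where "t = real q"
        have t: "t > 3" using q3 by (simp add: t_def)
        have "t * t * (t - 2) - t * ((t - 1) * (t - 1)) = - t" by (simp add: algebra_simps)
        then have "t * t / ((t - 1) * (t - 1)) \<le> t / (t - 2)"
          using t by (subst frac_le_eq) (auto intro!: divide_nonpos_pos)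
        then show ?thesis by (simp add: t_def)
      qed
      ultimately show "real q / (real q - 1) * (real q / (real q - 1)) \<le> 1 + h q" by simp
    qed
    then have "K * K * sqfree_sum (P - B) x \<le> (\<Prod>q\<in>B. 1 + h q) * sqfree_sum (P - B) x"
    proof (intro mult_right_mono)
      show "0 \<le> sqfree_sum (P - B) x"
        using smooth_sum_nonneg[of "P - B" x] smooth_sum_le_sqfree_sum[of "P - B" x] fin prime by force
    qed
    also have "\<dots> \<le> L D" unfolding x_def by (rule L_lower) (auto simp: P_def Om_def)
    finally show ?thesis using K0 by simp
  qed
  have Kx: "K * ln x > 0" using K0 x1 by simp
  have D1: "D \<ge> 1" using D by simp
  let ?A = "{p\<in>{s..<s + X}. prime p \<and> (\<forall>q\<in>B. p mod q \<noteq> 1)}"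
  let ?Z = "{n\<in>{s..<s + X}. \<forall>p\<in>P. n mod p \<notin> Om p}"
  \<comment> \<open>A prime of P is 0 modulo itself and would be sifted out; all such primes are at
    most D or belong to B and are counted trivially.\<close>
  have "?A \<subseteq> ?Z \<union> {1..D} \<union> B"
  proof
    fix p assume p: "p \<in> ?A"
    show "p \<in> ?Z \<union> {1..D} \<union> B"
    proof (cases "p \<le> D \<or> p \<in> B")
      case True then show ?thesis using p prime_gt_0_nat[of p] by auto
    next
      case False
      have "p mod r \<noteq> 0" if r: "r \<in> P" for r
      proof
        assume "p mod r = 0"
        then have "r dvd p" by auto
        moreover have "prime r" using prime r by blast
        ultimately have "r = p" using p by (auto simp: primes_dvd_imp_eq)
        then show False using r False by (auto simp: P_def)
      qed
      then have "p mod r \<notin> Om r" if "r \<in> P" for r using that p by (auto simp: Om_def)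
      then show ?thesis using p by auto
    qed
  qed
  then have "card ?A \<le> card (?Z \<union> {1..D} \<union> B)" using fB by (intro card_mono) auto
  also have "\<dots> \<le> card ?Z + D + card B"
    using card_Un_le[of "?Z \<union> {1..D}" B] card_Un_le[of ?Z "{1..D}"] by simp
  finally have "real (card ?A) \<le> real (card ?Z) + real D + real (card B)" by linarith
  also have "real (card ?Z) \<le> real X / L D + real D ^ 4" by (rule sieve_bound[OF D1])
  also have "real X / L D \<le> real X / (K * ln x)" using Ll Kx by (intro divide_left_mono) auto
  finally show ?thesis by (simp add: K_def x_def)
qed

section \<open>Primes avoiding a residue class modulo every prime of a block\<close>

definition primes_in :: "nat \<Rightarrow> nat \<Rightarrow> nat set" where
  "primes_in s N = {p. prime p \<and> s < p \<and> p \<le> N}"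

lemma finite_primes_in [simp]: "finite (primes_in s N)"
  by (rule finite_subset[of _ "{..N}"]) (auto simp: primes_in_def)

lemma card_prime_powers_le:
  assumes "N \<ge> 1"
  shows "real (card {n. n \<le> N \<and> primepow n \<and> \<not> prime n}) \<le> sqrt (real N) * log 2 (real N)"
proof -
  define a where "a = nat \<lfloor>sqrt (real N)\<rfloor>"
  define b where "b = nat \<lfloor>log 2 (real N)\<rfloor>"
  have "{n. n \<le> N \<and> primepow n \<and> \<not> prime n} \<subseteq> (\<lambda>(p,k). p ^ k) ` ({1..a} \<times> {1..b})"
  proof
    fix n assume "n \<in> {n. n \<le> N \<and> primepow n \<and> \<not> prime n}"
    then obtain p k where pk: "prime p" "k > 0" "n = p ^ k" "n \<le> N" "\<not> prime n" by (auto simp: primepow_def)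
    then have k2: "k \<ge> 2" by (cases "k = 1") auto
    have p2: "p \<ge> 2" using pk prime_ge_2_nat by blast
    have "p ^ 2 \<le> p ^ k" using k2 p2 by (intro power_increasing) auto
    then have "(real p)\<^sup>2 \<le> real N" using pk by (metis of_nat_le_iff of_nat_power order_trans)
    then have "real p \<le> sqrt (real N)" by (rule real_le_rsqrt)
    then have pa: "p \<le> a" unfolding a_def by linarith
    have "2 ^ k \<le> p ^ k" using p2 by (intro power_mono) auto
    then have "2 ^ k \<le> N" using pk by linarith
    then have "(2::real) ^ k \<le> real N" by (metis of_nat_le_iff of_nat_numeral of_nat_power)
    then have "real k \<le> log 2 (real N)" using assms by (simp add: le_log_iff powr_realpow)
    then have "k \<le> b" unfolding b_def by linarith
    then show "n \<in> (\<lambda>(p,k). p ^ k) ` ({1..a} \<times> {1..b})" using pk pa p2 by (intro image_eqI[of _ _ "(p, k)"]) auto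
  qed
  then have "card {n. n \<le> N \<and> primepow n \<and> \<not> prime n} \<le> card ((\<lambda>(p,k). p ^ k :: nat) ` ({1..a} \<times> {1..b}))"
    by (intro card_mono) auto
  also have "\<dots> \<le> card ({1..a} \<times> {1..b})" by (rule card_image_le) auto
  also have "\<dots> = a * b" by simp
  finally have "real (card {n. n \<le> N \<and> primepow n \<and> \<not> prime n}) \<le> real (a * b)" by (rule of_nat_mono)
  also have "\<dots> = real a * real b" by simp
  also have "\<dots> \<le> sqrt (real N) * log 2 (real N)"
  proof (intro mult_mono)
    show "real a \<le> sqrt (real N)" "real b \<le> log 2 (real N)"
      unfolding a_def b_def using assms by auto
  qed auto
  finally show ?thesis .
qed

lemma psi_diff_le_primes:
  assumes "s \<le> N" "N \<ge> 1"
  shows "psi (real N) - psi (real s) \<le> real (card (primes_in s N)) * ln (real N) + sqrt (real N) * log 2 (real N) * ln (real N)"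
proof -
  let ?PP = "{n. n \<le> N \<and> primepow n \<and> \<not> prime n}"
  have fPP: "finite ?PP" by (rule finite_subset[of _ "{..N}"]) auto
  have "psi (real N) - psi (real s) = (\<Sum>n\<in>{1..N} - {1..s}. mangoldt n)"
    using assms by (simp add: psi_diff ints_of_nat)
  also have "\<dots> \<le> (\<Sum>n\<in>primes_in s N \<union> ?PP. mangoldt n)"
  proof -
    have "(\<Sum>n\<in>{1..N} - {1..s}. mangoldt n) = (\<Sum>n\<in>({1..N} - {1..s}) \<inter> (primes_in s N \<union> ?PP). mangoldt n :: real)"
    proof (intro sum.mono_neutral_right ballI)
      fix n assume n: "n \<in> {1..N} - {1..s} - ({1..N} - {1..s}) \<inter> (primes_in s N \<union> ?PP)"
      then have "\<not> primepow n" by (auto simp: primes_in_def)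
      then show "mangoldt n = (0::real)" by (simp add: mangoldt_def)
    qed auto
    also have "\<dots> \<le> (\<Sum>n\<in>primes_in s N \<union> ?PP. mangoldt n)"
      using fPP by (intro sum_mono2) (auto simp: mangoldt_nonneg)
    finally show ?thesis .
  qed
  also have "\<dots> \<le> (\<Sum>n\<in>primes_in s N \<union> ?PP. ln (real N))"
  proof (rule sum_mono)
    fix n assume "n \<in> primes_in s N \<union> ?PP"
    then have "0 < n" "n \<le> N" by (auto simp: primes_in_def prime_gt_0_nat primepow_gt_0_nat)
    then show "mangoldt n \<le> ln (real N)" by (intro order_trans[OF mangoldt_le]) auto
  qed
  also have "\<dots> = real (card (primes_in s N \<union> ?PP)) * ln (real N)" by simp
  also have "\<dots> \<le> (real (card (primes_in s N)) + sqrt (real N) * log 2 (real N)) * ln (real N)"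
  proof (intro mult_right_mono)
    have "card (primes_in s N \<union> ?PP) \<le> card (primes_in s N) + card ?PP" by (rule card_Un_le)
    then show "real (card (primes_in s N \<union> ?PP)) \<le> real (card (primes_in s N)) + sqrt (real N) * log 2 (real N)"
      using card_prime_powers_le[OF assms(2)] by linarith
  qed (use assms in auto)
  finally show ?thesis by (simp add: algebra_simps)
qed

text \<open>Each prime up to N contributes at most ln N to \<open>psi\<close>, and proper prime
  powers are negligible. The error is allowed to be a proportion of N rather than of N - s, so short
  intervals impose nothing and the bound is uniform in s.\<close>

lemma primes_in_lower:
  fixes \<kappa> :: real
  assumes "\<kappa> > 0"
  shows "eventually (\<lambda>N::nat. \<forall>s\<le>N. (real N - real s) / ln (real N) - \<kappa> * (real N / ln (real N)) \<le> real (card (primes_in s N))) sequentially"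
proof -
  obtain M where M: "M \<ge> 0" "\<And>s. s \<ge> 0 \<Longrightarrow> \<bar>psi s - s\<bar> \<le> M + \<kappa> / 4 * s"
    using prime_number_theorem_psi[of "\<kappa> / 4"] assms by (metis divide_pos_pos zero_less_numeral)
  have "((\<lambda>x::real. (sqrt x * log 2 x * ln x) / x) \<longlongrightarrow> 0) at_top" by real_asymp
  then have "((\<lambda>N::nat. (sqrt (real N) * log 2 (real N) * ln (real N)) / real N) \<longlongrightarrow> 0) sequentially"
    by (rule filterlim_compose[OF _ filterlim_real_sequentially])
  then have "eventually (\<lambda>N::nat. (sqrt (real N) * log 2 (real N) * ln (real N)) / real N < \<kappa> / 4) sequentially"
    using assms by (intro order_tendstoD) auto
  moreover have "eventually (\<lambda>N::nat. real N \<ge> 8 * M / \<kappa>) sequentially"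
    using filterlim_real_sequentially by (simp add: filterlim_at_top)
  ultimately show ?thesis using eventually_ge_at_top[of 2]
  proof eventually_elim
    case (elim N)
    have lN: "ln (real N) > 0" using elim by simp
    have 1: "sqrt (real N) * log 2 (real N) * ln (real N) \<le> \<kappa> / 4 * real N" using elim by (simp add: field_simps)
    have 2: "2 * M \<le> \<kappa> / 4 * real N" using elim assms by (simp add: field_simps)
    show ?case
    proof (intro allI impI)
      fix s assume s: "s \<le> N"
      have "psi (real N) - psi (real s) \<ge> real N - real s - 2 * M - \<kappa> / 4 * real N - \<kappa> / 4 * real s"
        using M(2)[of "real N"] M(2)[of "real s"] by (simp add: abs_le_iff)
      moreover have "\<kappa> / 4 * real s \<le> \<kappa> / 4 * real N" using s assms by simp
      moreover have "psi (real N) - psi (real s) \<le> real (card (primes_in s N)) * ln (real N) + sqrt (real N) * log 2 (real N) * ln (real N)"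
        using psi_diff_le_primes[OF s] elim by simp
      ultimately have "real N - real s - \<kappa> * real N \<le> real (card (primes_in s N)) * ln (real N)"
        using 1 2 by linarith
      then have "(real N - real s - \<kappa> * real N) / ln (real N) \<le> real (card (primes_in s N))"
        using lN by (simp add: field_simps)
      then show "(real N - real s) / ln (real N) - \<kappa> * (real N / ln (real N)) \<le> real (card (primes_in s N))"
        by (simp add: diff_divide_distrib)
    qed
  qed
qed

lemma prime_count_lower: "eventually (\<lambda>N::nat. real N / (2 * ln (real N)) \<le> real (card (primes_in 0 N))) sequentially"
proof -
  have "eventually (\<lambda>N::nat. \<forall>s\<le>N. (real N - real s) / ln (real N) - 1/2 * (real N / ln (real N)) \<le> real (card (primes_in s N))) sequentially"
    by (rule primes_in_lower) simp
  then show ?thesis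
  proof (rule eventually_mono)
    fix N :: nat assume "\<forall>s\<le>N. (real N - real s) / ln (real N) - 1/2 * (real N / ln (real N)) \<le> real (card (primes_in s N))"
    then have "(real N - real 0) / ln (real N) - 1/2 * (real N / ln (real N)) \<le> real (card (primes_in 0 N))" by blast
    then show "real N / (2 * ln (real N)) \<le> real (card (primes_in 0 N))" by (simp add: field_simps)
  qed
qed

definition avoiding :: "nat set \<Rightarrow> nat set" where
  "avoiding B = {p. \<forall>q\<in>B. p mod q \<noteq> 1}"

text \<open>With D about N^(1/8) the sieve error D^4 is at most N^(1/2). The block is fixed, so
  dividing D by its product leaves at least N^(1/10) for large N; hence the logarithm is at least
  (ln N) / 10, which is the origin of the 10 in 10 / \<delta>.\<close>

lemma avoiding_upper:
  fixes \<delta> \<kappa> :: real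
  assumes fB: "finite B" and B: "\<And>q. q \<in> B \<Longrightarrow> prime q \<and> q > 3" and \<delta>: "\<delta> > 0"
    and K: "(\<Prod>q\<in>B. real q / (real q - 1)) \<ge> 10 / \<delta>" and \<kappa>: "\<kappa> > 0"
  shows "eventually (\<lambda>N::nat. \<forall>s\<le>N. real (card (primes_in s N \<inter> avoiding B))
           \<le> \<delta> * ((real N - real s) / ln (real N)) + \<kappa> * (real N / ln (real N))) sequentially"
proof -
  define K where "K = (\<Prod>q\<in>B. real q / (real q - 1))"
  define Q where "Q = \<Prod>B"
  define D where "D = (\<lambda>N::nat. nat \<lfloor>real N powr (1/8)\<rfloor>)"
  have K10: "K \<ge> 10 / \<delta>" using K by (simp add: K_def)
  moreover have "10 / \<delta> > 0" using \<delta> by simp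
  ultimately have K0: "K > 0" by linarith
  have Q0: "Q > 0" unfolding Q_def using B by (auto intro!: prod_pos simp: prime_gt_0_nat)
  have "filterlim (\<lambda>x::real. (x powr (1/8) - 1) / x powr (1/10)) at_top at_top" by real_asymp
  then have "filterlim (\<lambda>N::nat. (real N powr (1/8) - 1) / real N powr (1/10)) at_top sequentially"
    by (rule filterlim_compose[OF _ filterlim_real_sequentially])
  then have e1: "eventually (\<lambda>N::nat. (real N powr (1/8) - 1) / real N powr (1/10) \<ge> real Q) sequentially"
    by (simp add: filterlim_at_top)
  have "((\<lambda>x::real. (x powr (1/2) + x powr (1/8)) * ln x / x) \<longlongrightarrow> 0) at_top" by real_asymp
  then have "((\<lambda>N::nat. (real N powr (1/2) + real N powr (1/8)) * ln (real N) / real N) \<longlongrightarrow> 0) sequentially"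
    by (rule filterlim_compose[OF _ filterlim_real_sequentially])
  then have e2: "eventually (\<lambda>N::nat. (real N powr (1/2) + real N powr (1/8)) * ln (real N) / real N < \<kappa> / 2) sequentially"
    using \<kappa> by (intro order_tendstoD) auto
  have "filterlim (\<lambda>x::real. x / ln x) at_top at_top" by real_asymp
  then have "filterlim (\<lambda>N::nat. real N / ln (real N)) at_top sequentially"
    by (rule filterlim_compose[OF _ filterlim_real_sequentially])
  then have e3: "eventually (\<lambda>N::nat. real N / ln (real N) \<ge> 2 * real (card B) / \<kappa>) sequentially"
    by (simp add: filterlim_at_top)
  show ?thesis using e1 e2 e3 eventually_ge_at_top[of 2]
  proof eventually_elim
    case (elim N)
    have lN: "ln (real N) > 0" using elim by simp
    have p10: "real N powr (1/10) > 1" using elim by (intro gr_one_powr) auto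
    have "real Q * real N powr (1/10) \<le> real N powr (1/8) - 1" using elim p10 by (simp add: field_simps)
    also have "\<dots> \<le> real (D N)" unfolding D_def by linarith
    finally have DQ: "real Q * real N powr (1/10) \<le> real (D N)" .
    have "real Q * 1 < real Q * real N powr (1/10)" using p10 Q0 by (intro mult_strict_left_mono) auto
    then have DgQ: "D N > Q" using DQ by simp
    have "real N powr (1/10) \<le> real (D N) / real Q" using DQ Q0 by (simp add: field_simps)
    then have "ln (real N powr (1/10)) \<le> ln (real (D N) / real Q)" using p10 DgQ Q0 \<open>2 \<le> N\<close> by (subst ln_le_cancel_iff) auto
    then have lnD: "ln (real N) / 10 \<le> ln (real (D N) / real Q)" using elim by (simp add: ln_powr)
    have Dle: "real (D N) \<le> real N powr (1/8)" unfolding D_def by simp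
    have "real (D N) ^ 4 \<le> (real N powr (1/8)) ^ 4" using Dle by (intro power_mono) auto
    also have "\<dots> = real N powr (1/2)" using elim by (simp add: powr_powr flip: powr_numeral)
    finally have D4: "real (D N) ^ 4 \<le> real N powr (1/2)" .
    have "real N powr (1/2) + real N powr (1/8) \<le> \<kappa> / 2 * (real N / ln (real N))"
      using elim lN by (simp add: field_simps)
    moreover have "real (card B) \<le> \<kappa> / 2 * (real N / ln (real N))" using elim \<kappa> by (simp add: field_simps)
    ultimately have err: "real (D N) ^ 4 + real (D N) + real (card B) \<le> \<kappa> * (real N / ln (real N))"
      using D4 Dle by linarith
    show ?case
    proof (intro allI impI)
      fix s assume s: "s \<le> N"
      have "primes_in s N \<inter> avoiding B = {p\<in>{Suc s..<Suc s + (N - s)}. prime p \<and> (\<forall>q\<in>B. p mod q \<noteq> 1)}"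
        using s by (auto simp: primes_in_def avoiding_def)
      then have "real (card (primes_in s N \<inter> avoiding B))
          \<le> real (N - s) / (K * ln (real (D N) / real Q)) + real (D N) ^ 4 + real (D N) + real (card B)"
        using sieve_primes[OF fB B, of "D N" "Suc s" "N - s"] DgQ unfolding K_def Q_def by simp
      also have "real (N - s) / (K * ln (real (D N) / real Q)) \<le> real (N - s) / (10 / \<delta> * (ln (real N) / 10))"
        using K10 lnD lN \<delta> K0 by (intro divide_left_mono mult_mono mult_pos_pos) auto
      also have "\<dots> = \<delta> * ((real N - real s) / ln (real N))" using s \<delta> lN by (simp add: of_nat_diff field_simps)
      finally show "real (card (primes_in s N \<inter> avoiding B)) \<le> \<delta> * ((real N - real s) / ln (real N)) + \<kappa> * (real N / ln (real N))"
        using err by linarith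
    qed
  qed
qed

text \<open>The prime number theorem makes the sieve bound comparable with the number of
  primes in every interval, up to a negligible error.\<close>

definition sparse_below :: "real \<Rightarrow> nat set \<Rightarrow> bool" where
  "sparse_below \<delta> A \<longleftrightarrow> (\<forall>\<kappa>>0. \<exists>N0. \<forall>N\<ge>N0. \<forall>s\<le>N.
     real (card (primes_in s N \<inter> A)) \<le> \<delta> * real (card (primes_in s N)) + \<kappa> * real (card (primes_in 0 N)))"

lemma sparse_block_exists:
  fixes \<delta> :: real and y :: nat
  assumes \<delta>: "\<delta> > 0"
  obtains B where "finite B" "\<And>q. q \<in> B \<Longrightarrow> prime q \<and> q > y" "sparse_below \<delta> (avoiding B)"
proof -
  obtain B where B: "finite B" "\<And>q. q \<in> B \<Longrightarrow> prime q \<and> q > max y 3" "(\<Prod>q\<in>B. real q / (real q - 1)) \<ge> 10 / \<delta>"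
    by (rule prime_block_exists) (rule that)
  have "sparse_below \<delta> (avoiding B)" unfolding sparse_below_def
  proof (intro allI impI)
    fix \<kappa> :: real assume \<kappa>: "\<kappa> > 0"
    \<comment> \<open>The small constant enters once through the sieve and once, multiplied by
      \<delta>, through the prime number theorem; the further factor 2 comes from
      \<open>prime_count_lower\<close>.\<close>
    define \<kappa>' where "\<kappa>' = \<kappa> / (2 * (\<delta> + 1))"
    have \<kappa>': "\<kappa>' > 0" "2 * (\<delta> + 1) * \<kappa>' = \<kappa>" using \<kappa> \<delta> by (auto simp: \<kappa>'_def)
    have B3: "prime q \<and> q > 3" if "q \<in> B" for q using B(2)[OF that] by auto
    have "eventually (\<lambda>N::nat. \<forall>s\<le>N. real (card (primes_in s N \<inter> avoiding B))
           \<le> \<delta> * ((real N - real s) / ln (real N)) + \<kappa>' * (real N / ln (real N))) sequentially"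
      using B(1) B3 \<delta> B(3) \<kappa>'(1) by (rule avoiding_upper)
    then have "eventually (\<lambda>N. \<forall>s\<le>N. real (card (primes_in s N \<inter> avoiding B))
       \<le> \<delta> * real (card (primes_in s N)) + \<kappa> * real (card (primes_in 0 N))) sequentially"
      using primes_in_lower[OF \<kappa>'(1)] prime_count_lower
    proof eventually_elim
      case (elim N)
      show ?case
      proof (intro allI impI)
        fix s assume s: "s \<le> N"
        define r where "r = real N / ln (real N)"
        have 1: "real (card (primes_in s N \<inter> avoiding B)) \<le> \<delta> * ((real N - real s) / ln (real N)) + \<kappa>' * r"
          using elim(1) s by (auto simp: r_def)
        have "(real N - real s) / ln (real N) \<le> real (card (primes_in s N)) + \<kappa>' * r"
          using elim(2) s by (auto simp: r_def algebra_simps)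
        then have "\<delta> * ((real N - real s) / ln (real N)) \<le> \<delta> * (real (card (primes_in s N)) + \<kappa>' * r)"
          using \<delta> by (intro mult_left_mono) auto
        moreover have "r \<le> 2 * real (card (primes_in 0 N))" using elim(3) by (simp add: r_def)
        then have "(\<delta> + 1) * \<kappa>' * r \<le> (\<delta> + 1) * \<kappa>' * (2 * real (card (primes_in 0 N)))"
          using \<delta> \<kappa>' by (intro mult_left_mono) auto
        moreover have "(\<delta> + 1) * \<kappa>' * (2 * real (card (primes_in 0 N))) = \<kappa> * real (card (primes_in 0 N))"
          unfolding \<kappa>'(2)[symmetric] by simp
        ultimately show "real (card (primes_in s N \<inter> avoiding B)) \<le> \<delta> * real (card (primes_in s N)) + \<kappa> * real (card (primes_in 0 N))"
          using 1 by (simp add: algebra_simps)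
      qed
    qed
    then show "\<exists>N0. \<forall>N\<ge>N0. \<forall>s\<le>N. real (card (primes_in s N \<inter> avoiding B))
       \<le> \<delta> * real (card (primes_in s N)) + \<kappa> * real (card (primes_in 0 N))"
      by (simp add: eventually_sequentially)
  qed
  moreover have "\<And>q. q \<in> B \<Longrightarrow> prime q \<and> q > y" using B(2) by auto
  ultimately show ?thesis using that B(1) by blast
qed

section \<open>Construction of the set\<close>

lemma sparse_below_empty: "sparse_below 0 {}"
  by (auto simp: sparse_below_def)

lemma sparse_below_mono:
  assumes "sparse_below d A" "d \<le> d'" "A' \<subseteq> A"
  shows "sparse_below d' A'"
  unfolding sparse_below_def
proof (intro allI impI)
  fix \<kappa> :: real assume "\<kappa> > 0"
  then obtain N0 where N0: "\<And>N s. N \<ge> N0 \<Longrightarrow> s \<le> N \<Longrightarrow>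
      real (card (primes_in s N \<inter> A)) \<le> d * real (card (primes_in s N)) + \<kappa> * real (card (primes_in 0 N))"
    using assms(1) unfolding sparse_below_def by blast
  show "\<exists>N0. \<forall>N\<ge>N0. \<forall>s\<le>N. real (card (primes_in s N \<inter> A')) \<le> d' * real (card (primes_in s N)) + \<kappa> * real (card (primes_in 0 N))"
  proof (intro exI allI impI)
    fix N s assume "N0 \<le> N" "s \<le> N"
    have "real (card (primes_in s N \<inter> A')) \<le> real (card (primes_in s N \<inter> A))"
      using assms(3) by (intro of_nat_mono card_mono) auto
    moreover have "d * real (card (primes_in s N)) \<le> d' * real (card (primes_in s N))"
      using assms(2) by (intro mult_right_mono) auto
    ultimately show "real (card (primes_in s N \<inter> A')) \<le> d' * real (card (primes_in s N)) + \<kappa> * real (card (primes_in 0 N))"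
      using N0[OF \<open>N0 \<le> N\<close> \<open>s \<le> N\<close>] by linarith
  qed
qed

lemma sparse_below_Un:
  assumes "sparse_below d A" "sparse_below e B"
  shows "sparse_below (d + e) (A \<union> B)"
  unfolding sparse_below_def
proof (intro allI impI)
  fix \<kappa> :: real assume "\<kappa> > 0"
  then have k: "\<kappa> / 2 > 0" by simp
  obtain N1 where N1: "\<And>N s. N \<ge> N1 \<Longrightarrow> s \<le> N \<Longrightarrow>
      real (card (primes_in s N \<inter> A)) \<le> d * real (card (primes_in s N)) + \<kappa> / 2 * real (card (primes_in 0 N))"
    using assms(1) k unfolding sparse_below_def by blast
  obtain N2 where N2: "\<And>N s. N \<ge> N2 \<Longrightarrow> s \<le> N \<Longrightarrow>
      real (card (primes_in s N \<inter> B)) \<le> e * real (card (primes_in s N)) + \<kappa> / 2 * real (card (primes_in 0 N))"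
    using assms(2) k unfolding sparse_below_def by blast
  show "\<exists>N0. \<forall>N\<ge>N0. \<forall>s\<le>N. real (card (primes_in s N \<inter> (A \<union> B))) \<le> (d + e) * real (card (primes_in s N)) + \<kappa> * real (card (primes_in 0 N))"
  proof (intro exI allI impI)
    fix N s assume N: "max N1 N2 \<le> N" "s \<le> N"
    have "card (primes_in s N \<inter> (A \<union> B)) \<le> card (primes_in s N \<inter> A) + card (primes_in s N \<inter> B)"
      unfolding Int_Un_distrib by (rule card_Un_le)
    then have "real (card (primes_in s N \<inter> (A \<union> B))) \<le> real (card (primes_in s N \<inter> A)) + real (card (primes_in s N \<inter> B))"
      by linarith
    then show "real (card (primes_in s N \<inter> (A \<union> B))) \<le> (d + e) * real (card (primes_in s N)) + \<kappa> * real (card (primes_in 0 N))"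
      using N1[of N s] N2[of N s] N by (simp add: ring_distribs)
  qed
qed

lemma sparse_below_UN:
  fixes k :: nat
  assumes "\<And>i. i < k \<Longrightarrow> sparse_below (d i) (A i)"
  shows "sparse_below (\<Sum>i<k. d i) (\<Union>i<k. A i)"
  using assms
proof (induction k)
  case 0 then show ?case by (simp add: sparse_below_empty)
next
  case (Suc k)
  have "sparse_below ((\<Sum>i<k. d i) + d k) ((\<Union>i<k. A i) \<union> A k)" using Suc by (intro sparse_below_Un) auto
  then show ?case by (simp add: lessThan_Suc Un_commute add.commute)
qed

text \<open>A sparse block exists beyond any bound, so each new block can be placed above all primes
  used before.\<close>

lemma disjoint_sparse_blocks:
  fixes \<delta> :: real and k :: nat
  assumes "\<delta> > 0"
  shows "\<exists>B. (\<forall>i<k. finite (B i) \<and> (\<forall>q\<in>B i. prime q) \<and> sparse_below \<delta> (avoiding (B i)))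
           \<and> (\<forall>i<k. \<forall>j<k. i \<noteq> j \<longrightarrow> B i \<inter> B j = {})"
proof (induction k)
  case (Suc k)
  then obtain B where B0: "\<forall>i<k. finite (B i) \<and> (\<forall>q\<in>B i. prime q) \<and> sparse_below \<delta> (avoiding (B i))"
    "\<forall>i<k. \<forall>j<k. i \<noteq> j \<longrightarrow> B i \<inter> B j = {}" by (elim exE conjE)
  have B: "finite (B i) \<and> (\<forall>q\<in>B i. prime q) \<and> sparse_below \<delta> (avoiding (B i))" if "i < k" for i
    using B0(1) that by simp
  have B': "B i \<inter> B j = {}" if "i < k" "j < k" "i \<noteq> j" for i j using B0(2) that by simp
  have "finite (\<Union>i<k. B i)" using B by auto
  then obtain y where y: "\<And>q. q \<in> (\<Union>i<k. B i) \<Longrightarrow> q \<le> y" using finite_nat_set_iff_bounded_le by meson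
  obtain C where C: "finite C" "\<And>q. q \<in> C \<Longrightarrow> prime q \<and> q > y" "sparse_below \<delta> (avoiding C)"
    by (rule sparse_block_exists[OF assms, of y]) (rule that)
  have disj: "B i \<inter> C = {}" if "i < k" for i
  proof -
    have False if "q \<in> B i" "q \<in> C" for q
      using y[of q] C(2)[of q] that \<open>i < k\<close> by force
    then show ?thesis by blast
  qed
  show ?case
  proof (intro exI[of _ "B(k := C)"] conjI allI impI)
    fix i assume "i < Suc k"
    then show "finite ((B(k := C)) i)" "\<forall>q\<in>(B(k := C)) i. prime q" "sparse_below \<delta> (avoiding ((B(k := C)) i))"
      using B[of i] C by (auto simp: less_Suc_eq)
  next
    fix i j assume "i < Suc k" "j < Suc k" "i \<noteq> j"
    then show "(B(k := C)) i \<inter> (B(k := C)) j = {}"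
      using B'[of i j] disj[of i] disj[of j] by (auto simp: less_Suc_eq)
  qed
qed simp

text \<open>A large prime \<open>a\<close> outside \<open>X\<close> is 1 modulo some \<open>q\<close> in each of \<open>k\<close> blocks, and \<open>n\<close> is chosen so
  that this \<open>q\<close> divides \<open>n + i + a\<close>; the finitely many small \<open>a\<close> are handled by one auxiliary prime for
  each value of \<open>i + a\<close>.\<close>

lemma level_exists:
  fixes \<eta> :: real and k :: nat
  assumes \<eta>: "\<eta> > 0"
  shows "\<exists>X. sparse_below \<eta> X \<and> (\<forall>N. real (card (primes_in 0 N \<inter> X)) \<le> 2 * \<eta> * real (card (primes_in 0 N)))
     \<and> (\<forall>x\<in>X. k < x)
     \<and> (\<exists>n0 W. W > 0 \<and> (\<forall>n i a. n mod W = n0 mod W \<longrightarrow> W < n \<longrightarrow> i < k \<longrightarrow> prime a \<longrightarrow> a \<notin> X \<longrightarrow> \<not> prime (n + i + a)))"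
proof -
  have "\<eta> / (real k + 1) > 0" using \<eta> by (simp add: add_nonneg_pos)
  from disjoint_sparse_blocks[OF this, of k] obtain B where
    B0: "\<forall>i<k. finite (B i) \<and> (\<forall>q\<in>B i. prime q) \<and> sparse_below (\<eta> / (real k + 1)) (avoiding (B i))"
    "\<forall>i<k. \<forall>j<k. i \<noteq> j \<longrightarrow> B i \<inter> B j = {}" by (elim exE conjE)
  have B: "finite (B i) \<and> (\<forall>q\<in>B i. prime q) \<and> sparse_below (\<eta> / (real k + 1)) (avoiding (B i))" if "i < k" for i
    using B0(1) that by simp
  have B': "B i \<inter> B j = {}" if "i < k" "j < k" "i \<noteq> j" for i j using B0(2) that by simp
  define Y where "Y = (\<Union>i<k. avoiding (B i))"
  have "sparse_below (\<Sum>i<k. \<eta> / (real k + 1)) Y" unfolding Y_def using B by (intro sparse_below_UN) auto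
  moreover have "(\<Sum>i<k. \<eta> / (real k + 1)) \<le> \<eta>" using \<eta> by (simp add: field_simps)
  ultimately have Y: "sparse_below \<eta> Y" by (rule sparse_below_mono) auto
  then obtain N0 where N0: "\<And>N s. N \<ge> N0 \<Longrightarrow> s \<le> N \<Longrightarrow>
      real (card (primes_in s N \<inter> Y)) \<le> \<eta> * real (card (primes_in s N)) + \<eta> * real (card (primes_in 0 N))"
    using \<eta> unfolding sparse_below_def by blast
  \<comment> \<open>Dropping the elements up to N0 makes the bound with 2 \<eta> valid for every N,
    not only for large ones. Dropping those up to k ensures that below N only the levels k < N are
    visible, which keeps the later union over all levels finite on each interval.\<close>
  define M where "M = max N0 k"
  define X where "X = Y \<inter> {M<..}"
  have X1: "sparse_below \<eta> X" using Y by (rule sparse_below_mono) (auto simp: X_def)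
  have X2: "real (card (primes_in 0 N \<inter> X)) \<le> 2 * \<eta> * real (card (primes_in 0 N))" for N
  proof (cases "N \<ge> N0")
    case True
    have "real (card (primes_in 0 N \<inter> X)) \<le> real (card (primes_in 0 N \<inter> Y))"
      by (intro of_nat_mono card_mono) (auto simp: X_def)
    then show ?thesis using N0[OF True, of 0] by simp
  next
    case False
    then have "primes_in 0 N \<inter> X = {}" by (auto simp: primes_in_def X_def M_def)
    then show ?thesis using \<eta> by simp
  qed
  have X3: "\<forall>x\<in>X. k < x" by (auto simp: X_def M_def)

  define SB where "SB = (\<Union>i<k. B i)"
  have fSB: "finite SB" using B by (auto simp: SB_def)
  then obtain y where y: "\<And>q. q \<in> SB \<Longrightarrow> q \<le> y" using finite_nat_set_iff_bounded_le by meson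
  define J where "J = M + k"
  define R where "R = {p::nat. prime p \<and> y < p}"
  have "infinite R"
  proof -
    have "R = {p. prime p} - {..y}" by (auto simp: R_def)
    then show ?thesis using primes_infinite by simp
  qed
  define r where "r = enumerate R"
  have r: "r j \<in> R" "inj r" for j
    unfolding r_def using enumerate_in_set[OF \<open>infinite R\<close>] strict_mono_enumerate[OF \<open>infinite R\<close>]
    by (auto intro: strict_mono_imp_inj_on)
  define S where "S = SB \<union> r ` {1..J}"
  have fS: "finite S" using fSB by (simp add: S_def)
  have Sp: "prime q" if "q \<in> S" for q using that B r by (auto simp: S_def SB_def R_def)
  have rSB: "r j \<notin> SB" for j using y[of "r j"] r(1)[of j] by (auto simp: R_def)
  \<comment> \<open>Each modulus q is assigned a single offset c, with n to be congruent to -c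
    modulo q. The assignment is consistent because the blocks are disjoint, r is injective, and its
    values avoid all blocks.\<close>
  have "\<exists>c. (\<forall>i<k. q \<in> B i \<longrightarrow> c = i + 1) \<and> (\<forall>j\<in>{1..J}. q = r j \<longrightarrow> c = j)" for q
  proof (cases "q \<in> SB")
    case True
    then obtain i where i: "i < k" "q \<in> B i" by (auto simp: SB_def)
    have "i' = i" if "i' < k" "q \<in> B i'" for i' using B'[of i i'] i that by blast
    then show ?thesis using rSB True by (intro exI[of _ "i + 1"]) auto
  next
    case False
    then show ?thesis
    proof (cases "q \<in> range r")
      case True
      then obtain j where "q = r j" by blast
      then show ?thesis using r(2) False by (intro exI[of _ j]) (auto simp: SB_def dest: injD)
    qed (auto simp: SB_def)
  qed
  then obtain c where c: "\<And>q i. i < k \<Longrightarrow> q \<in> B i \<Longrightarrow> c q = i + 1" "\<And>j. j \<in> {1..J} \<Longrightarrow> c (r j) = j" by metis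
  \<comment> \<open>Over the natural numbers \<open>c q * (q - 1)\<close> represents -c modulo
    q.\<close>
  obtain n0 where n0: "\<And>q. q \<in> S \<Longrightarrow> [n0 = c q * (q - 1)] (mod q)"
    using chinese_remainder_nat[OF fS, of "\<lambda>q. q" "\<lambda>q. c q * (q - 1)"] Sp primes_coprime by blast
  define W where "W = \<Prod>S"
  have W0: "W > 0" unfolding W_def using Sp by (auto intro!: prod_pos simp: prime_gt_0_nat)
  have qW: "q dvd W" if "q \<in> S" for q unfolding W_def using fS that by (intro dvd_prodI[where f = "\<lambda>x. x", simplified]) auto
  have div: "q dvd n + c q" if "q \<in> S" "n mod W = n0 mod W" for q n
  proof -
    have "n mod q = n0 mod q" using qW[OF that(1)] that(2) by (metis mod_mod_cancel)
    then have "[n = c q * (q - 1)] (mod q)" using n0[OF that(1)] by (simp add: unique_euclidean_semiring_class.cong_def)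
    then have "[n + c q = c q * (q - 1) + c q] (mod q)" by (intro cong_add) auto
    moreover have "c q * (q - 1) + c q = c q * q" using Sp[OF that(1)] prime_gt_0_nat[of q]
      by (cases q) auto
    ultimately show ?thesis by (metis cong_dvd_iff dvd_triv_right)
  qed
  have comp: "\<not> prime (n + i + a)" if n: "n mod W = n0 mod W" "W < n" and i: "i < k" and a: "prime a" "a \<notin> X" for n i a
  proof -
    have "\<exists>q\<in>S. q dvd n + i + a"
    proof (cases "a > M")
      case True
      then have "a \<notin> avoiding (B i)" using a i by (auto simp: X_def Y_def)
      then obtain q where q: "q \<in> B i" "a mod q = 1" by (auto simp: avoiding_def)
      then have qS: "q \<in> S" using i by (auto simp: S_def SB_def)
      \<comment> \<open>The offset of block i is i + 1 because a is 1 modulo q: both n + (i + 1) and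
        a - 1 are divisible by q, and they sum to n + i + a.\<close>
      have "q dvd n + (i + 1)" using div[OF qS n(1)] c(1)[OF i q(1)] by simp
      moreover have "q dvd a - 1"
        using q(2) by (metis dvd_minus_mod)
      ultimately have "q dvd n + (i + 1) + (a - 1)" by (rule dvd_add)
      moreover have "n + (i + 1) + (a - 1) = n + i + a" using prime_gt_0_nat[OF a(1)] by simp
      ultimately show ?thesis using qS by auto
    next
      case False
      have j: "i + a \<in> {1..J}" using False i prime_gt_0_nat[OF a(1)] by (auto simp: J_def)
      then have "r (i + a) \<in> S" by (simp add: S_def)
      then have "r (i + a) dvd n + (i + a)" using div[OF _ n(1)] c(2)[OF j] by metis
      then show ?thesis using \<open>r (i + a) \<in> S\<close> by (auto simp: add.assoc)
    qed
    then obtain q where q: "q \<in> S" "q dvd n + i + a" by blast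
    \<comment> \<open>Requiring n to exceed W makes q a proper divisor, so n + i + a cannot be the
      prime q itself.\<close>
    have "q \<le> W" using qW[OF q(1)] W0 by (rule dvd_imp_le)
    then have "q \<noteq> n + i + a" using n(2) by simp
    then show ?thesis using q Sp[OF q(1)] primes_dvd_imp_eq by blast
  qed
  show ?thesis using X1 X2 X3 W0 comp by blast
qed

lemma geometric_tail:
  fixes \<epsilon> :: real
  assumes "\<epsilon> > 0"
  shows "(\<Sum>k\<in>{a..<b}. \<epsilon> / 2 ^ (k + 1)) \<le> \<epsilon> / 2 ^ a"
proof (cases "a \<le> b")
  case True
  have "(\<Sum>k\<in>{a..<b}. \<epsilon> / 2 ^ (k + 1)) = \<epsilon> / 2 ^ a - \<epsilon> / 2 ^ b"
    using True
  proof (induction b rule: dec_induct)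
    case (step n)
    have "\<epsilon> / 2 ^ n = \<epsilon> / 2 ^ Suc n + \<epsilon> / 2 ^ Suc n" by simp
    then show ?case using step by simp
  qed simp
  then show ?thesis using assms by simp
qed (use assms in auto)

text \<open>The thresholds in \<open>sparse_below\<close> depend on the level, so it does not pass
  to infinite unions by itself. Finitely many levels are treated by it; the tail is controlled by
  the bound of \<open>level_exists\<close> that holds for every N. With \<eta> k = \<epsilon> / 2^(k
  + 2) the sparsity constants sum to less than \<epsilon>, and the tail bounds 2 \<eta> k sum to at
  most \<epsilon> / 2^k0.\<close>

lemma discard_set_exists:
  fixes \<epsilon> :: real
  assumes \<epsilon>: "\<epsilon> > 0"
  obtains U where "sparse_below \<epsilon> U"
    "\<And>k::nat. \<exists>n0 W. W > 0 \<and> (\<forall>n i a. n mod W = n0 mod W \<longrightarrow> W < n \<longrightarrow> i < k \<longrightarrow> prime a \<longrightarrow> a \<notin> U \<longrightarrow> \<not> prime (n + i + a))"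
proof -
  define \<eta> where "\<eta> = (\<lambda>k::nat. \<epsilon> / 2 ^ (k + 2))"
  have \<eta>: "\<eta> k > 0" for k using \<epsilon> by (simp add: \<eta>_def)
  have "\<exists>X. \<forall>k. sparse_below (\<eta> k) (X k) \<and> (\<forall>N. real (card (primes_in 0 N \<inter> X k)) \<le> 2 * \<eta> k * real (card (primes_in 0 N)))
     \<and> (\<forall>x\<in>X k. k < x)
     \<and> (\<exists>n0 W. W > 0 \<and> (\<forall>n i a. n mod W = n0 mod W \<longrightarrow> W < n \<longrightarrow> i < k \<longrightarrow> prime a \<longrightarrow> a \<notin> X k \<longrightarrow> \<not> prime (n + i + a)))"
    by (intro choice allI level_exists \<eta>)
  then obtain X where X0: "\<forall>k. sparse_below (\<eta> k) (X k) \<and> (\<forall>N. real (card (primes_in 0 N \<inter> X k)) \<le> 2 * \<eta> k * real (card (primes_in 0 N)))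
     \<and> (\<forall>x\<in>X k. k < x)
     \<and> (\<exists>n0 W. W > 0 \<and> (\<forall>n i a. n mod W = n0 mod W \<longrightarrow> W < n \<longrightarrow> i < k \<longrightarrow> prime a \<longrightarrow> a \<notin> X k \<longrightarrow> \<not> prime (n + i + a)))" ..
  have X: "sparse_below (\<eta> k) (X k)"
    "real (card (primes_in 0 N \<inter> X k)) \<le> 2 * \<eta> k * real (card (primes_in 0 N))"
    "x \<in> X k \<Longrightarrow> k < x"
    "\<exists>n0 W. W > 0 \<and> (\<forall>n i a. n mod W = n0 mod W \<longrightarrow> W < n \<longrightarrow> i < k \<longrightarrow> prime a \<longrightarrow> a \<notin> X k \<longrightarrow> \<not> prime (n + i + a))"
    for k N x using X0[rule_format, of k] by simp_all
  define U where "U = (\<Union>k. X k)"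
  have "sparse_below \<epsilon> U" unfolding sparse_below_def
  proof (intro allI impI)
    fix \<kappa> :: real assume \<kappa>: "\<kappa> > 0"
    obtain k0 where k0: "2 * \<epsilon> / \<kappa> < 2 ^ k0" using real_arch_pow[of 2 "2 * \<epsilon> / \<kappa>"] by auto
    then have k0': "\<epsilon> / 2 ^ k0 \<le> \<kappa> / 2" using \<kappa> by (simp add: field_simps)
    have head: "sparse_below \<epsilon> (\<Union>k<k0. X k)"
    proof (rule sparse_below_mono)
      show "sparse_below (\<Sum>k<k0. \<eta> k) (\<Union>k<k0. X k)" by (rule sparse_below_UN) (rule X)
      have "(\<Sum>k<k0. \<eta> k) \<le> (\<Sum>k\<in>{0..<k0}. \<epsilon> / 2 ^ (k + 1))"
        unfolding atLeast0LessThan \<eta>_def using \<epsilon> by (intro sum_mono) (simp add: field_simps)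
      also have "\<dots> \<le> \<epsilon>" using geometric_tail[OF \<epsilon>, of 0 k0] by simp
      finally show "(\<Sum>k<k0. \<eta> k) \<le> \<epsilon>" .
    qed auto
    have "\<kappa> / 2 > 0" using \<kappa> by simp
    then obtain N0 where N0: "\<And>N s. N \<ge> N0 \<Longrightarrow> s \<le> N \<Longrightarrow> real (card (primes_in s N \<inter> (\<Union>k<k0. X k)))
        \<le> \<epsilon> * real (card (primes_in s N)) + \<kappa> / 2 * real (card (primes_in 0 N))"
      using head unfolding sparse_below_def by blast
    show "\<exists>N0. \<forall>N\<ge>N0. \<forall>s\<le>N. real (card (primes_in s N \<inter> U)) \<le> \<epsilon> * real (card (primes_in s N)) + \<kappa> * real (card (primes_in 0 N))"
    proof (intro exI allI impI)
      fix N s assume N: "N0 \<le> N" "s \<le> N"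
      \<comment> \<open>The tail is counted on all of (0, N], where its bound is available; being a
        small proportion of all primes up to N it is absorbed by the \<kappa> term.\<close>
      have "primes_in s N \<inter> U \<subseteq> (primes_in s N \<inter> (\<Union>k<k0. X k)) \<union> (\<Union>k\<in>{k0..<N}. primes_in 0 N \<inter> X k)"
      proof
        fix p assume p: "p \<in> primes_in s N \<inter> U"
        then obtain k where k: "p \<in> X k" by (auto simp: U_def)
        have "k < N" using X(3)[OF k] p by (auto simp: primes_in_def)
        then show "p \<in> (primes_in s N \<inter> (\<Union>k<k0. X k)) \<union> (\<Union>k\<in>{k0..<N}. primes_in 0 N \<inter> X k)"
          using p k by (cases "k < k0") (auto simp: primes_in_def)
      qed
      then have "card (primes_in s N \<inter> U) \<le> card ((primes_in s N \<inter> (\<Union>k<k0. X k)) \<union> (\<Union>k\<in>{k0..<N}. primes_in 0 N \<inter> X k))"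
        by (intro card_mono) auto
      also have "\<dots> \<le> card (primes_in s N \<inter> (\<Union>k<k0. X k)) + card (\<Union>k\<in>{k0..<N}. primes_in 0 N \<inter> X k)"
        by (rule card_Un_le)
      also have "\<dots> \<le> card (primes_in s N \<inter> (\<Union>k<k0. X k)) + (\<Sum>k\<in>{k0..<N}. card (primes_in 0 N \<inter> X k))"
        by (intro add_left_mono card_UN_le) auto
      finally have "real (card (primes_in s N \<inter> U))
          \<le> real (card (primes_in s N \<inter> (\<Union>k<k0. X k))) + (\<Sum>k\<in>{k0..<N}. real (card (primes_in 0 N \<inter> X k)))"
        by (simp flip: of_nat_sum of_nat_add)
      also have "(\<Sum>k\<in>{k0..<N}. real (card (primes_in 0 N \<inter> X k))) \<le> (\<Sum>k\<in>{k0..<N}. 2 * \<eta> k * real (card (primes_in 0 N)))"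
        by (intro sum_mono X)
      also have "\<dots> = (\<Sum>k\<in>{k0..<N}. \<epsilon> / 2 ^ (k + 1)) * real (card (primes_in 0 N))"
        unfolding sum_distrib_right by (intro sum.cong) (auto simp: \<eta>_def)
      also have "\<dots> \<le> \<kappa> / 2 * real (card (primes_in 0 N))"
        using geometric_tail[OF \<epsilon>, of k0 N] k0' by (intro mult_right_mono) linarith+
      finally show "real (card (primes_in s N \<inter> U)) \<le> \<epsilon> * real (card (primes_in s N)) + \<kappa> * real (card (primes_in 0 N))"
        using N0[OF N] by (simp add: algebra_simps)
    qed
  qed
  moreover have "\<exists>n0 W. W > 0 \<and> (\<forall>n i a. n mod W = n0 mod W \<longrightarrow> W < n \<longrightarrow> i < k \<longrightarrow> prime a \<longrightarrow> a \<notin> U \<longrightarrow> \<not> prime (n + i + a))" for k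
  proof -
    have "X k \<subseteq> U" by (auto simp: U_def)
    then show ?thesis using X(4)[of k] by blast
  qed
  ultimately show ?thesis by (rule that)
qed

section \<open>Greedy selection with an exact density\<close>

lemma card_primes_in_split:
  assumes "s \<le> N"
  shows "card (primes_in 0 N) = card (primes_in 0 s) + card (primes_in s N)"
proof -
  have "primes_in 0 N = primes_in 0 s \<union> primes_in s N" "primes_in 0 s \<inter> primes_in s N = {}"
    using assms by (auto simp: primes_in_def)
  then show ?thesis by (simp add: card_Un_disjoint)
qed

lemma prime_count_at_top: "filterlim (\<lambda>N::nat. real (card (primes_in 0 N))) at_top sequentially"
proof (rule filterlim_at_top_mono[OF _ prime_count_lower])
  have "filterlim (\<lambda>x::real. x / (2 * ln x)) at_top at_top" by real_asymp
  then show "filterlim (\<lambda>N::nat. real N / (2 * ln (real N))) at_top sequentially"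
    by (rule filterlim_compose[OF _ filterlim_real_sequentially])
qed

context
  fixes U :: "nat set" and c :: real
begin

text \<open>A prime outside U is accepted whenever the proportion of accepted primes stays at most
  c. The running count is defined before the set, since membership depends on it.\<close>

primrec greedy :: "nat \<Rightarrow> nat" where
  "greedy 0 = 0"
| "greedy (Suc n) = (if prime (Suc n) \<and> Suc n \<notin> U \<and> real (greedy n) + 1 \<le> c * real (card (primes_in 0 (Suc n)))
     then greedy n + 1 else greedy n)"

definition greedy_set :: "nat set" where
  "greedy_set = {p. prime p \<and> p \<notin> U \<and> real (greedy (p - 1)) + 1 \<le> c * real (card (primes_in 0 p))}"

lemma card_greedy_set: "card (greedy_set \<inter> {1..N}) = greedy N"
proof (induction N)
  case (Suc N)
  show ?case
  proof (cases "Suc N \<in> greedy_set")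
    case True
    then have "greedy_set \<inter> {1..Suc N} = insert (Suc N) (greedy_set \<inter> {1..N})" by auto
    then show ?thesis using True Suc by (simp add: greedy_set_def)
  next
    case False
    then have "greedy_set \<inter> {1..Suc N} = greedy_set \<inter> {1..N}" by (auto simp: le_Suc_eq)
    then show ?thesis using False Suc by (simp add: greedy_set_def)
  qed
qed simp

lemma greedy_upper:
  assumes "c \<ge> 0"
  shows "real (greedy N) \<le> c * real (card (primes_in 0 N))"
proof (induction N)
  case (Suc N)
  have "card (primes_in 0 N) \<le> card (primes_in 0 (Suc N))" by (intro card_mono) (auto simp: primes_in_def)
  then have "c * real (card (primes_in 0 N)) \<le> c * real (card (primes_in 0 (Suc N)))"
    using assms by (intro mult_left_mono) auto
  then show ?case using Suc by auto
qed (use assms in simp)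

text \<open>Counting from the last prime that was refused for being too many.\<close>

lemma greedy_last_refusal:
  "\<exists>s\<le>N. real (greedy s) \<ge> c * real (card (primes_in 0 s)) - 1 \<and> greedy N = greedy s + card (primes_in s N - U)"
proof (induction N)
  case 0
  have "primes_in 0 0 = {}" by (auto simp: primes_in_def)
  then show ?case by simp
next
  case (Suc N)
  then obtain s where s: "s \<le> N" "real (greedy s) \<ge> c * real (card (primes_in 0 s)) - 1"
    "greedy N = greedy s + card (primes_in s N - U)" by blast
  show ?case
  proof (cases "prime (Suc N) \<and> Suc N \<notin> U")
    case True
    show ?thesis
    proof (cases "real (greedy N) + 1 \<le> c * real (card (primes_in 0 (Suc N)))")
      case taken: True
      have "primes_in s (Suc N) - U = insert (Suc N) (primes_in s N - U)" "Suc N \<notin> primes_in s N"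
        using True s(1) by (auto simp: primes_in_def le_Suc_eq)
      then have "card (primes_in s (Suc N) - U) = card (primes_in s N - U) + 1" by simp
      moreover have "greedy (Suc N) = greedy N + 1" using True taken by simp
      ultimately show ?thesis using s by (intro exI[of _ s]) simp
    next
      case False
      have "primes_in (Suc N) (Suc N) = {}" by (auto simp: primes_in_def)
      then show ?thesis using False by (intro exI[of _ "Suc N"]) auto
    qed
  next
    case False
    then have "primes_in s (Suc N) - U = primes_in s N - U" by (auto simp: primes_in_def le_Suc_eq)
    moreover have "greedy (Suc N) = greedy N" using False by auto
    ultimately show ?thesis using s by (intro exI[of _ s]) (auto simp del: greedy.simps)
  qed
qed

text \<open>At the last refusal s the count is within 1 of c times the number of primes up to s;
  afterwards every prime outside U is accepted, which is a proportion of at least 1 - \<epsilon> = c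
  of the primes in (s, N] up to a small multiple of all primes up to N. Since s is arbitrary,
  \<open>sparse_below\<close> has to be uniform in s.\<close>

lemma greedy_density:
  assumes U: "sparse_below \<epsilon> U" and c: "c = 1 - \<epsilon>" "c \<ge> 0"
  shows "(\<lambda>N. real (greedy N) / real (card (primes_in 0 N))) \<longlonglongrightarrow> c"
proof (rule tendstoI)
  fix e :: real assume e: "e > 0"
  then have e3: "e / 3 > 0" by simp
  then obtain N0 where N0: "\<And>N s. N \<ge> N0 \<Longrightarrow> s \<le> N \<Longrightarrow>
      real (card (primes_in s N \<inter> U)) \<le> \<epsilon> * real (card (primes_in s N)) + e / 3 * real (card (primes_in 0 N))"
    using U unfolding sparse_below_def by blast
  have "eventually (\<lambda>N. real (card (primes_in 0 N)) \<ge> max 1 (3 / e)) sequentially"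
    using prime_count_at_top unfolding filterlim_at_top by blast
  then show "eventually (\<lambda>N. dist (real (greedy N) / real (card (primes_in 0 N))) c < e) sequentially"
    using eventually_ge_at_top[of N0]
  proof eventually_elim
    case (elim N)
    define P where "P = real (card (primes_in 0 N))"
    have P: "P \<ge> 1" "P \<ge> 3 / e" using elim by (auto simp: P_def)
    obtain s where s: "s \<le> N" "real (greedy s) \<ge> c * real (card (primes_in 0 s)) - 1"
      "greedy N = greedy s + card (primes_in s N - U)" using greedy_last_refusal[of N] by blast
    have "card (primes_in s N - U) = card (primes_in s N) - card (primes_in s N \<inter> U)"
      by (rule card_Diff_subset_Int) simp
    moreover have "card (primes_in s N \<inter> U) \<le> card (primes_in s N)" by (intro card_mono) auto
    ultimately have "real (card (primes_in s N - U)) = real (card (primes_in s N)) - real (card (primes_in s N \<inter> U))"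
      by (simp add: of_nat_diff)
    also have "\<dots> \<ge> c * real (card (primes_in s N)) - e / 3 * P"
      using N0[OF elim(2) s(1)] by (simp add: c P_def algebra_simps)
    finally have "real (greedy N) \<ge> c * real (card (primes_in 0 s)) - 1 + (c * real (card (primes_in s N)) - e / 3 * P)"
      using s by simp
    also have "c * real (card (primes_in 0 s)) - 1 + (c * real (card (primes_in s N)) - e / 3 * P) = c * P - 1 - e / 3 * P"
      using card_primes_in_split[OF s(1)] by (simp add: P_def algebra_simps)
    finally have "(c * P - 1 - e / 3 * P) / P \<le> real (greedy N) / P" using P by (intro divide_right_mono) auto
    moreover have "(c * P - 1 - e / 3 * P) / P = c - 1 / P - e / 3" using P by (simp add: field_simps)
    moreover have "1 / P \<le> e / 3" using P e by (simp add: field_simps)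
    moreover have "real (greedy N) / P \<le> c" using greedy_upper[OF c(2), of N] P by (simp add: P_def field_simps)
    ultimately show ?case using e by (simp add: P_def dist_real_def abs_less_iff)
  qed
qed

end

section \<open>Passage to the integers and to the notions of largeness\<close>

lemma primes_eq_image: "primes = int ` {p. prime p}"
proof -
  have "x \<in> int ` {p. prime p}" if "prime x" for x :: int
    using that prime_gt_0_int[OF that] by (intro image_eqI[of _ _ "nat x"]) auto
  then show ?thesis by (auto simp: primes_def)
qed

lemma int_image_Int_interval: "int ` A \<inter> {1..int N} = int ` (A \<inter> {1..N})"
  by auto

lemma has_rel_density_int_image:
  assumes A: "A \<subseteq> {p. prime p}"
    and lim: "(\<lambda>N. real (card (A \<inter> {1..N})) / real (card (primes_in 0 N))) \<longlonglongrightarrow> d"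
  shows "has_rel_density primes (int ` A) d"
proof -
  have 1: "int ` A \<inter> primes \<inter> {1..int N} = int ` (A \<inter> {1..N})" for N
    using A int_image_Int_interval[of A N] by (auto simp: primes_eq_image)
  have 2: "primes \<inter> {1..int N} = int ` primes_in 0 N" for N
    unfolding primes_eq_image int_image_Int_interval by (auto simp: primes_in_def)
  have inj: "inj_on int S" for S by (simp add: inj_on_def)
  have "(\<lambda>N. ereal (real (card (int ` A \<inter> primes \<inter> {1..int N})) / real (card (primes \<inter> {1..int N})))) \<longlonglongrightarrow> ereal d"
    unfolding 1 2 card_image[OF inj] using lim by simp
  then show ?thesis unfolding has_rel_density_def upper_rel_density_def lower_rel_density_def
    by (auto intro!: lim_imp_Limsup lim_imp_Liminf)
qed

text \<open>The starting points of the gaps form a residue class, so a long interval of the thick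
  set T contains a whole gap. If the gap is longer than the return time of the syndetic set R, then
  R meets it, giving an element of T \<inter> R outside S.\<close>

lemma piecewise_syndetic_not_subset:
  fixes S :: "int set"
  assumes gap: "\<And>k::nat. \<exists>n0 W. W > 0 \<and> (\<forall>n i. n mod W = n0 mod W \<longrightarrow> W < n \<longrightarrow> i < k \<longrightarrow> int (n + i) \<notin> S)"
    and B: "piecewise_syndetic B"
  shows "\<not> B \<inter> pos_ints \<subseteq> S"
proof
  assume sub: "B \<inter> pos_ints \<subseteq> S"
  obtain T R where TR: "thick T" "syndetic R" "B \<inter> pos_ints = T \<inter> R"
    using B unfolding piecewise_syndetic_def by blast
  obtain F where F: "finite F" "pos_ints \<subseteq> diff_set (R \<inter> pos_ints) F" using TR(2) unfolding syndetic_def by blast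
  have "finite (abs ` F)" using F by simp
  then obtain c0 where c0: "\<And>f. f \<in> F \<Longrightarrow> \<bar>f\<bar> \<le> c0"
    by (metis Max_ge imageI)
  \<comment> \<open>The finite set F may contain integers of both signs. Hence the point n + c is
    tested, and the element of R found lies between n and n + 2 c.\<close>
  define c where "c = nat \<bar>c0\<bar>"
  have c: "\<bar>f\<bar> \<le> int c" if "f \<in> F" for f using c0[OF that] unfolding c_def by linarith
  obtain n0 W where W: "W > 0" "\<And>n i. n mod W = n0 mod W \<Longrightarrow> W < n \<Longrightarrow> i < 2 * c + 1 \<Longrightarrow> int (n + i) \<notin> S"
    using gap[of "2 * c + 1"] by blast
  \<comment> \<open>One W is spent to get beyond W, another to reach the residue class, and 2 c + 1
    is the length of the gap.\<close>
  define L where "L = 2 * W + 2 * c + 1"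
  obtain a where a: "{a + 1..a + int L} \<subseteq> T \<inter> pos_ints" using TR(1) unfolding thick_def by blast
  have "a + 1 \<in> {a + 1..a + int L}" by (simp add: L_def)
  then have "a + 1 \<in> pos_ints" using a by blast
  then have a0: "a \<ge> 0" by (simp add: pos_ints_def)
  define m where "m = a + int W + 1"
  define n where "n = m + (int n0 - m) mod int W"
  have nm: "m \<le> n" "n < m + int W" using W(1) by (auto simp: n_def)
  have "n mod int W = int n0 mod int W" by (simp add: n_def mod_simps)
  define n' where "n' = nat n"
  have n': "int n' = n" using nm a0 by (simp add: n'_def m_def)
  have "int (n' mod W) = int (n0 mod W)" using \<open>n mod int W = int n0 mod int W\<close> by (simp add: zmod_int n')
  then have mod: "n' mod W = n0 mod W" by simp
  have Wn: "W < n'" using nm n' a0 by (simp add: m_def)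
  have "n + int c \<in> pos_ints" using nm a0 by (simp add: pos_ints_def m_def)
  then have "n + int c \<in> diff_set (R \<inter> pos_ints) F" using F(2) by blast
  then obtain x f where x: "x \<in> R" "f \<in> F" "n + int c = x - f" by (auto simp: diff_set_def)
  have xb: "n \<le> x" "x \<le> n + 2 * int c" using c[OF x(2)] x(3) by auto
  define i where "i = nat (x - n)"
  have i: "x = int (n' + i)" "i < 2 * c + 1" using xb n' by (auto simp: i_def)
  have "x \<in> {a + 1..a + int L}" using xb nm by (auto simp: L_def m_def)
  then have "x \<in> T" using a by blast
  then have "x \<in> S" using x(1) TR(3) sub by blast
  moreover have "x \<notin> S" unfolding i(1) by (rule W(2)[OF mod Wn i(2)])
  ultimately show False by blast
qed

theorem theoremC:
  fixes \<epsilon> :: real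
  assumes "\<epsilon> > 0"
  shows "\<exists>A. A \<subseteq> primes
           \<and> (\<exists>d. has_rel_density primes A d \<and> d \<ge> 1 - \<epsilon>)
           \<and> \<not> piecewise_syndetic (diff_set primes A)
           \<and> thickly_syndetic (pos_ints - diff_set primes A)
           \<and> \<not> prime_intersective (pos_ints - diff_set primes A)"
proof -
  \<comment> \<open>The cap 1/2 keeps the density 1 - e positive, as the failure of intersectivity
    requires even for large \<epsilon>.\<close>
  define e where "e = min \<epsilon> (1/2)"
  have e: "e > 0" "e \<le> 1/2" "e \<le> \<epsilon>" using assms by (auto simp: e_def)
  obtain U where U: "sparse_below e U"
    "\<And>k::nat. \<exists>n0 W. W > 0 \<and> (\<forall>n i a. n mod W = n0 mod W \<longrightarrow> W < n \<longrightarrow> i < k \<longrightarrow> prime a \<longrightarrow> a \<notin> U \<longrightarrow> \<not> prime (n + i + a))"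
    by (rule discard_set_exists[OF e(1)]) (rule that)
  define G where "G = greedy_set U (1 - e)"
  define A where "A = int ` G"
  define S where "S = diff_set primes A"
  have G: "prime p" "p \<notin> U" if "p \<in> G" for p using that by (auto simp: G_def greedy_set_def)
  have A: "A \<subseteq> primes" using G(1) by (auto simp: A_def primes_eq_image)
  have dens: "has_rel_density primes A (1 - e)"
    unfolding A_def
  proof (rule has_rel_density_int_image)
    show "G \<subseteq> {p. prime p}" using G(1) by blast
    show "(\<lambda>N. real (card (G \<inter> {1..N})) / real (card (primes_in 0 N))) \<longlonglongrightarrow> 1 - e"
      unfolding G_def card_greedy_set using U(1) e by (intro greedy_density) auto
  qed
  have gap: "\<exists>n0 W. W > 0 \<and> (\<forall>n i. n mod W = n0 mod W \<longrightarrow> W < n \<longrightarrow> i < k \<longrightarrow> int (n + i) \<notin> S)" for k :: nat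
  proof -
    obtain n0 W where W: "W > 0" "\<And>n i a. n mod W = n0 mod W \<Longrightarrow> W < n \<Longrightarrow> i < k \<Longrightarrow> prime a \<Longrightarrow> a \<notin> U \<Longrightarrow> \<not> prime (n + i + a)"
      using U(2)[of k] by blast
    have "int (n + i) \<notin> S" if "n mod W = n0 mod W" "W < n" "i < k" for n i
    proof
      assume "int (n + i) \<in> S"
      then obtain p a where pa: "int (n + i) = int p - int a" "prime p" "a \<in> G"
        by (auto simp: S_def A_def diff_set_def primes_eq_image)
      then have "p = n + i + a" by linarith
      then show False using W(2)[OF that, of a] G[OF pa(3)] pa(2) by simp
    qed
    then show ?thesis using W(1) by blast
  qed
  have npws: "\<not> B \<inter> pos_ints \<subseteq> S" if "piecewise_syndetic B" for B
    using gap that by (rule piecewise_syndetic_not_subset)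
  have "\<not> piecewise_syndetic S" using npws[of S] by blast
  moreover have "thickly_syndetic (pos_ints - S)"
    unfolding thickly_syndetic_def
  proof (intro allI impI)
    fix B assume "B \<subseteq> pos_ints \<and> piecewise_syndetic B"
    then show "(pos_ints - S) \<inter> pos_ints \<inter> B \<noteq> {}" using npws[of B] by blast
  qed
  \<comment> \<open>The set A itself is the witness: it has positive density, and its differences
    are differences of a prime and an element of A.\<close>
  moreover have "\<not> prime_intersective (pos_ints - S)"
  proof
    assume "prime_intersective (pos_ints - S)"
    moreover have "upper_rel_density primes A > 0" using dens e by (simp add: has_rel_density_def)
    ultimately have "(pos_ints - S) \<inter> diff_set A A \<noteq> {}" using A unfolding prime_intersective_def by blast
    moreover have "diff_set A A \<subseteq> S" using A by (auto simp: S_def diff_set_def)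
    ultimately show False by blast
  qed
  ultimately show ?thesis unfolding S_def using A dens e by (intro exI[of _ A] conjI exI[of _ "1 - e"]) auto
qed

end
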